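(* Let $\Omega\subset\mathbb{R}^2$ be a bounded smooth annular domain with interior boundary $\gamma_I$ and external boundary $\gamma_E$. Suppose that $\psi\in C^1(\overline{\Omega})$, that $H$ is a given real constant, that $\psi(x)\ge H$ on $\gamma_E$, and that $\psi$ has $N$ local maximal points on $\gamma_E$. Let $u$ be a non-constant solution of the boundary value problem $$\sum_{i,j=1}^{2}a_{ij}(\nabla u)\frac{\partial^2 u}{\partial x_i\partial x_j}=0\ \text{ in }\Omega,\qquad u|_{\gamma_I}=H,\quad u|_{\gamma_E}=\psi.$$ Then $u$ has finitely many interior critical points $x_1,\dots,x_k$ in $\Omega$, and $$\sum_{i=1}^{k}m_i\le N,$$ where $m_1,\dots,m_k$ are the multiplicities of the critical points $x_1,\dots,x_k$ respectively.
   Context: An annular domain is a bounded planar domain whose boundary consists of two disjoint simple closed curves, the interior one $\gamma_I$ and the external one $\gamma_E$. The coefficients $a_{ij}$ are smooth functions of $\nabla u$ and the operator $L$, $Lu=\sum_{i,j=1}^2 a_{ij}(\nabla u)u_{x_ix_j}$, is uniformly elliptic in $\Omega$ (there are constants $0<\lambda\le\Lambda$ with $\lambda|\xi|^2\le\sum_{i,j}a_{ij}(\nabla u(x))\xi_i\xi_j\le\Lambda|\xi|^2$ for all $x\in\Omega$, $\xi\in\mathbb{R}^2$). "Solution" means a classical solution attaining its boundary values continuously. Local maximal points on $\gamma_E$ are those of the restriction $\psi|_{\gamma_E}$. An interior critical point is a point $x_0\in\Omega$ with $\nabla u(x_0)=0$; its multiplicity is the integer $m\ge1$ such that, in a neighborhood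 of $x_0$, the level set $\{x\in\Omega:u(x)=u(x_0)\}$ consists of $m+1$ simple arcs intersecting at $x_0$ (as given by the Hartman–Wintner theorem). An empty sum is $0$. *)

theory Defs
  imports "HOL-Analysis.Analysis"
begin

text \<open>\<open>Ck_on k S f\<close> is meant for open \<open>S\<close>: all iterated directional derivatives of \<open>f\<close> of order
  less than \<open>k\<close> are Frechet differentiable on \<open>S\<close>, and those of order \<open>k\<close> are continuous there.\<close>

primrec Ck_on :: "nat \<Rightarrow> 'a::real_normed_vector set \<Rightarrow> ('a \<Rightarrow> 'b::real_normed_vector) \<Rightarrow> bool" where
  "Ck_on 0 S f \<longleftrightarrow> continuous_on S f"
| "Ck_on (Suc k) S f \<longleftrightarrow>
     (\<forall>x\<in>S. f differentiable (at x)) \<and> (\<forall>v. Ck_on k S (\<lambda>x. frechet_derivative f (at x) v))"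

definition smooth_on :: "'a::real_normed_vector set \<Rightarrow> ('a \<Rightarrow> 'b::real_normed_vector) \<Rightarrow> bool" where
  "smooth_on S f \<longleftrightarrow> (\<forall>k. Ck_on k S f)"

text \<open>\<open>C\<^sup>1\<close> up to the boundary: \<open>f\<close> is continuous on the closure of the open set \<open>\<Omega>\<close>, and its gradient
  on \<open>\<Omega>\<close> extends continuously to the closure.\<close>

definition C1_on_closure :: "'a::real_inner set \<Rightarrow> ('a \<Rightarrow> real) \<Rightarrow> bool" where
  "C1_on_closure \<Omega> f \<longleftrightarrow>
     continuous_on (closure \<Omega>) f \<and>
     (\<exists>G. continuous_on (closure \<Omega>) G \<and> (\<forall>x\<in>\<Omega>. GDERIV f x :> G x))"

definition partial :: "'n::finite \<Rightarrow> (real^'n \<Rightarrow> real) \<Rightarrow> real^'n \<Rightarrow> real" where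
  "partial i f x = frechet_derivative f (at x) (axis i 1)"

definition grad :: "(real^'n::finite \<Rightarrow> real) \<Rightarrow> real^'n \<Rightarrow> real^'n" where
  "grad f x = (\<chi> i. partial i f x)"

text \<open>Regularity and periodicity are imposed on the whole real line, so that the curve is also
  smooth across the base point of its parametrization.\<close>

definition smooth_simple_closed_curve :: "(real^2) set \<Rightarrow> bool" where
  "smooth_simple_closed_curve \<gamma> \<longleftrightarrow>
     (\<exists>c :: real \<Rightarrow> real^2.
        smooth_on UNIV c \<and> (\<forall>t. c (t + 1) = c t) \<and> (\<forall>t. vector_derivative c (at t) \<noteq> 0) \<and>
        simple_path c \<and> path_image c = \<gamma>)"

definition smooth_annular_domain :: "(real^2) set \<Rightarrow> (real^2) set \<Rightarrow> (real^2) set \<Rightarrow> bool" where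
  "smooth_annular_domain \<Omega> \<gamma>I \<gamma>E \<longleftrightarrow>
     open \<Omega> \<and> connected \<Omega> \<and> \<Omega> \<noteq> {} \<and> bounded \<Omega> \<and>
     smooth_simple_closed_curve \<gamma>I \<and> smooth_simple_closed_curve \<gamma>E \<and>
     \<gamma>I \<inter> \<gamma>E = {} \<and> \<gamma>I \<subseteq> inside \<gamma>E \<and> frontier \<Omega> = \<gamma>I \<union> \<gamma>E"

text \<open>The matrix \<open>(a\<^sub>i\<^sub>j(\<nabla>u(x)))\<close> is not required to be symmetric.\<close>

definition uniformly_elliptic_along ::
  "(2 \<Rightarrow> 2 \<Rightarrow> real^2 \<Rightarrow> real) \<Rightarrow> (real^2) set \<Rightarrow> (real^2 \<Rightarrow> real) \<Rightarrow> bool" where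
  "uniformly_elliptic_along a \<Omega> u \<longleftrightarrow>
     (\<exists>l L. 0 < l \<and> l \<le> L \<and>
        (\<forall>x\<in>\<Omega>. \<forall>\<xi>::real^2.
           l * (norm \<xi>)\<^sup>2 \<le> (\<Sum>i\<in>UNIV. \<Sum>j\<in>UNIV. a i j (grad u x) * \<xi> $ i * \<xi> $ j) \<and>
           (\<Sum>i\<in>UNIV. \<Sum>j\<in>UNIV. a i j (grad u x) * \<xi> $ i * \<xi> $ j) \<le> L * (norm \<xi>)\<^sup>2))"

definition classical_solution ::
  "(2 \<Rightarrow> 2 \<Rightarrow> real^2 \<Rightarrow> real) \<Rightarrow> (real^2) set \<Rightarrow> (real^2 \<Rightarrow> real) \<Rightarrow> bool" where
  "classical_solution a \<Omega> u \<longleftrightarrow>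
     Ck_on 2 \<Omega> u \<and> continuous_on (closure \<Omega>) u \<and>
     (\<forall>x\<in>\<Omega>. (\<Sum>i\<in>UNIV. \<Sum>j\<in>UNIV. a i j (grad u x) * partial i (partial j u) x) = 0)"

text \<open>Maxima are not required to be strict; the points of a plateau all count.\<close>

definition local_max_points :: "'a::metric_space set \<Rightarrow> ('a \<Rightarrow> real) \<Rightarrow> 'a set" where
  "local_max_points S f = {p \<in> S. \<exists>e>0. \<forall>y\<in>S \<inter> ball p e. f y \<le> f p}"

definition critical_points :: "(real^2) set \<Rightarrow> (real^2 \<Rightarrow> real) \<Rightarrow> (real^2) set" where
  "critical_points \<Omega> u = {x \<in> \<Omega>. grad u x = 0}"

text \<open>On some neighbourhood \<open>V\<close> of \<open>x0\<close> the level set of \<open>u\<close> through \<open>x0\<close> is a union of \<open>m + 1\<close>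
  simple arcs that all pass through \<open>x0\<close> and have no other common points. Arcs are compact, so \<open>V\<close>
  is not required to be open. That \<open>x0\<close> is not an endpoint of any arc makes \<open>m\<close> unique: the level
  set has \<open>2 * (m + 1)\<close> branches at \<open>x0\<close>.\<close>

definition is_multiplicity :: "(real^2) set \<Rightarrow> (real^2 \<Rightarrow> real) \<Rightarrow> real^2 \<Rightarrow> nat \<Rightarrow> bool" where
  "is_multiplicity \<Omega> u x0 m \<longleftrightarrow>
     m \<ge> 1 \<and>
     (\<exists>V (g :: nat \<Rightarrow> real \<Rightarrow> real^2).
        x0 \<in> interior V \<and> V \<subseteq> \<Omega> \<and>
        (\<forall>i\<le>m. arc (g i) \<and> x0 \<in> path_image (g i) - {pathstart (g i), pathfinish (g i)}) \<and>
        (\<forall>i\<le>m. \<forall>j\<le>m. i \<noteq> j \<longrightarrow> path_image (g i) \<inter> path_image (g j) = {x0}) \<and>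
        {x \<in> V. u x = u x0} = (\<Union>i\<le>m. path_image (g i)))"

definition multiplicity_at :: "(real^2) set \<Rightarrow> (real^2 \<Rightarrow> real) \<Rightarrow> real^2 \<Rightarrow> nat" where
  "multiplicity_at \<Omega> u x0 = (THE m. is_multiplicity \<Omega> u x0 m)"

end

theory Submission
  imports Defs "HOL-Complex_Analysis.Complex_Analysis"
begin

text \<open>At a critical point \<open>x0\<close> a linear change of variables turns the operator at \<open>x0\<close> into the
  Laplacian, and the complex gradient \<open>f\<close> satisfies \<open>norm (dbar f) \<le> M * norm f\<close>. Cauchy--Pompeiu
  estimates on circles show that such an \<open>f\<close> vanishes near the point or has a leading term
  \<open>c * z ^ k\<close> with \<open>c \<noteq> 0\<close>; connectedness of the domain excludes the first case. So \<open>u\<close> looks like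
  \<open>Re (z ^ n)\<close> with \<open>n \<ge> 2\<close>: its level set consists of \<open>n\<close> arcs through \<open>x0\<close>, the multiplicity is
  \<open>n - 1\<close>, and \<open>u\<close> has no local extremum in the domain.

  Extend \<open>u\<close> by \<open>H\<close> to the bounded complementary component, so that it lives on the inside of the
  outer curve. By the maximum principle the \<open>n\<close> negative sectors at a critical point of level \<open>t\<close>
  lie in \<open>n\<close> different components of the sublevel set \<open>t\<close>, and each component contains the
  extended part or touches the outer curve at a local minimum of \<open>\<psi>\<close>. Hence, when the critical points
  are added in the order of their levels, the mergers number at most the local minima of \<open>\<psi>\<close>,
  which are not more than the local maxima.\<close>

section \<open>Cauchy--Pompeiu estimates\<close>

text \<open>\<open>u\<close> is only \<open>C^2\<close>, so \<open>f\<close> is merely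
  \<open>C^1\<close>. The inequality for dbar \<open>f\<close> comes from freezing the coefficients
  at gradient 0: \<open>a i j (grad u) - a i j 0\<close> is of the order of \<open>grad u\<close>,
  and second derivatives are locally bounded. No area integral occurs: circle means are
  differentiated along a homotopy, and up to a total derivative in the angle only dbar
  \<open>f\<close> contributes. Orders of vanishing are measured with half a power of the radius to
  spare, because integer orders would produce logarithms. The hole is filled with the value
  \<open>H\<close> because a loop at a saddle may surround it. Since \<open>H\<close> is the minimum
  of the extended function, the maximum principle survives inside such a loop; a minimum principle
  would not. Hence sublevel sets, and therefore minima of \<open>\<psi>\<close>, are counted.
  Critical points could accumulate at the boundary, so isolation does not give finiteness; the bound
  is proved for each finite set of critical points, and each of them contributes at least 1.\<close>

definition wirtinger_C1 :: "complex set \<Rightarrow> (complex \<Rightarrow> complex) \<Rightarrow> (complex \<Rightarrow> complex) \<Rightarrow> (complex \<Rightarrow> complex) \<Rightarrow> bool" where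
  "wirtinger_C1 S f p q \<longleftrightarrow> continuous_on S p \<and> continuous_on S q \<and>
     (\<forall>z\<in>S. (f has_derivative (\<lambda>h. p z * h + q z * cnj h)) (at z))"

definition unit_turn :: "real \<Rightarrow> complex" where
  "unit_turn x = exp (2 * of_real pi * \<i> * of_real x)"

text \<open>In contour terms this is the integral of \<open>g z / z\<close> over the circle, divided
  by \<open>2 * pi * \<i>\<close>; the factors \<open>z\<close> in later integrands compensate for
  the denominator.\<close>

definition circle_mean :: "real \<Rightarrow> (complex \<Rightarrow> complex) \<Rightarrow> complex" where
  "circle_mean r g = integral {0..1} (\<lambda>x. g (of_real r * unit_turn x))"

lemma norm_unit_turn [simp]: "norm (unit_turn x) = 1"
  by (simp add: unit_turn_def)

lemma unit_turn_0_1 [simp]: "unit_turn 0 = 1" "unit_turn 1 = 1"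
  by (auto simp: unit_turn_def)

lemma unit_turn_nonzero [simp]: "unit_turn x \<noteq> 0"
  by (simp add: unit_turn_def)

lemma unit_turn_cnj [simp]: "cnj (unit_turn x) * unit_turn x = 1" "unit_turn x * cnj (unit_turn x) = 1"
  using complex_norm_square[of "unit_turn x"] by (auto simp: mult.commute)

lemma unit_turn_vector_derivative:
  "(unit_turn has_vector_derivative (2 * of_real pi * \<i> * unit_turn x)) (at x within S)"
  unfolding unit_turn_def
  by (rule has_vector_derivative_eq_rhs, rule has_vector_derivative_real_field, (rule derivative_eq_intros refl | simp)+)

lemma continuous_on_unit_turn [continuous_intros]:
  "continuous_on S g \<Longrightarrow> continuous_on S (\<lambda>x. unit_turn (g x))"
  unfolding unit_turn_def by (intro continuous_intros)

lemma wirtinger_vector_derivative: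
  assumes "wirtinger_C1 S f p q" "c x \<in> S" "(c has_vector_derivative c') (at x within T)"
  shows "((\<lambda>x. f (c x)) has_vector_derivative (p (c x) * c' + q (c x) * cnj c')) (at x within T)"
proof -
  have "(f has_derivative (\<lambda>h. p (c x) * h + q (c x) * cnj h)) (at (c x))"
    using assms by (auto simp: wirtinger_C1_def)
  from has_derivative_compose[OF assms(3)[unfolded has_vector_derivative_def] this]
  show ?thesis
    unfolding has_vector_derivative_def
    by (rule has_derivative_eq_rhs) (simp add: fun_eq_iff algebra_simps scaleR_conv_of_real)
qed

lemma wirtinger_C1_subset: "wirtinger_C1 S f p q \<Longrightarrow> T \<subseteq> S \<Longrightarrow> wirtinger_C1 T f p q"
  by (auto simp: wirtinger_C1_def intro: continuous_on_subset)

lemma wirtinger_C1_continuous: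
  assumes "wirtinger_C1 S f p q" shows "continuous_on S f" "continuous_on S p" "continuous_on S q"
  using assms has_derivative_continuous
  by (auto simp: wirtinger_C1_def intro!: continuous_at_imp_continuous_on) blast

lemma wirtinger_C1_mult:
  assumes "wirtinger_C1 S f p q" "wirtinger_C1 S g p' q'"
  shows "wirtinger_C1 S (\<lambda>z. f z * g z) (\<lambda>z. f z * p' z + p z * g z) (\<lambda>z. f z * q' z + q z * g z)"
proof -
  note c = wirtinger_C1_continuous[OF assms(1)] wirtinger_C1_continuous[OF assms(2)]
  have "((\<lambda>z. f z * g z) has_derivative (\<lambda>h. (f z * p' z + p z * g z) * h + (f z * q' z + q z * g z) * cnj h)) (at z)"
    if "z \<in> S" for z
    using assms that unfolding wirtinger_C1_def
    by (intro has_derivative_eq_rhs[OF has_derivative_mult]) (auto simp: algebra_simps)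
  then show ?thesis
    unfolding wirtinger_C1_def using c by (auto intro!: continuous_intros)
qed

lemma wirtinger_C1_holomorphic:
  assumes "g holomorphic_on S" "open S"
  shows "wirtinger_C1 S g (deriv g) (\<lambda>_. 0)"
  unfolding wirtinger_C1_def
  using assms holomorphic_derivI[of g S] holomorphic_deriv[of g S]
  by (auto simp: has_field_derivative_def intro: holomorphic_on_imp_continuous_on)

text \<open>A one-dimensional substitute for Stokes' formula. The integral of \<open>A s\<close> has
  the integral of \<open>As s\<close> as its derivative, and subtracting \<open>Bx s\<close>, the
  derivative of a function with equal end values, does not change it. So a bound on the difference
  controls the variation. \<open>B\<close> is only asked for inside the interval because it is
  singular at \<open>s = 0\<close> in one application.\<close>

lemma homotopy_integral_bound:
  fixes A B As Bx :: "real \<Rightarrow> real \<Rightarrow> complex" and C \<phi> :: "real \<Rightarrow> real"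
  assumes "a < b"
    and dA: "\<And>s x. s \<in> {a..b} \<Longrightarrow> x \<in> {0..1} \<Longrightarrow> ((\<lambda>s. A s x) has_vector_derivative As s x) (at s within {a..b})"
    and cAs: "continuous_on ({a..b} \<times> {0..1}) (\<lambda>(s, x). As s x)"
    and cA: "\<And>s. s \<in> {a..b} \<Longrightarrow> continuous_on {0..1} (A s)"
    and dB: "\<And>s x. s \<in> {a<..<b} \<Longrightarrow> x \<in> {0..1} \<Longrightarrow> ((\<lambda>x. B s x) has_vector_derivative Bx s x) (at x within {0..1})"
    and B01: "\<And>s. s \<in> {a<..<b} \<Longrightarrow> B s 0 = B s 1"
    and bnd: "\<And>s x. s \<in> {a<..<b} \<Longrightarrow> x \<in> {0..1} \<Longrightarrow> norm (As s x - Bx s x) \<le> C s"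
    and c\<phi>: "continuous_on {a..b} \<phi>"
    and d\<phi>: "\<And>s. s \<in> {a<..<b} \<Longrightarrow> (\<phi> has_real_derivative C s) (at s)"
  shows "norm (integral {0..1} (A b) - integral {0..1} (A a)) \<le> \<phi> b - \<phi> a"
proof -
  let ?F = "\<lambda>s. integral {0..1} (A s)"
  let ?F' = "\<lambda>s. integral {0..1} (As s)"
  have dF: "(?F has_vector_derivative ?F' s) (at s within {a..b})" if "s \<in> {a..b}" for s
    using leibniz_rule_vector_derivative[of "{a..b}" 0 1 A As s]
      dA cAs integrable_continuous_interval[OF cA] that by simp
  have cF: "continuous_on {a..b} ?F"
    using dF by (meson continuous_on_eq_continuous_within has_vector_derivative_continuous)
  have cAs': "continuous_on {0..1} (As s)" if "s \<in> {a..b}" for s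
  proof -
    have "continuous_on {0..1} (\<lambda>x. (case (s, x) of (s, x) \<Rightarrow> As s x))"
      by (rule continuous_on_compose2[OF cAs]) (use that in \<open>auto intro!: continuous_on_Pair continuous_on_const continuous_on_id\<close>)
    then show ?thesis by simp
  qed
  have nF: "norm (?F' s) \<le> C s" if s: "s \<in> {a<..<b}" for s
  proof -
    have "(Bx s has_integral (B s 1 - B s 0)) {0..1}"
      by (rule fundamental_theorem_of_calculus) (use dB s in auto)
    then have B0: "(Bx s has_integral 0) {0..1}" using B01 s by simp
    have "(As s has_integral ?F' s) {0..1}"
      using cAs' s by (intro integrable_integral integrable_continuous_interval) auto
    from has_integral_diff[OF this B0]
    have "((\<lambda>x. As s x - Bx s x) has_integral ?F' s) {0..1}" by simp
    moreover have "0 \<le> C s" using order_trans[OF norm_ge_zero bnd[OF s, of 0]] by simp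
    ultimately have "norm (?F' s) \<le> C s * measure lborel (cbox 0 (1::real))"
      by (intro has_integral_bound[of "C s" "\<lambda>x. As s x - Bx s x"]) (simp_all add: bnd[OF s])
    then show ?thesis by simp
  qed
  show ?thesis
  proof (rule differentiable_bound_general[OF \<open>a < b\<close> cF c\<phi>])
    fix x assume x: "a < x" "x < b"
    show "(?F has_vector_derivative ?F' x) (at x)"
      using dF[of x] x by (simp add: at_within_Icc_at)
    show "(\<phi> has_vector_derivative C x) (at x)"
      using d\<phi>[of x] x by (simp add: has_real_derivative_iff_has_vector_derivative)
    show "norm (?F' x) \<le> C x" using nF x by simp
  qed
qed

text \<open>For holomorphic \<open>G\<close> the contour integral would not depend on the radius;
  its rate of change is governed by \<open>q\<close> alone.\<close>

lemma circle_mean_annulus: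
  fixes C \<phi> :: "real \<Rightarrow> real"
  assumes W: "wirtinger_C1 S G p q" and ab: "0 < a" "a < b"
    and S: "\<And>z. a \<le> norm z \<Longrightarrow> norm z \<le> b \<Longrightarrow> z \<in> S"
    and qb: "\<And>z. a < norm z \<Longrightarrow> norm z < b \<Longrightarrow> 2 * norm z * norm (q z) \<le> C (norm z)"
    and c\<phi>: "continuous_on {a..b} \<phi>"
    and d\<phi>: "\<And>s. s \<in> {a<..<b} \<Longrightarrow> (\<phi> has_real_derivative C s) (at s)"
  shows "norm (circle_mean b (\<lambda>z. G z * z) - circle_mean a (\<lambda>z. G z * z)) \<le> \<phi> b - \<phi> a"
proof -
  let ?z = "\<lambda>s x. of_real s * unit_turn x"
  let ?A = "\<lambda>s x. G (?z s x) * ?z s x"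
  let ?As = "\<lambda>s x. (p (?z s x) * unit_turn x + q (?z s x) * cnj (unit_turn x)) * ?z s x + G (?z s x) * unit_turn x"
  let ?B = "\<lambda>s x. G (?z s x) * unit_turn x / (2 * of_real pi * \<i>)"
  let ?Bx = "\<lambda>s x. p (?z s x) * of_real s * unit_turn x * unit_turn x - q (?z s x) * of_real s + G (?z s x) * unit_turn x"
  note c = wirtinger_C1_continuous[OF W]
  have zS: "?z s x \<in> S" if "s \<in> {a..b}" for s x
    using that ab S[of "?z s x"] by (auto simp: norm_mult)
  have cz: "continuous_on ({a..b} \<times> {0..1}) (\<lambda>y. h (?z (fst y) (snd y)))" if "continuous_on S h" for h :: "complex \<Rightarrow> complex"
    by (rule continuous_on_compose2[OF that]) (use zS in \<open>auto intro!: continuous_intros\<close>)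
  have cz2: "continuous_on {0..1} (\<lambda>y. h (?z s y))" if "continuous_on S h" "s \<in> {a..b}" for h :: "complex \<Rightarrow> complex" and s
    by (rule continuous_on_compose2[OF that(1)]) (use zS that in \<open>auto intro!: continuous_intros\<close>)
  have dz: "((\<lambda>s. ?z s x) has_vector_derivative unit_turn x) (at s within T)" for s x T
    unfolding has_vector_derivative_def
    by (auto intro!: derivative_eq_intros simp: scaleR_conv_of_real)
  have dz2: "((\<lambda>x. ?z s x) has_vector_derivative of_real s * (2 * of_real pi * \<i> * unit_turn x)) (at x within T)" for s x T
    by (intro has_vector_derivative_mult_right unit_turn_vector_derivative)
  show ?thesis
    unfolding circle_mean_def
  proof (rule homotopy_integral_bound[where As="?As" and B="?B" and Bx="?Bx" and C=C])
    fix s x :: real assume s: "s \<in> {a..b}" and x: "x \<in> {0..1}"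
    show "((\<lambda>s. ?A s x) has_vector_derivative ?As s x) (at s within {a..b})"
      by (rule has_vector_derivative_eq_rhs[OF has_vector_derivative_mult[OF wirtinger_vector_derivative[OF W _ dz] dz]])
        (use zS s in \<open>auto simp: algebra_simps\<close>)
  next
    fix s x :: real assume s: "s \<in> {a<..<b}" and x: "x \<in> {0..1}"
    have "((\<lambda>x. G (?z s x) * unit_turn x) has_vector_derivative 2 * of_real pi * \<i> * ?Bx s x) (at x within {0..1})"
      by (rule has_vector_derivative_eq_rhs[OF has_vector_derivative_mult[OF wirtinger_vector_derivative[OF W _ dz2] unit_turn_vector_derivative]])
        (use zS s in \<open>auto simp: algebra_simps\<close>)
    from has_vector_derivative_divide[OF this, of "2 * of_real pi * \<i>"]
    show "(?B s has_vector_derivative ?Bx s x) (at x within {0..1})" by simp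
    \<comment> \<open>\<open>?B\<close> is chosen such that the terms with \<open>p\<close> and with
      \<open>G\<close> cancel and the two terms with \<open>q\<close> add up.\<close>
    have "?As s x - ?Bx s x = 2 * of_real s * q (?z s x)"
      using unit_turn_cnj(1)[of x] by (simp add: algebra_simps)
    moreover have "2 * norm (?z s x) * norm (q (?z s x)) \<le> C (norm (?z s x))"
      using s ab by (intro qb) (auto simp: norm_mult)
    ultimately show "norm (?As s x - ?Bx s x) \<le> C s"
      using s ab by (simp only: norm_mult) (simp add: norm_mult)
  next
    show "continuous_on ({a..b} \<times> {0..1}) (\<lambda>(s, x). ?As s x)"
      unfolding split_beta using cz[OF c(1)] cz[OF c(2)] cz[OF c(3)]
      by (intro continuous_intros) auto
    show "continuous_on {0..1} (?A s)" if "s \<in> {a..b}" for s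
      using cz2[OF c(1) that] by (intro continuous_intros) auto
  qed (use assms in auto)
qed

lemma circle_mean_Cauchy_kernel:
  assumes "norm z0 < R"
  shows "circle_mean R (\<lambda>z. z / (z - z0)) = 1"
proof -
  have R: "0 < R" using assms norm_ge_zero le_less_trans by blast
  have "((\<lambda>u. 1 / (u - z0)) has_contour_integral (2 * of_real pi * \<i> * 1)) (circlepath 0 R)"
    using Cauchy_integral_circlepath[of 0 R "\<lambda>_. 1" z0] assms by auto
  then have "((\<lambda>x. 1 / (circlepath 0 R x - z0) * vector_derivative (circlepath 0 R) (at x within {0..1})) has_integral (2 * of_real pi * \<i>)) {0..1}"
    by (simp add: has_contour_integral_def)
  from has_integral_mult_right[OF this, of "1 / (2 * of_real pi * \<i>)"]
  have "((\<lambda>x. 1 / (2 * of_real pi * \<i>) * (1 / (circlepath 0 R x - z0) * vector_derivative (circlepath 0 R) (at x within {0..1}))) has_integral 1) {0..1}"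
    by simp
  moreover have "1 / (2 * of_real pi * \<i>) * (1 / (circlepath 0 R x - z0) * vector_derivative (circlepath 0 R) (at x within {0..1}))
      = of_real R * unit_turn x / (of_real R * unit_turn x - z0)" if "x \<in> {0..1}" for x
    using that vector_derivative_circlepath01[of x 0 R]
    by (simp add: circlepath unit_turn_def)
  ultimately have "((\<lambda>x. of_real R * unit_turn x / (of_real R * unit_turn x - z0)) has_integral 1) {0..1}"
    by (rule has_integral_eq[rotated]) auto
  then show ?thesis by (simp add: circle_mean_def integral_unique)
qed

text \<open>The circle is contracted to \<open>z0\<close> along segments. Differentiation in
  \<open>s\<close> brings a factor \<open>?w x\<close> which cancels the pole of the kernel, so the
  area term of the Cauchy-Pompeiu formula is estimated without being written down.\<close>

lemma Cauchy_Pompeiu_bound: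
  assumes W: "wirtinger_C1 S f p q" and z0: "norm z0 < R" and S: "cball 0 R \<subseteq> S"
    and qb: "\<And>z. norm z \<le> R \<Longrightarrow> norm (q z) \<le> C"
  shows "norm (f z0 - circle_mean R (\<lambda>z. f z * (z / (z - z0)))) \<le> 2 * R * C"
proof -
  have R: "0 < R" using assms norm_ge_zero le_less_trans by blast
  let ?e = "\<lambda>x. of_real R * unit_turn x"
  let ?w = "\<lambda>x. ?e x - z0"
  let ?z = "\<lambda>s x. z0 + of_real s * ?w x"
  let ?A = "\<lambda>s x. f (?z s x) * (?e x / ?w x)"
  let ?As = "\<lambda>s x. (p (?z s x) * ?w x + q (?z s x) * cnj (?w x)) * (?e x / ?w x)"
  let ?B = "\<lambda>s x. f (?z s x) / (2 * of_real pi * \<i> * of_real s)"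
  let ?Bx = "\<lambda>s x. p (?z s x) * ?e x - q (?z s x) * cnj (?e x)"
  note c = wirtinger_C1_continuous[OF W]
  have w0: "?w x \<noteq> 0" for x
  proof
    assume "?w x = 0"
    then have "norm (?e x) = norm z0" by simp
    then show False using z0 R by (simp add: norm_mult)
  qed
  have nz: "norm (?z s x) \<le> R" if "s \<in> {0..1}" for s x
  proof -
    have "?z s x = (1 - s) *\<^sub>R z0 + s *\<^sub>R ?e x" by (simp add: algebra_simps scaleR_conv_of_real)
    moreover have "z0 \<in> cball 0 R" "?e x \<in> cball 0 R" using z0 R by (auto simp: norm_mult)
    ultimately have "?z s x \<in> cball 0 R"
      using convex_cball[of "0::complex" R] that by (auto simp: convex_alt)
    then show ?thesis by simp
  qed
  have zS: "?z s x \<in> S" if "s \<in> {0..1}" for s x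
    using nz[OF that] S by auto
  have cz: "continuous_on ({0..1} \<times> {0..1}) (\<lambda>y. h (?z (fst y) (snd y)))" if "continuous_on S h" for h :: "complex \<Rightarrow> complex"
    by (rule continuous_on_compose2[OF that], intro continuous_intros, rule image_subsetI, rule zS, auto)
  have cz2: "continuous_on {0..1} (\<lambda>y. h (?z s y))" if "continuous_on S h" "s \<in> {0..1}" for h :: "complex \<Rightarrow> complex" and s
    by (rule continuous_on_compose2[OF that(1)], intro continuous_intros, rule image_subsetI, rule zS[OF that(2)])
  have dz: "((\<lambda>s. ?z s x) has_vector_derivative ?w x) (at s within T)" for s x T
    unfolding has_vector_derivative_def
    by (rule has_derivative_eq_rhs, (rule derivative_intros)+, simp add: scaleR_conv_of_real algebra_simps)
  have dz2: "((\<lambda>x. ?z s x) has_vector_derivative of_real s * (of_real R * (2 * of_real pi * \<i> * unit_turn x))) (at x within T)" for s x T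
  proof -
    have "((\<lambda>x. ?w x) has_vector_derivative of_real R * (2 * of_real pi * \<i> * unit_turn x) - 0) (at x within T)"
      by (intro has_vector_derivative_diff has_vector_derivative_mult_right unit_turn_vector_derivative has_vector_derivative_const)
    from has_vector_derivative_add[OF has_vector_derivative_const[of z0] has_vector_derivative_mult_right[OF this, of "of_real s"]]
    show ?thesis by simp
  qed
  have "norm (integral {0..1} (?A 1) - integral {0..1} (?A 0)) \<le> (2 * R * C) * 1 - (2 * R * C) * 0"
  proof (rule homotopy_integral_bound[where As="?As" and B="?B" and Bx="?Bx" and C="\<lambda>_. 2 * R * C" and \<phi>="\<lambda>s. 2 * R * C * s"])
    fix s x :: real assume s: "s \<in> {0..1}" and x: "x \<in> {0..1}"
    show "((\<lambda>s. ?A s x) has_vector_derivative ?As s x) (at s within {0..1})"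
      by (rule has_vector_derivative_mult_left[OF wirtinger_vector_derivative[OF W _ dz]])
        (use zS s in auto)
  next
    fix s x :: real assume s: "s \<in> {0<..<1}" and x: "x \<in> {0..1}"
    have "((\<lambda>x. f (?z s x)) has_vector_derivative 2 * of_real pi * \<i> * of_real s * ?Bx s x) (at x within {0..1})"
      by (rule has_vector_derivative_eq_rhs[OF wirtinger_vector_derivative[OF W zS dz2]])
        (use s in \<open>auto simp: algebra_simps\<close>)
    from has_vector_derivative_divide[OF this, of "2 * of_real pi * \<i> * of_real s"]
    show "(?B s has_vector_derivative ?Bx s x) (at x within {0..1})" using s by simp
    have "?As s x - ?Bx s x = q (?z s x) * (cnj (?w x) * (?e x / ?w x) + cnj (?e x))"
      using w0[of x] by (simp add: field_simps)
    then have eq: "norm (?As s x - ?Bx s x) = norm (q (?z s x)) * norm (cnj (?w x) * (?e x / ?w x) + cnj (?e x))"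
      by (simp only: norm_mult)
    have "norm (cnj (?w x) * (?e x / ?w x) + cnj (?e x)) \<le> norm (cnj (?w x) * (?e x / ?w x)) + norm (cnj (?e x))"
      by (rule norm_triangle_ineq)
    also have "\<dots> = 2 * R"
      using w0[of x] R by (simp only: norm_mult norm_divide complex_mod_cnj) simp
    finally have "norm (q (?z s x)) * norm (cnj (?w x) * (?e x / ?w x) + cnj (?e x)) \<le> C * (2 * R)"
      using nz[of s x] s R qb norm_ge_zero by (intro mult_mono) (auto intro: order_trans[OF norm_ge_zero qb])
    then show "norm (?As s x - ?Bx s x) \<le> 2 * R * C"
      unfolding eq by (simp only: mult.commute mult.left_commute)
  next
    show "continuous_on ({0..1} \<times> {0..1}) (\<lambda>(s, x). ?As s x)"
      unfolding split_beta using cz[OF c(1)] cz[OF c(2)] cz[OF c(3)] w0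
      by (intro continuous_intros) auto
    show "continuous_on {0..1} (?A s)" if "s \<in> {0..1}" for s
      using cz2[OF c(1) that] w0 by (intro continuous_intros) auto
  qed (auto intro!: continuous_intros derivative_eq_intros)
  moreover have "integral {0..1} (?A 0) = f z0"
    using circle_mean_Cauchy_kernel[OF z0] integral_mult_right[of "{0..1}" "f z0" "\<lambda>x. ?e x / ?w x"]
    by (simp add: circle_mean_def)
  moreover have "integral {0..1} (?A 1) = circle_mean R (\<lambda>z. f z * (z / (z - z0)))"
    by (simp add: circle_mean_def)
  ultimately show ?thesis by (simp add: norm_minus_commute)
qed

section \<open>Unique continuation\<close>

lemma wirtinger_C1_compose_holomorphic:
  assumes W: "wirtinger_C1 S f p q" and g: "g holomorphic_on T" "open T" and fT: "f ` S \<subseteq> T"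
  shows "wirtinger_C1 S (\<lambda>z. g (f z)) (\<lambda>z. deriv g (f z) * p z) (\<lambda>z. deriv g (f z) * q z)"
proof -
  note c = wirtinger_C1_continuous[OF W]
  have c': "continuous_on S (\<lambda>z. deriv g (f z))"
    by (rule continuous_on_compose2[OF holomorphic_on_imp_continuous_on[OF holomorphic_deriv[OF g]] c(1) fT])
  have "((\<lambda>z. g (f z)) has_derivative (\<lambda>h. deriv g (f z) * p z * h + deriv g (f z) * q z * cnj h)) (at z)"
    if "z \<in> S" for z
  proof -
    have "(g has_derivative (\<lambda>h. deriv g (f z) * h)) (at (f z))"
      using holomorphic_derivI[OF g, of "f z"] fT that by (auto simp: has_field_derivative_def)
    moreover have "(f has_derivative (\<lambda>h. p z * h + q z * cnj h)) (at z)"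
      using W that by (auto simp: wirtinger_C1_def)
    ultimately have "((\<lambda>z. g (f z)) has_derivative (\<lambda>h. deriv g (f z) * (p z * h + q z * cnj h))) (at z)"
      by (rule has_derivative_compose[rotated])
    then show ?thesis by (rule has_derivative_eq_rhs) (simp add: algebra_simps)
  qed
  then show ?thesis
    unfolding wirtinger_C1_def using c c' by (auto intro!: continuous_intros)
qed

lemma wirtinger_C1_cnj: "wirtinger_C1 S cnj (\<lambda>_. 0) (\<lambda>_. 1)"
  unfolding wirtinger_C1_def by (auto intro!: derivative_eq_intros)

lemma wirtinger_C1_eq:
  assumes "wirtinger_C1 S f p q" "\<And>z. z \<in> S \<Longrightarrow> q z = q' z"
  shows "wirtinger_C1 S f p q'"
  using assms by (auto simp: wirtinger_C1_def cong: continuous_on_cong)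

lemma wirtinger_C1_mult_holomorphic:
  assumes W: "wirtinger_C1 S f p q" and g: "g holomorphic_on S" "open S"
  obtains p' where "wirtinger_C1 S (\<lambda>z. f z * g z) p' (\<lambda>z. q z * g z)"
proof -
  have "wirtinger_C1 S (\<lambda>z. f z * g z) (\<lambda>z. f z * deriv g z + p z * g z) (\<lambda>z. q z * g z)"
    by (rule wirtinger_C1_eq[OF wirtinger_C1_mult[OF W wirtinger_C1_holomorphic[OF g]]]) simp
  then show ?thesis by (rule that)
qed

text \<open>The cut-off of the regularized inverse power: as \<open>e \<rightarrow> 0\<close> it tends to
  \<open>(1 - (norm z / R)^(2*k)) / z^k\<close>.\<close>

lemma wirtinger_C1_cutoff:
  fixes e R :: real and k :: nat
  assumes e: "0 < e" and R: "0 < R"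
  defines "N \<equiv> \<lambda>z. z * cnj z + of_real e"
  defines "\<eta> \<equiv> \<lambda>z. 1 - (z * cnj z) ^ k / of_real R ^ (2*k)"
  obtains p where "wirtinger_C1 S (\<lambda>z. \<eta> z * (cnj z / N z) ^ k) p
     (\<lambda>z. \<eta> z * (of_nat k * (cnj z / N z) ^ (k - 1) * of_real e / (N z)\<^sup>2)
          - of_nat k * (z * cnj z) ^ (k - 1) * z / of_real R ^ (2*k) * (cnj z / N z) ^ k)"
proof -
  have N0: "N z \<noteq> 0" for z
  proof -
    have "N z = of_real ((norm z)\<^sup>2 + e)" using complex_norm_square[of z] by (simp add: N_def)
    moreover have "(norm z)\<^sup>2 + e > 0" using e by (simp add: add_nonneg_pos)
    ultimately show ?thesis by (simp only: of_real_eq_0_iff)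
  qed
  have W0: "wirtinger_C1 UNIV (\<lambda>z. z * cnj z) (\<lambda>z. cnj z) (\<lambda>z. z)"
    using wirtinger_C1_mult[OF wirtinger_C1_holomorphic[of "\<lambda>z. z" UNIV] wirtinger_C1_cnj]
    by (auto intro!: holomorphic_intros)
  have W1: "wirtinger_C1 UNIV \<eta> (\<lambda>z. - of_nat k * (z * cnj z) ^ (k - 1) / of_real R ^ (2*k) * cnj z)
      (\<lambda>z. - of_nat k * (z * cnj z) ^ (k - 1) / of_real R ^ (2*k) * z)"
  proof -
    have "deriv (\<lambda>w. 1 - w ^ k / of_real R ^ (2*k)) w = - of_nat k * w ^ (k - 1) / of_real R ^ (2*k)" for w :: complex
      using R by (intro DERIV_imp_deriv) (auto intro!: derivative_eq_intros simp: field_simps)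
    moreover have "(\<lambda>w. 1 - w ^ k / of_real R ^ (2*k)) holomorphic_on UNIV"
      by (intro holomorphic_intros) (use R in auto)
    ultimately show ?thesis
      using wirtinger_C1_compose_holomorphic[OF W0, of "\<lambda>w. 1 - w ^ k / of_real R ^ (2*k)" UNIV]
      unfolding \<eta>_def by simp
  qed
  have WN: "wirtinger_C1 UNIV (\<lambda>z. 1 / N z) (\<lambda>z. - 1 / (N z)\<^sup>2 * cnj z) (\<lambda>z. - 1 / (N z)\<^sup>2 * z)"
  proof -
    have "wirtinger_C1 UNIV N (\<lambda>z. cnj z) (\<lambda>z. z)"
      using W0 unfolding wirtinger_C1_def N_def by (auto intro!: derivative_eq_intros)
    moreover have "deriv (\<lambda>w. 1 / w) w = - 1 / w\<^sup>2" if "w \<noteq> 0" for w :: complex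
      by (rule DERIV_imp_deriv) (use that in \<open>auto intro!: derivative_eq_intros simp: power2_eq_square\<close>)
    moreover have "(\<lambda>w. 1 / w) holomorphic_on - {0::complex}"
      by (intro holomorphic_intros) auto
    moreover have "N ` UNIV \<subseteq> - {0}" using N0 by auto
    ultimately show ?thesis
      using wirtinger_C1_compose_holomorphic[of UNIV N _ _ "\<lambda>w. 1 / w" "- {0}"] N0
      by (simp add: open_Compl)
  qed
  have W2: "wirtinger_C1 UNIV (\<lambda>z. cnj z / N z) (\<lambda>z. - cnj z / (N z)\<^sup>2 * cnj z) (\<lambda>z. of_real e / (N z)\<^sup>2)"
  proof -
    have "1 / N z - z * cnj z / (N z)\<^sup>2 = of_real e / (N z)\<^sup>2" for z
      using N0[of z] by (simp add: field_simps power2_eq_square) (simp add: N_def algebra_simps)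
    then have "wirtinger_C1 UNIV (\<lambda>z. cnj z * (1 / N z)) (\<lambda>z. cnj z * (- 1 / (N z)\<^sup>2 * cnj z) + 0 * (1 / N z)) (\<lambda>z. of_real e / (N z)\<^sup>2)"
      by (intro wirtinger_C1_eq[OF wirtinger_C1_mult[OF wirtinger_C1_cnj[of UNIV] WN]]) (simp add: algebra_simps)
    then show ?thesis by simp
  qed
  have W3: "wirtinger_C1 UNIV (\<lambda>z. (cnj z / N z) ^ k) (\<lambda>z. of_nat k * (cnj z / N z) ^ (k - 1) * (- cnj z / (N z)\<^sup>2 * cnj z))
      (\<lambda>z. of_nat k * (cnj z / N z) ^ (k - 1) * (of_real e / (N z)\<^sup>2))"
    using wirtinger_C1_compose_holomorphic[OF W2 holomorphic_on_power[OF holomorphic_on_id], of UNIV k]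
    by (simp add: DERIV_imp_deriv[OF DERIV_power[OF DERIV_ident]])
  show ?thesis
    by (rule that, rule wirtinger_C1_eq, rule wirtinger_C1_mult[OF wirtinger_C1_subset[OF W1 subset_UNIV] wirtinger_C1_subset[OF W3 subset_UNIV]])
      (simp add: algebra_simps)
qed

text \<open>A weighted estimate in the manner of Carleman: \<open>f\<close> times the cut-off
  inverse power \<open>?\<kappa>\<close> vanishes on the circle of radius \<open>R\<close>, so
  Cauchy-Pompeiu bounds it by its dbar derivative. That consists of a part with \<open>q\<close>,
  which is absorbed, and of the derivatives \<open>?d1\<close> of the regularized power and
  \<open>?d2\<close> of the cut-off. The term with \<open>C\<close> disappears as \<open>e\<close>
  tends to 0.\<close>

lemma unique_continuation_estimate:
  fixes f :: "complex \<Rightarrow> complex" and R m M C e :: real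
  assumes W: "wirtinger_C1 S f p q" and S: "cball 0 R \<subseteq> S" and R: "0 < R"
    and q: "\<And>z. norm z \<le> R \<Longrightarrow> norm (q z) \<le> M * norm (f z)" and M: "0 \<le> M" "4 * R * M \<le> 1"
    and m: "\<And>z. norm z \<le> R \<Longrightarrow> norm (f z) \<le> m"
    and C: "\<And>z. norm z \<le> R \<Longrightarrow> norm (f z) \<le> C * norm z ^ (k + 3)"
    and k: "1 \<le> k" and e: "0 < e" and z0: "norm z0 \<le> R / 2"
  shows "norm (f z0) * norm z0 ^ k \<le> ((norm z0)\<^sup>2 + e) ^ k * (8 * R * (m * of_nat k * R ^ (k - 1) / R ^ (2 * k) + C * of_nat k * e))"
proof -
  let ?N = "\<lambda>z. z * cnj z + of_real e :: complex"
  let ?\<eta> = "\<lambda>z. 1 - (z * cnj z) ^ k / of_real R ^ (2*k) :: complex"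
  let ?n = "\<lambda>z. (norm z)\<^sup>2 + e :: real"
  let ?\<kappa> = "\<lambda>z. ?\<eta> z * (cnj z / ?N z) ^ k"
  let ?d1 = "\<lambda>z. ?\<eta> z * (of_nat k * (cnj z / ?N z) ^ (k - 1) * of_real e / (?N z)\<^sup>2)"
  let ?d2 = "\<lambda>z. of_nat k * (z * cnj z) ^ (k - 1) * z / of_real R ^ (2*k) * (cnj z / ?N z) ^ k"
  let ?B = "m * of_nat k * R ^ (k - 1) / R ^ (2 * k) + C * of_nat k * e"
  obtain p1 where "wirtinger_C1 S ?\<kappa> p1 (\<lambda>z. ?d1 z - ?d2 z)"
    using wirtinger_C1_cutoff[OF e R] by blast
  from wirtinger_C1_mult[OF W this]
  obtain p2 where W2: "wirtinger_C1 S (\<lambda>z. f z * ?\<kappa> z) p2 (\<lambda>z. f z * (?d1 z - ?d2 z) + q z * ?\<kappa> z)"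
    by blast
  have zz: "z * cnj z = of_real ((norm z)\<^sup>2)" for z by (simp only: complex_norm_square)
  have nN: "norm (?N z) = ?n z" for z
  proof -
    have "?N z = of_real (?n z)" by (simp add: zz)
    then have "norm (?N z) = \<bar>?n z\<bar>" by (simp only: norm_of_real)
    then show ?thesis using e by simp
  qed
  have n0: "?n z > 0" for z using e by (simp add: add_nonneg_pos)
  have \<eta>: "?\<eta> z = of_real (1 - ((norm z)\<^sup>2)^k / R ^ (2*k))" for z by (simp add: zz)
  have n\<eta>: "norm (?\<eta> z) = \<bar>1 - ((norm z)\<^sup>2)^k / R ^ (2*k)\<bar>" for z
    unfolding \<eta> by (simp only: norm_of_real)
  have \<eta>1: "norm (?\<eta> z) \<le> 1" if "norm z \<le> R" for z
  proof -
    have "((norm z)\<^sup>2)^k \<le> (R\<^sup>2)^k" using that by (intro power_mono) auto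
    then show ?thesis unfolding n\<eta> using R by (simp add: power_mult)
  qed
  have C0: "0 \<le> C"
  proof -
    have "0 \<le> C * R ^ (k + 3)" using order_trans[OF norm_ge_zero C[of "of_real R"]] R by simp
    then show ?thesis using R by (metis zero_less_power zero_le_mult_iff not_less)
  qed
  have b1: "norm (f z * ?d1 z) \<le> C * of_nat k * e" if z: "norm z \<le> R" for z
  proof -
    have "norm (f z * ?d1 z) = norm (f z) * (norm (?\<eta> z) * (of_nat k * (norm z / ?n z) ^ (k-1) * e / (?n z)\<^sup>2))"
      using e by (simp only: norm_mult norm_divide norm_power nN complex_mod_cnj norm_of_real norm_of_nat abs_of_pos)
    also have "\<dots> \<le> (C * norm z ^ (k + 3)) * (1 * (of_nat k * (norm z / ?n z) ^ (k-1) * e / (?n z)\<^sup>2))"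
      using C[OF z] C0 \<eta>1[OF z] e n0[of z] by (intro mult_mono order_refl mult_nonneg_nonneg divide_nonneg_nonneg zero_le_power) (auto intro: order_trans[OF norm_ge_zero C[OF z]])
    also have "\<dots> = C * of_nat k * e * ((norm z ^ (k+3) * norm z ^ (k-1)) / (?n z ^ (k - 1) * (?n z)\<^sup>2))"
      by (simp add: power_divide)
    \<comment> \<open>The order \<open>k + 3\<close> in the bound for \<open>f\<close> is what makes
      the power of \<open>norm z\<close> match the denominator
      \<open>?n z ^ (k + 1)\<close>.\<close>
    also have "norm z ^ (k+3) * norm z ^ (k-1) = ((norm z)\<^sup>2) ^ (k+1)"
      using k by (simp add: power_add[symmetric] power_mult[symmetric])
    also have "?n z ^ (k - 1) * (?n z)\<^sup>2 = ?n z ^ (k+1)"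
      using k by (simp add: power_add[symmetric])
    also have "C * of_nat k * e * (((norm z)\<^sup>2) ^ (k+1) / ?n z ^ (k+1)) \<le> C * of_nat k * e * 1"
      using n0[of z] e C0 by (intro mult_left_mono) (auto simp: divide_le_eq_1 power_mono simp del: power_Suc)
    finally show ?thesis by simp
  qed
  have b2: "norm (f z * ?d2 z) \<le> m * of_nat k * R ^ (k - 1) / R ^ (2 * k)" if z: "norm z \<le> R" for z
  proof -
    have "norm (f z * ?d2 z) = norm (f z) * (of_nat k * ((norm z)\<^sup>2) ^ (k-1) * norm z / R ^ (2*k) * (norm z / ?n z) ^ k)"
      using R by (simp only: norm_mult norm_divide norm_power nN complex_mod_cnj norm_of_real norm_of_nat power2_eq_square abs_of_pos)
    also have "\<dots> = norm (f z) * (of_nat k / R ^ (2*k)) * ((((norm z)\<^sup>2) ^ (k-1) * norm z * norm z ^ k) / ?n z ^ k)"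
      by (simp add: power_divide)
    also have "((norm z)\<^sup>2) ^ (k-1) * norm z * norm z ^ k = norm z ^ (k - 1) * ((norm z)\<^sup>2) ^ k"
      using k by (cases k) (auto simp: power_mult[symmetric] power_add[symmetric] power2_eq_square algebra_simps power_mult_distrib)
    also have "norm (f z) * (of_nat k / R ^ (2*k)) * (norm z ^ (k - 1) * ((norm z)\<^sup>2) ^ k / ?n z ^ k)
        \<le> m * (of_nat k / R ^ (2*k)) * (R ^ (k - 1) * 1)"
    proof (intro mult_mono)
      have "norm z ^ (k - 1) * (((norm z)\<^sup>2) ^ k / ?n z ^ k) \<le> R ^ (k - 1) * 1"
        using n0[of z] e z R by (intro mult_mono power_mono) (auto simp: divide_le_eq_1 power_mono)
      then show "norm z ^ (k - 1) * ((norm z)\<^sup>2) ^ k / ?n z ^ k \<le> R ^ (k - 1) * 1" by simp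
    qed (use m[OF z] R n0[of z] order_trans[OF norm_ge_zero m[OF z]] in \<open>auto intro!: mult_nonneg_nonneg divide_nonneg_nonneg zero_le_power less_imp_le\<close>)
    finally show ?thesis by simp
  qed
  let ?\<phi> = "\<lambda>z. f z * ?\<kappa> z"
  have "compact (cball (0::complex) R)" "cball (0::complex) R \<noteq> {}" using R by auto
  moreover have "continuous_on (cball 0 R) (\<lambda>z. norm (?\<phi> z))"
    using continuous_on_subset[OF wirtinger_C1_continuous(1)[OF W2] S] by (intro continuous_on_norm)
  ultimately obtain z1 where z1: "z1 \<in> cball 0 R" and max: "\<And>z. z \<in> cball 0 R \<Longrightarrow> norm (?\<phi> z) \<le> norm (?\<phi> z1)"
    using continuous_attains_sup by meson
  let ?s = "norm (?\<phi> z1)"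
  have q2: "norm (f z * (?d1 z - ?d2 z) + q z * ?\<kappa> z) \<le> M * ?s + ?B" if z: "norm z \<le> R" for z
  proof -
    have "norm (q z * ?\<kappa> z) \<le> M * norm (f z) * norm (?\<kappa> z)"
      unfolding norm_mult[of "q z"] using q[OF z] by (rule mult_right_mono) simp
    also have "\<dots> = M * norm (?\<phi> z)" by (simp only: norm_mult mult.assoc)
    also have "\<dots> \<le> M * ?s" using max[of z] z M by (intro mult_left_mono) auto
    finally have b3: "norm (q z * ?\<kappa> z) \<le> M * ?s" .
    have "norm (f z * ?d1 z - f z * ?d2 z + q z * ?\<kappa> z) \<le> C * of_nat k * e + m * of_nat k * R ^ (k - 1) / R ^ (2 * k) + M * ?s"
      by (intro norm_triangle_mono b3 order_trans[OF norm_triangle_ineq4 add_mono] b1[OF z] b2[OF z])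
    then show ?thesis by (simp only: right_diff_distrib)
  qed
  have zero: "?\<phi> z = 0" if "norm z = R" for z
    using \<eta>[of z] that R by (simp add: power_mult)
  have mean0: "circle_mean R (\<lambda>z. ?\<phi> z * g z) = 0" for g
    unfolding circle_mean_def
  proof (intro integral_unique has_integral_is_0)
    fix x :: real
    have "norm (of_real R * unit_turn x) = R" using R by (simp add: norm_mult)
    from zero[OF this] show "?\<phi> (of_real R * unit_turn x) * g (of_real R * unit_turn x) = 0"
      by (simp only: mult_zero_left)
  qed
  \<comment> \<open>On the circle the cut-off is 0, so only the dbar term of the Cauchy-Pompeiu
    bound is left.\<close>
  have le: "norm (?\<phi> z) \<le> 2 * R * (M * ?s + ?B)" if z: "norm z < R" for z
    using Cauchy_Pompeiu_bound[OF W2 z S q2] by (simp only: mean0 diff_0_right)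
  have B0: "0 \<le> ?B" using order_trans[OF norm_ge_zero b1[of 0]] order_trans[OF norm_ge_zero b2[of 0]] R by simp
  have "?s \<le> 2 * R * (M * ?s + ?B)"
  proof (cases "norm z1 < R")
    case False
    then have "norm z1 = R" using z1 by auto
    from zero[OF this] have s0: "?s = 0" by (simp only: norm_zero)
    show ?thesis unfolding s0 using B0 R by (simp only: mult_zero_right add_0) simp
  qed (rule le)
  \<comment> \<open>By \<open>4 * R * M \<le> 1\<close> at most half of the supremum stands on the
    right and can be absorbed.\<close>
  also have "\<dots> = (4 * R * M) * ?s / 2 + 2 * R * ?B" by (simp add: algebra_simps)
  also have "\<dots> \<le> 1 * ?s / 2 + 2 * R * ?B"
    by (intro add_mono[OF _ order_refl] divide_right_mono mult_right_mono M(2) norm_ge_zero) simp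
  finally have s: "?s \<le> 4 * R * ?B" by simp
  have z0R: "norm z0 \<le> R" using z0 R by simp
  have "norm (f z0) * (norm (?\<eta> z0) * (norm z0 / ?n z0) ^ k) = norm (?\<phi> z0)"
    by (simp only: norm_mult norm_power norm_divide nN complex_mod_cnj)
  also have "\<dots> \<le> 4 * R * ?B" using max[of z0] s z0R by (simp del: norm_mult)
  finally have *: "norm (f z0) * (norm (?\<eta> z0) * (norm z0 / ?n z0) ^ k) \<le> 4 * R * ?B" .
  have "1 / 2 \<le> norm (?\<eta> z0)"
  proof -
    have "((norm z0)\<^sup>2)^k \<le> ((R/2)\<^sup>2)^k" using z0 by (intro power_mono) auto
    also have "\<dots> = R ^ (2*k) * (1/4)^k" by (simp add: power_mult power_divide)
    also have "(1/4::real)^k \<le> (1/4)^1" using k by (intro power_decreasing) auto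
    finally have "((norm z0)\<^sup>2)^k \<le> R ^ (2*k) * (1/4)" using R by simp
    then have "((norm z0)\<^sup>2)^k / R ^ (2*k) \<le> 1/4" using R by (simp add: divide_le_eq mult.commute)
    then show ?thesis unfolding n\<eta> by linarith
  qed
  then have "norm (f z0) * (1/2 * (norm z0 / ?n z0) ^ k) \<le> norm (f z0) * (norm (?\<eta> z0) * (norm z0 / ?n z0) ^ k)"
    using n0[of z0] by (intro mult_left_mono mult_right_mono) auto
  also note *
  finally have "norm (f z0) * norm z0 ^ k / ?n z0 ^ k \<le> 8 * R * ?B" by (simp add: power_divide)
  then show ?thesis using n0[of z0] by (simp add: pos_divide_le_eq mult.commute)
qed

text \<open>For fixed \<open>k\<close> the regularization is removed first; the factor
  \<open>R ^ (2 * k)\<close> of the cut-off then leaves a bound of the order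
  \<open>k * (norm z0 / R) ^ k\<close>, which tends to 0 with growing \<open>k\<close> because
  \<open>norm z0 \<le> R / 2\<close>.\<close>

lemma unique_continuation_origin:
  fixes f :: "complex \<Rightarrow> complex"
  assumes W: "wirtinger_C1 S f p q" and S: "cball 0 R \<subseteq> S" and R: "0 < R"
    and q: "\<And>z. norm z \<le> R \<Longrightarrow> norm (q z) \<le> M * norm (f z)" and M: "0 \<le> M" "4 * R * M \<le> 1"
    and flat: "\<And>k. \<exists>C. \<forall>z. norm z \<le> R \<longrightarrow> norm (f z) \<le> C * norm z ^ k"
    and z0: "norm z0 \<le> R / 2"
  shows "f z0 = 0"
proof (cases "z0 = 0")
  case True
  obtain C where "\<forall>z. norm z \<le> R \<longrightarrow> norm (f z) \<le> C * norm z ^ 1" using flat by blast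
  then have "norm (f 0) \<le> C * norm (0::complex) ^ 1" using R by (metis norm_zero less_imp_le)
  then show ?thesis using True by simp
next
  case False
  obtain m where m: "\<And>z. norm z \<le> R \<Longrightarrow> norm (f z) \<le> m"
    using flat[of 0] by auto
  have est: "norm (f z0) \<le> 8 * m * (of_nat k * (1/2) ^ k)" if k: "1 \<le> k" for k
  proof -
    obtain C where C: "\<And>z. norm z \<le> R \<Longrightarrow> norm (f z) \<le> C * norm z ^ (k + 3)" using flat by meson
    let ?g = "\<lambda>e. ((norm z0)\<^sup>2 + e) ^ k * (8 * R * (m * of_nat k * R ^ (k - 1) / R ^ (2 * k) + C * of_nat k * e))"
    have "(?g \<longlongrightarrow> ?g 0) (at_right 0)" by (intro tendsto_intros)
    moreover have "eventually (\<lambda>e. norm (f z0) * norm z0 ^ k \<le> ?g e) (at_right 0)"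
      using eventually_at_right_less[of 0]
      by eventually_elim (rule unique_continuation_estimate[OF W S R q M m C k _ z0])
    ultimately have "norm (f z0) * norm z0 ^ k \<le> ?g 0"
      by (rule tendsto_lowerbound) simp
    also have "R ^ (2 * k) = R ^ k * (R * R ^ (k - 1))" using k by (cases k) (auto simp: power_add mult_2)
    then have "?g 0 = (norm z0 ^ k) * (norm z0 ^ k * (8 * m * of_nat k / R ^ k))"
      using R by (simp add: power2_eq_square power_mult_distrib field_simps)
    finally have "norm (f z0) * norm z0 ^ k \<le> (norm z0 ^ k * (8 * m * of_nat k / R ^ k)) * norm z0 ^ k"
      by (simp only: mult.commute)
    then have "norm (f z0) \<le> norm z0 ^ k * (8 * m * of_nat k / R ^ k)"
      by (rule mult_right_le_imp_le) (use False in simp)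
    also have "\<dots> = 8 * m * (of_nat k * (norm z0 / R) ^ k)" by (simp add: power_divide)
    also have "\<dots> \<le> 8 * m * (of_nat k * (1/2) ^ k)"
      using z0 R order_trans[OF norm_ge_zero m[of 0]] by (intro mult_left_mono power_mono) (auto simp: field_simps)
    finally show ?thesis .
  qed
  have "(\<lambda>k. of_nat k * (1/2::real) ^ k) \<longlonglongrightarrow> 0"
    using powser_times_n_limit_0[of "1/2::real"] by simp
  then have "(\<lambda>k. 8 * m * (of_nat k * (1/2::real) ^ k)) \<longlonglongrightarrow> 8 * m * 0"
    by (intro tendsto_intros)
  moreover have "\<forall>\<^sub>F k in sequentially. norm (f z0) \<le> 8 * m * (of_nat k * (1/2::real) ^ k)"
    by (rule eventually_mono[OF eventually_ge_at_top[of 1] est])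
  ultimately have "norm (f z0) \<le> 8 * m * 0" by (rule tendsto_lowerbound) simp
  then show ?thesis by simp
qed

section \<open>The leading term\<close>

lemma limit_from_sqrt_bound:
  fixes F :: "real \<Rightarrow> complex"
  assumes R: "0 < R" and F: "\<And>a b. 0 < a \<Longrightarrow> a < b \<Longrightarrow> b \<le> R \<Longrightarrow> norm (F b - F a) \<le> D * sqrt b"
  obtains c where "\<And>r. 0 < r \<Longrightarrow> r \<le> R \<Longrightarrow> norm (F r - c) \<le> D * sqrt r"
proof -
  have D: "0 \<le> D"
  proof -
    have "0 \<le> D * sqrt R" using order_trans[OF norm_ge_zero F[of "R/2" R]] R by simp
    then show ?thesis using R mult_neg_pos[of D "sqrt R"] by (cases "D < 0") auto
  qed
  let ?r = "\<lambda>n. R / real (Suc n)"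
  have r0: "?r \<longlonglongrightarrow> 0"
    using tendsto_mult_right_zero[OF LIMSEQ_inverse_real_of_nat, of R] by (simp add: divide_inverse)
  have rpos: "0 < ?r n" "?r n \<le> R" for n using R by (auto simp: divide_le_eq)
  have close: "norm (F (?r m) - F (?r n)) \<le> D * sqrt (?r (min m n))" for m n
    using R
  proof (induction m n rule: linorder_wlog)
    case (le m n)
    then show ?case
    proof (cases "m = n")
      case False
      then have "?r n < ?r m" using le R by (intro divide_strict_left_mono) auto
      then show ?thesis using F[of "?r n" "?r m"] rpos[of m] rpos[of n] le by (simp add: min_absorb1)
    qed (use D rpos[of m] in auto)
  next
    case (sym m n)
    then show ?case by (simp add: norm_minus_commute min.commute)
  qed
  have "(\<lambda>n. D * sqrt (?r n)) \<longlonglongrightarrow> D * sqrt 0" by (intro tendsto_intros r0)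
  then have lim0: "(\<lambda>n. D * sqrt (?r n)) \<longlonglongrightarrow> 0" by simp
  have "Cauchy (\<lambda>n. F (?r n))"
  proof (rule metric_CauchyI)
    fix e :: real assume "0 < e"
    then obtain M where M: "\<And>n. n \<ge> M \<Longrightarrow> D * sqrt (?r n) < e"
      using order_tendstoD(2)[OF lim0] by (auto simp: eventually_sequentially)
    show "\<exists>M. \<forall>m\<ge>M. \<forall>n\<ge>M. dist (F (?r m)) (F (?r n)) < e"
    proof (intro exI[of _ M] allI impI)
      fix m n assume "M \<le> m" "M \<le> n"
      then have "M \<le> min m n" by simp
      from le_less_trans[OF close M[OF this]] show "dist (F (?r m)) (F (?r n)) < e"
        by (simp only: dist_norm)
    qed
  qed
  then obtain c where c: "(\<lambda>n. F (?r n)) \<longlonglongrightarrow> c" by (auto simp: Cauchy_convergent_iff convergent_def)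
  show ?thesis
  proof (rule that)
    fix r assume r: "0 < r" "r \<le> R"
    have "(\<lambda>n. norm (F r - F (?r n))) \<longlonglongrightarrow> norm (F r - c)" by (intro tendsto_intros c)
    moreover have "\<forall>\<^sub>F n in sequentially. norm (F r - F (?r n)) \<le> D * sqrt r"
      using order_tendstoD(2)[OF r0 r(1)]
      by eventually_elim (use F r rpos in blast)
    ultimately show "norm (F r - c) \<le> D * sqrt r" by (rule tendsto_upperbound) simp
  qed
qed

lemma le_sqrt_limit:
  assumes "0 < r" and le: "\<And>a. 0 < a \<Longrightarrow> a < r \<Longrightarrow> x \<le> y + D * sqrt a"
  shows "x \<le> y"
proof -
  have "((\<lambda>a. y + D * sqrt a) \<longlongrightarrow> y + D * sqrt 0) (at_right 0)" by (intro tendsto_intros)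
  moreover have "\<forall>\<^sub>F a in at_right 0. x \<le> y + D * sqrt a"
    using eventually_at_right_real[OF assms(1)] by eventually_elim (use le in auto)
  ultimately have "x \<le> y + D * sqrt 0" by (rule tendsto_lowerbound) simp
  then show ?thesis by simp
qed

lemma norm_circle_mean_le:
  assumes "\<And>z. norm z = r \<Longrightarrow> norm (g z) \<le> B" "0 \<le> r" "continuous_on (sphere 0 r) g"
  shows "norm (circle_mean r g) \<le> B"
proof -
  have "continuous_on {0..1} (\<lambda>x. g (of_real r * unit_turn x))"
    by (rule continuous_on_compose2[OF assms(3)]) (use assms(2) in \<open>auto intro!: continuous_intros simp: norm_mult\<close>)
  then have "((\<lambda>x. g (of_real r * unit_turn x)) has_integral circle_mean r g) (cbox 0 1)"
    unfolding circle_mean_def by (simp add: integrable_integral integrable_continuous_interval)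
  moreover have "0 \<le> B" using order_trans[OF norm_ge_zero assms(1)[of "of_real r"]] assms(2) by simp
  ultimately have "norm (circle_mean r g) \<le> B * measure lborel (cbox 0 (1::real))"
    by (intro has_integral_bound) (use assms in \<open>auto simp: norm_mult\<close>)
  then show ?thesis by simp
qed

text \<open>A finite geometric series in \<open>w / z\<close>. Its terms produce the coefficients in
  the expansion of \<open>f\<close>, and the remainder gains \<open>w ^ (k + 1)\<close>.\<close>

lemma geometric_kernel_expansion:
  fixes z w :: complex
  assumes "z \<noteq> 0" "z \<noteq> w"
  shows "z / (z - w) = (\<Sum>j\<le>k. w ^ j / z ^ j) + w ^ (k + 1) * (1 / (z ^ k * (z - w)))"
proof (induction k)
  case 0
  then show ?case using assms by (simp add: field_simps)
next
  case (Suc k)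
  have "w ^ (k + 1) * (1 / (z ^ k * (z - w))) = w ^ Suc k / z ^ Suc k + w ^ (Suc k + 1) * (1 / (z ^ Suc k * (z - w)))"
    using assms by (simp add: field_simps)
  then show ?case using Suc by simp
qed

locale dbar_dominated =
  fixes S f p q and R M :: real
  assumes W: "wirtinger_C1 S f p q" and S: "cball 0 R \<subseteq> S" "open S" and R: "0 < R" "R \<le> 1"
    and q: "\<And>z. norm z \<le> R \<Longrightarrow> norm (q z) \<le> M * norm (f z)" and M: "0 \<le> M"
begin

text \<open>This is the order \<open>k - 1/2\<close>, written without real exponents. The half power
  keeps the integrals over annuli free of logarithms: the variation of the \<open>k\<close>-th
  coefficient is the integral of a multiple of \<open>1 / sqrt s\<close>. Letting \<open>r\<close>
  exceed \<open>norm z\<close> includes the point 0.\<close>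

definition vanishing_order :: "nat \<Rightarrow> real \<Rightarrow> bool" where
  "vanishing_order k C \<longleftrightarrow> (\<forall>r z. 0 < r \<longrightarrow> r \<le> R \<longrightarrow> norm z \<le> r \<longrightarrow> norm (f z) * sqrt r \<le> C * r ^ k)"

lemma vanishing_orderD:
  "vanishing_order k C \<Longrightarrow> 0 < r \<Longrightarrow> r \<le> R \<Longrightarrow> norm z \<le> r \<Longrightarrow> norm (f z) * sqrt r \<le> C * r ^ k"
  by (simp add: vanishing_order_def)

lemma f_continuous: "T \<subseteq> cball 0 R \<Longrightarrow> continuous_on T f"
  using wirtinger_C1_continuous(1)[OF W] S continuous_on_subset by blast

lemma circle_mean_variation:
  assumes V: "vanishing_order k C" and g: "g holomorphic_on S - E" "closed E"
    and ab: "0 < a" "a < b" "b \<le> R" and E: "\<And>z. a \<le> norm z \<Longrightarrow> norm z \<le> b \<Longrightarrow> z \<notin> E"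
    and B: "\<And>s z. a < s \<Longrightarrow> s < b \<Longrightarrow> norm z = s \<Longrightarrow> 2 * M * C * norm (g z) * s ^ (k + 1) \<le> sqrt s * B s"
    and \<phi>: "continuous_on {a..b} \<phi>" "\<And>s. s \<in> {a<..<b} \<Longrightarrow> (\<phi> has_real_derivative B s) (at s)"
  shows "norm (circle_mean b (\<lambda>z. f z * g z * z) - circle_mean a (\<lambda>z. f z * g z * z)) \<le> \<phi> b - \<phi> a"
proof -
  obtain p' where W': "wirtinger_C1 (S - E) (\<lambda>z. f z * g z) p' (\<lambda>z. q z * g z)"
    using wirtinger_C1_mult_holomorphic[OF wirtinger_C1_subset[OF W] g(1)] g S by blast
  show ?thesis
  proof (rule circle_mean_annulus[OF W' ab(1,2)])
    fix z :: complex assume z: "a < norm z" "norm z < b"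
    then have z0: "0 < norm z" using ab by linarith
    have "norm (f z) * sqrt (norm z) \<le> C * norm z ^ k"
      using z ab z0 by (intro vanishing_orderD[OF V] order_refl) linarith+
    then have "(2 * M * norm z * norm (g z)) * (norm (f z) * sqrt (norm z)) \<le> (2 * M * norm z * norm (g z)) * (C * norm z ^ k)"
      using M by (intro mult_left_mono) auto
    also have "\<dots> = 2 * M * C * norm (g z) * norm z ^ (k + 1)" by simp
    also have "\<dots> \<le> sqrt (norm z) * B (norm z)" using B z by blast
    finally have "sqrt (norm z) * (2 * norm z * (M * norm (f z)) * norm (g z)) \<le> sqrt (norm z) * B (norm z)"
      by (simp add: algebra_simps)
    then have "2 * norm z * (M * norm (f z)) * norm (g z) \<le> B (norm z)"
      by (rule mult_left_le_imp_le) (use z0 in simp)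
    moreover have "2 * norm z * (norm (q z) * norm (g z)) \<le> 2 * norm z * ((M * norm (f z)) * norm (g z))"
      using q[of z] z ab by (intro mult_left_mono mult_right_mono) auto
    ultimately show "2 * norm z * norm (q z * g z) \<le> B (norm z)" by (simp add: norm_mult mult.assoc)
  qed (use \<phi> E S ab in auto)
qed

lemma vanishing_order_nonneg:
  assumes "vanishing_order k C" shows "0 \<le> C"
proof -
  have "norm (f 0) * sqrt R \<le> C * R ^ k" using assms R by (auto simp: vanishing_order_def)
  then have "0 \<le> C * R ^ k" using R by (smt (verit) mult_nonneg_nonneg norm_ge_zero real_sqrt_ge_zero)
  then show ?thesis using R mult_neg_pos[of C "R ^ k"] by (cases "C < 0") auto
qed

text \<open>For holomorphic \<open>f\<close> these means are the Taylor coefficients and do not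
  depend on \<open>r\<close>. Here they vary with a rate of the size
  \<open>s ^ (k - j) / sqrt s\<close>, which is integrable at 0, so they still have a limit at
  radius 0. For \<open>j < k\<close> the order of vanishing forces this limit to be 0.\<close>

lemma coefficient_limit:
  assumes V: "vanishing_order k C" and j: "j \<le> k"
  obtains c where "\<And>r. 0 < r \<Longrightarrow> r \<le> R \<Longrightarrow> norm (circle_mean r (\<lambda>z. f z / z ^ j) - c) \<le> 4 * M * C * r ^ (k - j) * sqrt r"
    "j < k \<Longrightarrow> c = 0"
proof -
  note C0 = vanishing_order_nonneg[OF V]
  let ?F = "\<lambda>r. circle_mean r (\<lambda>z. f z / z ^ j)"
  have var: "norm (?F b - ?F a) \<le> 4 * M * C * b ^ (k - j) * sqrt b" if ab: "0 < a" "a < b" "b \<le> R" for a b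
  proof -
    have le: "norm (circle_mean b (\<lambda>z. f z * (1 / z ^ (j+1)) * z) - circle_mean a (\<lambda>z. f z * (1 / z ^ (j+1)) * z))
        \<le> 4 * M * C * b ^ (k - j) * sqrt b - 4 * M * C * b ^ (k - j) * sqrt a"
    proof (rule circle_mean_variation[OF V, where E="{0}" and B="\<lambda>s. 2 * M * C * b ^ (k - j) / sqrt s"])
      show "(\<lambda>z. 1 / z ^ (j + 1)) holomorphic_on S - {0}" by (intro holomorphic_intros) auto
      fix s :: real and z :: complex assume s: "a < s" "s < b" "norm z = s"
      have "norm (1 / z ^ (j+1)) * s ^ (k + 1) = s ^ (k - j)"
        using s ab j by (simp add: norm_divide norm_power norm_mult power_diff)
      also have "\<dots> \<le> b ^ (k - j)" using s ab by (intro power_mono) auto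
      finally have "2 * M * C * (norm (1 / z ^ (j+1)) * s ^ (k + 1)) \<le> 2 * M * C * b ^ (k - j)"
        using M C0 by (intro mult_left_mono) auto
      then show "2 * M * C * norm (1 / z ^ (j+1)) * s ^ (k + 1) \<le> sqrt s * (2 * M * C * b ^ (k - j) / sqrt s)"
        using s ab by (simp add: mult.assoc)
    next
      show "((\<lambda>s. 4 * M * C * b ^ (k - j) * sqrt s) has_real_derivative 2 * M * C * b ^ (k - j) / sqrt s) (at s)"
        if "s \<in> {a<..<b}" for s
        using that ab by (auto intro!: derivative_eq_intros simp: field_simps)
    qed (use ab in \<open>auto intro!: continuous_intros\<close>)
    moreover have "circle_mean r (\<lambda>z. f z * (1 / z ^ (j+1)) * z) = ?F r" if "0 < r" for r
      unfolding circle_mean_def using that by simp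
    from this[of a] this[of b] have ea: "circle_mean a (\<lambda>z. f z * (1 / z ^ (j+1)) * z) = ?F a"
      and eb: "circle_mean b (\<lambda>z. f z * (1 / z ^ (j+1)) * z) = ?F b" using ab by linarith+
    moreover have "0 \<le> 4 * M * C * b ^ (k - j) * sqrt a" using M C0 ab by simp
    ultimately show ?thesis using le unfolding ea eb by linarith
  qed
  define D where "D = 4 * M * C * R ^ (k - j)"
  have "norm (?F b - ?F a) \<le> D * sqrt b" if ab: "0 < a" "a < b" "b \<le> R" for a b
  proof -
    have "4 * M * C * b ^ (k - j) * sqrt b \<le> D * sqrt b"
      unfolding D_def using M C0 ab by (intro mult_right_mono mult_left_mono power_mono) auto
    with var[OF ab] show ?thesis by simp
  qed
  from limit_from_sqrt_bound[OF R(1) this]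
  obtain c where c: "\<And>r. 0 < r \<Longrightarrow> r \<le> R \<Longrightarrow> norm (?F r - c) \<le> D * sqrt r" by blast
  show ?thesis
  proof (rule that)
    fix r assume r: "0 < r" "r \<le> R"
    \<comment> \<open>\<open>D\<close> contains only \<open>R ^ (k - j)\<close>. Comparing with a
      radius \<open>a\<close> that tends to 0 brings back the sharper power of
      \<open>r\<close>.\<close>
    show "norm (?F r - c) \<le> 4 * M * C * r ^ (k - j) * sqrt r"
    proof (rule le_sqrt_limit[OF r(1)])
      fix a assume a: "0 < a" "a < r"
      have "norm (?F r - c) \<le> norm (?F r - ?F a) + norm (?F a - c)"
        using norm_triangle_ineq[of "?F r - ?F a" "?F a - c"] by simp
      then show "norm (?F r - c) \<le> 4 * M * C * r ^ (k - j) * sqrt r + D * sqrt a"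
        using var[OF a r(2)] c[of a] a r by simp
    qed
  next
    assume jk: "j < k"
    have "norm c \<le> 0"
    proof (rule le_sqrt_limit[OF R(1)])
      fix a assume a: "0 < a" "a < R"
      have "norm (?F a) \<le> C * sqrt a"
      proof (rule norm_circle_mean_le)
        fix z :: complex assume z: "norm z = a"
        have "norm (f z) * sqrt a \<le> C * a ^ k" using z a by (intro vanishing_orderD[OF V]) auto
        also have "a ^ k = a ^ j * (a * a ^ (k - j - 1))"
          using jk by (simp add: power_add[symmetric] flip: power_Suc)
        also have "C * \<dots> \<le> C * (a ^ j * (a * 1))"
          using a R C0 by (intro mult_left_mono power_le_one) auto
        finally have "norm (f z) * sqrt a \<le> C * a ^ j * sqrt a * sqrt a" using a by (simp add: mult.assoc)
        then have "norm (f z) \<le> C * a ^ j * sqrt a" by (rule mult_right_le_imp_le) (use a in simp)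
        then show "norm (f z / z ^ j) \<le> C * sqrt a"
          using z a by (simp add: norm_divide norm_power divide_le_eq mult.commute mult.left_commute)
      qed (use a in \<open>auto intro!: continuous_intros f_continuous\<close>)
      moreover have "norm c \<le> norm (?F a) + norm (?F a - c)"
        using norm_triangle_ineq4[of "?F a" "?F a - c"] by simp
      ultimately show "norm c \<le> 0 + (C + D) * sqrt a" using c[of a] a by (simp add: algebra_simps)
    qed
    then show "c = 0" by simp
  qed
qed

text \<open>Taylor's formula with a dbar error: Cauchy-Pompeiu on the circle of radius
  \<open>2 * norm w\<close>, with the kernel expanded up to order \<open>k\<close>. The coefficients
  below \<open>k\<close> have the limit 0, the \<open>k\<close>-th one yields \<open>c\<close>, and
  every error turns out to be of the order \<open>norm w ^ k * sqrt (norm w)\<close>.\<close>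

lemma expansion:
  assumes V: "vanishing_order k C"
  obtains c C' where "0 \<le> C'" "\<And>z. 0 < norm z \<Longrightarrow> norm z < R / 2 \<Longrightarrow> norm (f z - c * z ^ k) \<le> C' * norm z ^ k * sqrt (norm z)"
proof -
  note C0 = vanishing_order_nonneg[OF V]
  let ?P = "\<lambda>j c. (\<forall>r. 0 < r \<longrightarrow> r \<le> R \<longrightarrow> norm (circle_mean r (\<lambda>z. f z / z ^ j) - c) \<le> 4 * M * C * r ^ (k - j) * sqrt r) \<and> (j < k \<longrightarrow> c = 0)"
  have "\<exists>c. ?P j c" if "j \<le> k" for j
    by (rule coefficient_limit[OF V that]) blast
  then have "\<exists>c. \<forall>j\<in>{..k}. ?P j (c j)" by (intro bchoice) auto
  then obtain c where cP: "\<And>j. j \<le> k \<Longrightarrow> ?P j (c j)" by auto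
  then have c: "\<And>j r. j \<le> k \<Longrightarrow> 0 < r \<Longrightarrow> r \<le> R \<Longrightarrow> norm (circle_mean r (\<lambda>z. f z / z ^ j) - c j) \<le> 4 * M * C * r ^ (k - j) * sqrt r"
    and c0: "\<And>j. j < k \<Longrightarrow> c j = 0" by auto
  define D where "D = 2 * C / (R * sqrt R)"
  define C' where "C' = 4 * M * C * 2 ^ k + real (k + 1) * (8 * M * C * 2 ^ k) + 8 * M * C + D"
  have D0: "0 \<le> D" unfolding D_def using C0 R by simp
  show ?thesis
  proof (rule that)
    show "0 \<le> C'" unfolding C'_def using C0 M D0 by simp
    fix w :: complex assume w: "0 < norm w" "norm w < R / 2"
    \<comment> \<open>With this radius the pole \<open>w\<close> keeps the distance
      \<open>norm w\<close> from the circle, and all errors scale with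
      \<open>norm w\<close>.\<close>
    let ?t = "norm w" let ?R = "2 * norm w"
    have t1: "?t \<le> 1" "sqrt ?R \<le> 2 * sqrt ?t" "?t \<le> sqrt ?t" "?t / sqrt ?R \<le> sqrt ?t"
    proof -
      show "?t \<le> 1" using w R by simp
      show "sqrt ?R \<le> 2 * sqrt ?t" by (rule real_le_lsqrt) (auto simp: power_mult_distrib)
      show t: "?t \<le> sqrt ?t" using \<open>?t \<le> 1\<close> w by (intro real_le_rsqrt) (auto simp: power2_eq_square mult_left_le)
      have "?t = sqrt ?t * sqrt ?t" by simp
      also have "\<dots> \<le> sqrt ?t * sqrt ?R" by (intro mult_left_mono) auto
      finally show "?t / sqrt ?R \<le> sqrt ?t" using w by (simp add: divide_le_eq)
    qed
    let ?K = "\<lambda>r. circle_mean r (\<lambda>z. f z / (z ^ k * (z - w)))"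
    have far: "norm z / 2 \<le> norm (z - w)" if "?R \<le> norm z" for z
      using norm_triangle_ineq2[of z w] that by simp
    \<comment> \<open>The remainder mean is moved out to the fixed radius \<open>R\<close>, where it
      is bounded by \<open>D\<close>. The price is of the order \<open>1 / sqrt ?R\<close>, which
      the factor \<open>w ^ (k + 1)\<close> can pay.\<close>
    have K1: "norm (?K R - ?K ?R) \<le> 8 * M * C / sqrt ?R"
    proof -
      have le: "norm (circle_mean R (\<lambda>z. f z * (1 / (z ^ (k+1) * (z - w))) * z) - circle_mean ?R (\<lambda>z. f z * (1 / (z ^ (k+1) * (z - w))) * z))
          \<le> - 8 * M * C / sqrt R - (- 8 * M * C / sqrt ?R)"
      proof (rule circle_mean_variation[OF V, where E="{0, w}" and B="\<lambda>s. 4 * M * C / (s * sqrt s)"])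
        show "(\<lambda>z. 1 / (z ^ (k + 1) * (z - w))) holomorphic_on S - {0, w}"
          by (intro holomorphic_intros) auto
        fix s :: real and z :: complex assume s: "?R < s" "s < R" "norm z = s"
        then have s0: "0 < s" using w by linarith
        have "norm (1 / (z ^ (k+1) * (z - w))) * s ^ (k + 1) = 1 / norm (z - w)"
          using s s0 by (simp add: norm_divide norm_power norm_mult del: power_Suc)
        also have "\<dots> \<le> 1 / (s / 2)"
        proof -
          have "s / 2 \<le> norm (z - w)" "0 < s / 2" using far[of z] s w by auto
          then show ?thesis by (intro divide_left_mono mult_pos_pos) linarith+
        qed
        finally have "2 * M * C * (norm (1 / (z ^ (k+1) * (z - w))) * s ^ (k + 1)) \<le> 2 * M * C * (1 / (s / 2))"
          using M C0 by (intro mult_left_mono) auto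
        then show "2 * M * C * norm (1 / (z ^ (k+1) * (z - w))) * s ^ (k + 1) \<le> sqrt s * (4 * M * C / (s * sqrt s))"
          using s0 by (simp add: mult.assoc)
      next
        show "((\<lambda>s. - 8 * M * C / sqrt s) has_real_derivative 4 * M * C / (s * sqrt s)) (at s)"
          if "s \<in> {?R<..<R}" for s
        proof -
          have "0 < s" using that le_less_trans[of 0 ?R s] by simp
          then show ?thesis by (auto intro!: derivative_eq_intros simp: field_simps)
        qed
      qed (use w in \<open>auto intro!: continuous_intros\<close>)
      moreover have "circle_mean r (\<lambda>z. f z * (1 / (z ^ (k+1) * (z - w))) * z) = ?K r" if "0 < r" for r
        unfolding circle_mean_def using that by simp
      from this[OF R(1)] this[of ?R] w have ea: "circle_mean R (\<lambda>z. f z * (1 / (z ^ (k+1) * (z - w))) * z) = ?K R"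
        and eb: "circle_mean ?R (\<lambda>z. f z * (1 / (z ^ (k+1) * (z - w))) * z) = ?K ?R" by simp_all
      moreover have "0 \<le> 8 * M * C / sqrt R" using M C0 R by simp
      then show ?thesis using le unfolding ea eb by linarith
    qed
    have K2: "norm (?K R) \<le> D"
    proof (rule norm_circle_mean_le)
      fix z :: complex assume z: "norm z = R"
      have "norm (f z) * sqrt R \<le> C * R ^ k" using z R by (intro vanishing_orderD[OF V]) auto
      moreover have "R / 2 \<le> norm (z - w)" using far[of z] z w by simp
      moreover have nz: "norm (f z / (z ^ k * (z - w))) = norm (f z) / (R ^ k * norm (z - w))"
        using z by (simp add: norm_divide norm_mult norm_power)
      ultimately have "norm (f z) / (R ^ k * norm (z - w)) \<le> (C * R ^ k / sqrt R) / (R ^ k * (R / 2))"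
        using R C0 by (intro frac_le mult_left_mono mult_pos_pos) (auto simp: le_divide_eq)
      also have "\<dots> = D" unfolding D_def using R by (simp add: field_simps)
      finally show "norm (f z / (z ^ k * (z - w))) \<le> D" using nz by simp
    next
      show "continuous_on (sphere 0 R) (\<lambda>z. f z / (z ^ k * (z - w)))"
        using w R by (intro continuous_intros f_continuous) auto
    qed (use R in simp)
    have K: "norm (?K ?R) \<le> 8 * M * C / sqrt ?R + D"
      using K1 K2 norm_triangle_ineq4[of "?K R" "?K R - ?K ?R"] by simp
    have G1: "norm (f w - circle_mean ?R (\<lambda>z. f z * (z / (z - w)))) \<le> 2 * ?R * (M * (C * ?R ^ k / sqrt ?R))"
    proof (rule Cauchy_Pompeiu_bound[OF W])
      fix z :: complex assume z: "norm z \<le> ?R"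
      have "norm (f z) * sqrt ?R \<le> C * ?R ^ k" using z w by (intro vanishing_orderD[OF V]) auto
      then have "norm (f z) \<le> C * ?R ^ k / sqrt ?R" using w by (simp add: le_divide_eq)
      then have le: "norm (f z) \<le> C * ?R ^ k / sqrt ?R" .
      have "norm z \<le> R" using z w by simp
      from order_trans[OF q[OF this] mult_left_mono[OF le M]]
      show "norm (q z) \<le> M * (C * ?R ^ k / sqrt ?R)" .
    qed (use w S in auto)
    have E: "circle_mean ?R (\<lambda>z. f z * (z / (z - w))) = (\<Sum>j\<le>k. w ^ j * circle_mean ?R (\<lambda>z. f z / z ^ j)) + w ^ (k + 1) * ?K ?R"
    proof -
      let ?z = "\<lambda>x. of_real ?R * unit_turn x"
      have z0: "?z x \<noteq> 0" "?z x \<noteq> w" for x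
      proof -
        have n: "norm (?z x) = ?R" by (simp add: norm_mult)
        show "?z x \<noteq> 0" using n w by (metis norm_zero less_irrefl mult_eq_0_iff zero_neq_numeral)
        show "?z x \<noteq> w" using n w by force
      qed
      have cf: "continuous_on {0..1} (\<lambda>x. f (?z x))"
        by (rule continuous_on_compose2[OF f_continuous[OF order_refl]]) (use w in \<open>auto intro!: continuous_intros simp: norm_mult\<close>)
      have cz: "continuous_on {0..1} ?z" by (intro continuous_intros)
      have i1: "(\<lambda>x. w ^ j * (f (?z x) / ?z x ^ j)) integrable_on {0..1}" for j
        using z0 by (intro integrable_continuous_interval continuous_intros cf) auto
      have i2: "(\<lambda>x. w ^ (k + 1) * (f (?z x) / (?z x ^ k * (?z x - w)))) integrable_on {0..1}"
        using z0 by (intro integrable_continuous_interval continuous_intros cf) auto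
      have "f (?z x) * (?z x / (?z x - w)) = (\<Sum>j\<le>k. w ^ j * (f (?z x) / ?z x ^ j)) + w ^ (k + 1) * (f (?z x) / (?z x ^ k * (?z x - w)))" for x
        unfolding geometric_kernel_expansion[OF z0, of x k] distrib_left sum_distrib_left
        by (simp add: algebra_simps)
      then have "circle_mean ?R (\<lambda>z. f z * (z / (z - w))) = integral {0..1} (\<lambda>x. (\<Sum>j\<le>k. w ^ j * (f (?z x) / ?z x ^ j)) + w ^ (k + 1) * (f (?z x) / (?z x ^ k * (?z x - w))))"
        unfolding circle_mean_def by simp
      also have "\<dots> = (\<Sum>j\<le>k. integral {0..1} (\<lambda>x. w ^ j * (f (?z x) / ?z x ^ j))) + integral {0..1} (\<lambda>x. w ^ (k + 1) * (f (?z x) / (?z x ^ k * (?z x - w))))"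
        by (simp only: integral_add[OF integrable_sum[OF finite_atMost i1] i2] integral_sum[OF finite_atMost i1])
      finally show ?thesis unfolding circle_mean_def integral_mult_right .
    qed
    \<comment> \<open>Each mean is replaced by its limit \<open>c j\<close>; only the summand with
      \<open>j = k\<close> survives in the limit.\<close>
    have S1: "norm ((\<Sum>j\<le>k. w ^ j * circle_mean ?R (\<lambda>z. f z / z ^ j)) - c k * w ^ k) \<le> real (k + 1) * (8 * M * C * 2 ^ k) * (?t ^ k * sqrt ?t)"
    proof -
      have "(\<Sum>j\<le>k. w ^ j * c j) = (\<Sum>j\<in>{k}. w ^ j * c j)"
        by (rule sum.mono_neutral_right) (use c0 in auto)
      then have "(\<Sum>j\<le>k. w ^ j * circle_mean ?R (\<lambda>z. f z / z ^ j)) - c k * w ^ k = (\<Sum>j\<le>k. w ^ j * (circle_mean ?R (\<lambda>z. f z / z ^ j) - c j))"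
        by (simp add: right_diff_distrib sum_subtractf mult.commute)
      also have "norm \<dots> \<le> (\<Sum>j\<le>k. 8 * M * C * 2 ^ k * (?t ^ k * sqrt ?t))"
      proof (rule sum_norm_le)
        fix j assume j: "j \<in> {..k}"
        have "norm (w ^ j * (circle_mean ?R (\<lambda>z. f z / z ^ j) - c j)) \<le> ?t ^ j * (4 * M * C * ?R ^ (k - j) * sqrt ?R)"
          unfolding norm_mult norm_power using c[of j ?R] j w by (intro mult_left_mono) auto
        also have "\<dots> \<le> ?t ^ j * (4 * M * C * (2 ^ k * ?t ^ (k - j)) * (2 * sqrt ?t))"
        proof -
          have "?R ^ (k - j) \<le> 2 ^ k * ?t ^ (k - j)"
            unfolding power_mult_distrib by (intro mult_right_mono power_increasing) auto
          then show ?thesis using M C0 t1(2) by (intro mult_left_mono mult_mono) auto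
        qed
        also have "\<dots> = 8 * M * C * 2 ^ k * ((?t ^ j * ?t ^ (k - j)) * sqrt ?t)" by simp
        also have "?t ^ j * ?t ^ (k - j) = ?t ^ k" using j by (simp add: power_add[symmetric])
        finally show "norm (w ^ j * (circle_mean ?R (\<lambda>z. f z / z ^ j) - c j)) \<le> 8 * M * C * 2 ^ k * (?t ^ k * sqrt ?t)" .
      qed
      finally show ?thesis by (simp add: mult.assoc)
    qed
    have S2: "norm (w ^ (k + 1) * ?K ?R) \<le> (8 * M * C + D) * (?t ^ k * sqrt ?t)"
    proof -
      have "norm (w ^ (k + 1) * ?K ?R) \<le> ?t ^ (k + 1) * (8 * M * C / sqrt ?R + D)"
        unfolding norm_mult norm_power using K by (intro mult_left_mono) auto
      also have "\<dots> = ?t ^ k * (8 * M * C * (?t / sqrt ?R) + D * ?t)" by (simp add: algebra_simps)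
      also have "\<dots> \<le> ?t ^ k * (8 * M * C * sqrt ?t + D * sqrt ?t)"
        using t1(3,4) M C0 D0 by (intro mult_left_mono add_mono) auto
      finally show ?thesis by (simp add: algebra_simps)
    qed
    have S3: "2 * ?R * (M * (C * ?R ^ k / sqrt ?R)) \<le> 4 * M * C * 2 ^ k * (?t ^ k * sqrt ?t)"
    proof -
      have "?R / sqrt ?R = sqrt ?R" using w by (simp add: real_div_sqrt)
      moreover have "2 * ?R * (M * (C * ?R ^ k / sqrt ?R)) = 2 * M * C * ?R ^ k * (?R / sqrt ?R)" by simp
      ultimately have "2 * ?R * (M * (C * ?R ^ k / sqrt ?R)) = 2 * M * C * ?R ^ k * sqrt ?R" by (simp only:)
      also have "\<dots> \<le> 2 * M * C * ?R ^ k * (2 * sqrt ?t)" using t1(2) M C0 by (intro mult_left_mono) auto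
      finally show ?thesis by (simp add: power_mult_distrib)
    qed
    have "f w - c k * w ^ k = (f w - circle_mean ?R (\<lambda>z. f z * (z / (z - w)))) + ((\<Sum>j\<le>k. w ^ j * circle_mean ?R (\<lambda>z. f z / z ^ j)) - c k * w ^ k) + w ^ (k + 1) * ?K ?R"
      using E by simp
    then have "norm (f w - c k * w ^ k) \<le> norm (f w - circle_mean ?R (\<lambda>z. f z * (z / (z - w)))) + norm ((\<Sum>j\<le>k. w ^ j * circle_mean ?R (\<lambda>z. f z / z ^ j)) - c k * w ^ k) + norm (w ^ (k + 1) * ?K ?R)"
      by (simp only: order_trans[OF norm_triangle_ineq add_right_mono[OF norm_triangle_ineq]])
    also have "\<dots> \<le> C' * (?t ^ k * sqrt ?t)"
      using add_mono[OF add_mono[OF order_trans[OF G1 S3] S1] S2] unfolding C'_def by (simp only: distrib_right)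
    finally show "norm (f w - c k * w ^ k) \<le> C' * ?t ^ k * sqrt ?t" by (simp add: mult.assoc)
  qed
qed

text \<open>The half power given away in \<open>vanishing_order\<close> is regained by passing to
  the order \<open>k + 1\<close>.\<close>

lemma vanishing_order_flat:
  assumes V: "\<And>k. \<exists>C. vanishing_order k C"
  shows "\<exists>C. \<forall>z. norm z \<le> R \<longrightarrow> norm (f z) \<le> C * norm z ^ k"
proof -
  obtain C1 where C1: "vanishing_order 1 C1" using V by blast
  have "norm (f 0) \<le> 0"
  proof (rule le_sqrt_limit[OF R(1)])
    fix a assume a: "0 < a" "a < R"
    have "norm (f 0) * sqrt a \<le> C1 * a ^ 1" using a by (intro vanishing_orderD[OF C1]) auto
    also have "\<dots> = (C1 * sqrt a) * sqrt a" using a by (simp add: mult.assoc)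
    finally have "norm (f 0) \<le> C1 * sqrt a" by (rule mult_right_le_imp_le) (use a in simp)
    then show "norm (f 0) \<le> 0 + C1 * sqrt a" by simp
  qed
  then have f0: "f 0 = 0" by simp
  obtain C where C: "vanishing_order (k + 1) C" using V by blast
  note C0 = vanishing_order_nonneg[OF C]
  have "norm (f z) \<le> C * norm z ^ k" if z: "norm z \<le> R" for z
  proof (cases "z = 0")
    case False
    then have z0: "0 < norm z" by simp
    have "norm (f z) * sqrt (norm z) \<le> C * norm z ^ (k + 1)"
      using vanishing_orderD[OF C z0 z] by simp
    also have "\<dots> = (C * norm z ^ k * sqrt (norm z)) * sqrt (norm z)" by (simp add: mult.assoc)
    finally have "norm (f z) \<le> C * norm z ^ k * sqrt (norm z)" by (rule mult_right_le_imp_le) (use z0 in simp)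
    also have "\<dots> \<le> C * norm z ^ k * 1" using z R C0 by (intro mult_left_mono) auto
    finally show ?thesis by simp
  qed (use f0 C0 in simp)
  then show ?thesis by blast
qed

end

text \<open>Unless \<open>f\<close> is flat at 0, there is a last order \<open>k\<close>. If the
  coefficient \<open>c\<close> of the expansion was 0, its error term would be a bound of order
  \<open>k + 1/2\<close>, which is exactly \<open>vanishing_order (Suc k)\<close>.\<close>

theorem leading_term:
  assumes W: "wirtinger_C1 (ball 0 r0) f p q" and r0: "0 < r0" and M: "0 \<le> M"
    and q: "\<And>z. norm z < r0 \<Longrightarrow> norm (q z) \<le> M * norm (f z)"
  shows "(\<exists>r>0. \<forall>z. norm z < r \<longrightarrow> f z = 0) \<or>
    (\<exists>k c C r. c \<noteq> 0 \<and> 0 < r \<and>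
      (\<forall>z. 0 < norm z \<longrightarrow> norm z < r \<longrightarrow> norm (f z - c * z ^ k) \<le> C * norm z ^ k * sqrt (norm z)))"
proof -
  \<comment> \<open>\<open>r0 / 2\<close> keeps the closed disc inside the ball, 1 makes powers
    decrease, and the last bound gives \<open>4 * R * M \<le> 1\<close>.\<close>
  define R where "R = min (min 1 (r0 / 2)) (1 / (4 * M + 4))"
  have R: "0 < R" "R \<le> 1" "R < r0" unfolding R_def using r0 M by auto
  have "R * (4 * M + 4) \<le> 1" using M by (simp add: R_def min_def field_simps)
  then have RM: "4 * R * M \<le> 1" using R M by (simp add: algebra_simps)
  interpret dbar_dominated "ball 0 r0" f p q R M
    by unfold_locales (use W R q M in auto)
  show ?thesis
  proof (cases "\<forall>k. \<exists>C. vanishing_order k C")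
    case True
    have "f z = 0" if "norm z < R / 2" for z
    proof (rule unique_continuation_origin[OF W S(1) R(1) q M RM])
      show "\<exists>C. \<forall>z. norm z \<le> R \<longrightarrow> norm (f z) \<le> C * norm z ^ k" for k
        by (rule vanishing_order_flat) (use True in blast)
    qed (use that R in auto)
    then show ?thesis using R by (intro disjI1 exI[of _ "R / 2"]) auto
  next
    case False
    obtain m where "\<forall>z\<in>cball 0 R. norm (f z) \<le> m"
      using compact_imp_bounded[OF compact_continuous_image[OF f_continuous[OF order_refl] compact_cball]]
      by (auto simp: bounded_iff)
    then have m: "\<And>z. norm z \<le> R \<Longrightarrow> norm (f z) \<le> m" by simp
    have m0: "0 \<le> m" using order_trans[OF norm_ge_zero m[of 0]] R by simp
    have "vanishing_order 0 m"
      unfolding vanishing_order_def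
    proof (intro allI impI)
      fix r :: real and z :: complex assume "0 < r" "r \<le> R" "norm z \<le> r"
      then have "norm (f z) * sqrt r \<le> m * 1" using m[of z] m0 R by (intro mult_mono) auto
      then show "norm (f z) * sqrt r \<le> m * r ^ 0" by simp
    qed
    with False obtain k C where C: "vanishing_order k C" and notC: "\<And>C. \<not> vanishing_order (Suc k) C"
    proof -
      have "\<exists>k. (\<exists>C. vanishing_order k C) \<and> \<not> (\<exists>C. vanishing_order (Suc k) C)"
      proof (rule ccontr)
        assume "\<not> ?thesis"
        then have "\<exists>C. vanishing_order k C" for k
          using \<open>vanishing_order 0 m\<close> by (induction k) blast+
        with False show False by blast
      qed
      then show ?thesis using that by blast
    qed
    obtain c C' where C': "0 \<le> C'" and e: "\<And>z. 0 < norm z \<Longrightarrow> norm z < R / 2 \<Longrightarrow> norm (f z - c * z ^ k) \<le> C' * norm z ^ k * sqrt (norm z)"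
      by (rule expansion[OF C]) blast
    have "c \<noteq> 0"
    proof
      assume "c = 0"
      then have e0: "norm (f z) \<le> C' * norm z ^ k * sqrt (norm z)" if "0 < norm z" "norm z < R / 2" for z
        using e[OF that] by simp
      have "norm (f 0) \<le> 0"
      proof -
        have "((\<lambda>a. f (of_real a)) \<longlongrightarrow> f (of_real 0)) (at_right 0)"
        proof (rule isCont_tendsto_compose[of "of_real 0" f])
          show "isCont f (of_real 0)"
            using wirtinger_C1_continuous(1)[OF W] r0 by (simp add: continuous_on_eq_continuous_at)
        qed (intro tendsto_intros)
        from tendsto_norm[OF this] have "((\<lambda>a. norm (f (of_real a))) \<longlongrightarrow> norm (f 0)) (at_right 0)" by simp
        moreover have "((\<lambda>a. C' * 1 * sqrt a) \<longlongrightarrow> C' * 1 * sqrt 0) (at_right 0)" by (intro tendsto_intros)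
        moreover have "\<forall>\<^sub>F a in at_right 0. norm (f (of_real a)) \<le> C' * 1 * sqrt a"
        proof -
          have "\<forall>\<^sub>F a in at_right 0. a \<in> {0<..<R/2}" using R by (intro eventually_at_right_real) simp
          then show ?thesis
          proof eventually_elim
            case (elim a)
            have "norm (f (of_real a)) \<le> C' * a ^ k * sqrt a" using e0[of "of_real a"] elim by simp
            also have "\<dots> \<le> C' * 1 * sqrt a"
              using elim R C' by (intro mult_right_mono mult_left_mono power_le_one) auto
            finally show ?case .
          qed
        qed
        ultimately have "norm (f 0) \<le> C' * 1 * sqrt 0" by (intro tendsto_le[of "at_right (0::real)"]) auto
        then show ?thesis by simp
      qed
      then have f0: "f 0 = 0" by simp
      \<comment> \<open>The expansion holds only below \<open>R / 2\<close>; the second summand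
        covers the rest of the disc, where \<open>f\<close> is bounded by \<open>m\<close>.\<close>
      define C2 where "C2 = C' + m / (R/2) ^ Suc k"
      have "vanishing_order (Suc k) C2"
        unfolding vanishing_order_def
      proof (intro allI impI)
        fix r :: real and z :: complex assume r: "0 < r" "r \<le> R" "norm z \<le> r"
        have C2: "C' * r ^ Suc k \<le> C2 * r ^ Suc k" "m / (R/2) ^ Suc k * r ^ Suc k \<le> C2 * r ^ Suc k" "0 \<le> C2"
        proof -
          have nn: "0 \<le> C' * r ^ Suc k" "0 \<le> m / (R/2) ^ Suc k * r ^ Suc k"
            using C' m0 R r by (auto intro!: mult_nonneg_nonneg divide_nonneg_nonneg)
          then show "C' * r ^ Suc k \<le> C2 * r ^ Suc k" "m / (R/2) ^ Suc k * r ^ Suc k \<le> C2 * r ^ Suc k"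
            unfolding C2_def distrib_right by linarith+
          show "0 \<le> C2" unfolding C2_def using C' m0 R by simp
        qed
        consider "z = 0" | "0 < norm z" "norm z < R / 2" | "R / 2 \<le> norm z" by fastforce
        then show "norm (f z) * sqrt r \<le> C2 * r ^ Suc k"
        proof cases
          case 2
          have "norm (f z) * sqrt r \<le> C' * norm z ^ k * sqrt (norm z) * sqrt r"
            using e0[OF 2] r by (intro mult_right_mono) auto
          also have "\<dots> \<le> C' * r ^ k * sqrt r * sqrt r"
            using C' r by (intro mult_right_mono mult_mono power_mono) auto
          also have "\<dots> = C' * r ^ Suc k" using r by (simp add: mult.assoc)
          finally show ?thesis using C2 by linarith
        next
          case 3
          have "norm (f z) * sqrt r \<le> m * 1" using m[of z] m0 r R by (intro mult_mono) auto
          also have "m * (R/2) ^ Suc k \<le> m * r ^ Suc k" using 3 r R m0 by (intro mult_left_mono power_mono) auto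
          then have "m * 1 \<le> m / (R/2) ^ Suc k * r ^ Suc k" using R by (simp add: field_simps)
          finally show ?thesis using C2 by linarith
        qed (use f0 C2 r in simp)
      qed
      with notC show False by blast
    qed
    then show ?thesis using e R by (intro disjI2 exI[of _ k] exI[of _ c] exI[of _ C'] exI[of _ "R/2"]) auto
  qed
qed

section \<open>Normal form at a critical point\<close>

text \<open>The second difference over a parallelogram, evaluated by the mean value theorem first
  along \<open>v\<close> and then along \<open>w\<close>. Since it is symmetric in \<open>v\<close>
  and \<open>w\<close>, evaluating it in both orders proves the symmetry of second
  derivatives.\<close>

lemma mixed_difference_mvt:
  fixes u :: "'a::real_normed_vector \<Rightarrow> real"
  assumes S: "\<And>a b. 0 \<le> a \<Longrightarrow> a \<le> s \<Longrightarrow> 0 \<le> b \<Longrightarrow> b \<le> s \<Longrightarrow> x + a *\<^sub>R v + b *\<^sub>R w \<in> S" and s: "0 < s"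
    and u: "\<And>y. y \<in> S \<Longrightarrow> (u has_derivative du y) (at y)"
    and du: "\<And>y. y \<in> S \<Longrightarrow> ((\<lambda>y. du y v) has_derivative ddu y) (at y)"
  obtains a b where "0 < a" "a < s" "0 < b" "b < s"
    "u (x + s *\<^sub>R v + s *\<^sub>R w) - u (x + s *\<^sub>R v) - u (x + s *\<^sub>R w) + u x = s * (s * ddu (x + a *\<^sub>R v + b *\<^sub>R w) w)"
proof -
  let ?\<phi> = "\<lambda>a. u (x + a *\<^sub>R v + s *\<^sub>R w) - u (x + a *\<^sub>R v)"
  let ?\<phi>' = "\<lambda>a. du (x + a *\<^sub>R v + s *\<^sub>R w) v - du (x + a *\<^sub>R v) v"
  have lin: "du y (c *\<^sub>R h) = c * du y h" if "y \<in> S" for y c h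
    using linear_scale[OF has_derivative_linear[OF u[OF that]], of c h] by simp
  have lin2: "ddu y (c *\<^sub>R h) = c * ddu y h" if "y \<in> S" for y c h
    using linear_scale[OF has_derivative_linear[OF du[OF that]], of c h] by simp
  have d\<phi>: "DERIV ?\<phi> a :> ?\<phi>' a" if a: "0 \<le> a" "a \<le> s" for a
  proof -
    have S1: "x + a *\<^sub>R v + s *\<^sub>R w \<in> S" "x + a *\<^sub>R v \<in> S" using S[of a s] S[of a 0] a s by auto
    have "((\<lambda>a. x + a *\<^sub>R v + s *\<^sub>R w) has_derivative (\<lambda>h. h *\<^sub>R v)) (at a)"
      "((\<lambda>a. x + a *\<^sub>R v) has_derivative (\<lambda>h. h *\<^sub>R v)) (at a)"
      by (auto intro!: derivative_eq_intros)
    from has_derivative_diff[OF has_derivative_compose[OF this(1) u] has_derivative_compose[OF this(2) u]] S1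
    have "(?\<phi> has_derivative (\<lambda>h. h * ?\<phi>' a)) (at a)"
      by (simp add: lin right_diff_distrib)
    then show ?thesis
      unfolding has_field_derivative_def by (rule has_derivative_eq_rhs) (simp add: fun_eq_iff)
  qed
  obtain a where a: "0 < a" "a < s" "?\<phi> s - ?\<phi> 0 = (s - 0) * ?\<phi>' a"
    using MVT2[OF s d\<phi>] by blast
  let ?\<eta> = "\<lambda>b. du (x + a *\<^sub>R v + b *\<^sub>R w) v"
  have d\<eta>: "DERIV ?\<eta> b :> ddu (x + a *\<^sub>R v + b *\<^sub>R w) w" if b: "0 \<le> b" "b \<le> s" for b
  proof -
    have S1: "x + a *\<^sub>R v + b *\<^sub>R w \<in> S" using S[of a b] a b by auto
    have "((\<lambda>b. x + a *\<^sub>R v + b *\<^sub>R w) has_derivative (\<lambda>h. h *\<^sub>R w)) (at b)"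
      by (auto intro!: derivative_eq_intros)
    from has_derivative_compose[OF this du] S1
    have "(?\<eta> has_derivative (\<lambda>h. h * ddu (x + a *\<^sub>R v + b *\<^sub>R w) w)) (at b)"
      by (simp add: lin2)
    then show ?thesis
      unfolding has_field_derivative_def by (rule has_derivative_eq_rhs) (simp add: fun_eq_iff)
  qed
  obtain b where b: "0 < b" "b < s" "?\<eta> s - ?\<eta> 0 = (s - 0) * ddu (x + a *\<^sub>R v + b *\<^sub>R w) w"
    using MVT2[OF s d\<eta>] by blast
  show ?thesis using a b by (intro that[of a b]) (auto simp: algebra_simps)
qed

lemma second_derivative_symmetric:
  fixes u :: "'a::real_normed_vector \<Rightarrow> real"
  assumes S: "open S" "x \<in> S"
    and u: "\<And>y. y \<in> S \<Longrightarrow> (u has_derivative du y) (at y)"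
    and d: "\<And>v y. y \<in> S \<Longrightarrow> ((\<lambda>y. du y v) has_derivative ddu v y) (at y)"
    and c: "\<And>v w. continuous_on S (\<lambda>y. ddu v y w)"
  shows "ddu v x w = ddu w x v"
proof (rule ccontr)
  assume "\<not> ?thesis"
  then have e: "0 < \<bar>ddu v x w - ddu w x v\<bar> / 2" (is "0 < ?e") by simp
  have "isCont (\<lambda>y. ddu v y w) x" "isCont (\<lambda>y. ddu w y v) x"
    using c S by (auto simp: continuous_on_eq_continuous_at)
  then obtain d1 d2 where d1: "0 < d1" "\<And>y. dist y x < d1 \<Longrightarrow> \<bar>ddu v y w - ddu v x w\<bar> < ?e"
    and d2: "0 < d2" "\<And>y. dist y x < d2 \<Longrightarrow> \<bar>ddu w y v - ddu w x v\<bar> < ?e"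
    using e unfolding continuous_at_eps_delta dist_real_def by metis
  obtain d3 where d3: "0 < d3" "ball x d3 \<subseteq> S" using S openE by blast
  define s where "s = min d1 (min d2 d3) / (norm v + norm w + 1)"
  have s: "0 < s" unfolding s_def using d1 d2 d3 by (auto intro!: divide_pos_pos add_nonneg_pos)
  have near: "dist (x + a *\<^sub>R v + b *\<^sub>R w) x < min d1 (min d2 d3)" if "0 \<le> a" "a \<le> s" "0 \<le> b" "b \<le> s" for a b
  proof -
    have "dist (x + a *\<^sub>R v + b *\<^sub>R w) x \<le> norm (a *\<^sub>R v) + norm (b *\<^sub>R w)"
      unfolding dist_norm by (metis add.assoc add_diff_cancel_left' norm_triangle_ineq)
    also have "\<dots> \<le> s * norm v + s * norm w" using that by (auto intro!: add_mono mult_right_mono)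
    also have "\<dots> < s * (norm v + norm w + 1)" using s by (simp add: algebra_simps)
    also have "\<dots> = min d1 (min d2 d3)"
      unfolding s_def using norm_ge_zero[of v] norm_ge_zero[of w] by (simp add: add_nonneg_eq_0_iff)
    finally show ?thesis .
  qed
  have inS: "x + a *\<^sub>R v + b *\<^sub>R w \<in> S" if "0 \<le> a" "a \<le> s" "0 \<le> b" "b \<le> s" for a b
    using near[OF that] d3 by (auto simp: dist_commute)
  have inS': "x + a *\<^sub>R w + b *\<^sub>R v \<in> S" if "0 \<le> a" "a \<le> s" "0 \<le> b" "b \<le> s" for a b
    using inS[OF that(3,4,1,2)] by (simp add: ac_simps)
  obtain a b where ab: "0 < a" "a < s" "0 < b" "b < s"
    "u (x + s *\<^sub>R v + s *\<^sub>R w) - u (x + s *\<^sub>R v) - u (x + s *\<^sub>R w) + u x = s * (s * ddu v (x + a *\<^sub>R v + b *\<^sub>R w) w)"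
    by (rule mixed_difference_mvt[OF inS s u d])
  obtain a' b' where ab': "0 < a'" "a' < s" "0 < b'" "b' < s"
    "u (x + s *\<^sub>R w + s *\<^sub>R v) - u (x + s *\<^sub>R w) - u (x + s *\<^sub>R v) + u x = s * (s * ddu w (x + a' *\<^sub>R w + b' *\<^sub>R v) v)"
    by (rule mixed_difference_mvt[OF inS' s u d])
  have "s * (s * ddu v (x + a *\<^sub>R v + b *\<^sub>R w) w) = s * (s * ddu w (x + b' *\<^sub>R v + a' *\<^sub>R w) v)"
  proof -
    have "x + s *\<^sub>R w + s *\<^sub>R v = x + s *\<^sub>R v + s *\<^sub>R w" "x + a' *\<^sub>R w + b' *\<^sub>R v = x + b' *\<^sub>R v + a' *\<^sub>R w"
      by simp_all
    with ab(5) ab'(5) show ?thesis by (simp only:)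
  qed
  then have "ddu v (x + a *\<^sub>R v + b *\<^sub>R w) w = ddu w (x + b' *\<^sub>R v + a' *\<^sub>R w) v" using s by simp
  moreover have "\<bar>ddu v (x + a *\<^sub>R v + b *\<^sub>R w) w - ddu v x w\<bar> < ?e" using d1(2) near[of a b] ab by auto
  moreover have "\<bar>ddu w (x + b' *\<^sub>R v + a' *\<^sub>R w) v - ddu w x v\<bar> < ?e" using d2(2) near[of b' a'] ab' by auto
  ultimately show False by (simp add: abs_if split: if_splits)
qed

text \<open>The leading term \<open>c * z ^ k\<close> of the complex gradient integrates to
  \<open>Re (c / n * z ^ n)\<close> with \<open>n = k + 1\<close>, and \<open>f 0 = 0\<close> forces
  \<open>k \<ge> 1\<close>. A complex dilation by \<open>l\<close> removes the constant.\<close>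

lemma harmonic_normal_form:
  fixes U :: "complex \<Rightarrow> real"
  assumes W: "wirtinger_C1 (ball 0 r0) f p q" and r0: "0 < r0" and M: "0 \<le> M"
    and q: "\<And>z. norm z < r0 \<Longrightarrow> norm (q z) \<le> M * norm (f z)"
    and U: "\<And>z. norm z < r0 \<Longrightarrow> (U has_derivative (\<lambda>h. Re (f z * h))) (at z)" and f0: "f 0 = 0"
  shows "(\<exists>r>0. \<forall>z. norm z < r \<longrightarrow> f z = 0) \<or>
    (\<exists>n\<ge>2. \<exists>l. l \<noteq> 0 \<and> (\<forall>e>0. \<exists>r>0. \<forall>z. norm z < r \<longrightarrow>
       \<bar>U (l * z) - U 0 - Re (z ^ n)\<bar> \<le> e * norm z ^ n \<and>
       norm (l * f (l * z) - of_nat n * z ^ (n - 1)) \<le> e * norm z ^ (n - 1)))"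
proof -
  consider "\<exists>r>0. \<forall>z. norm z < r \<longrightarrow> f z = 0"
    | k c C r where "c \<noteq> 0" "0 < r"
      "\<forall>z. 0 < norm z \<longrightarrow> norm z < r \<longrightarrow> norm (f z - c * z ^ k) \<le> C * norm z ^ k * sqrt (norm z)"
    using leading_term[OF W r0 M q] by blast
  then show ?thesis
proof cases
  case (2 k c C r)
  then have c: "c \<noteq> 0" and r: "0 < r"
    and lead: "\<forall>z. 0 < norm z \<longrightarrow> norm z < r \<longrightarrow> norm (f z - c * z ^ k) \<le> C * norm z ^ k * sqrt (norm z)" by auto
  have k: "k \<noteq> 0"
  proof
    assume "k = 0"
    have "norm c \<le> 0"
    proof -
      have "((\<lambda>a. f (of_real a)) \<longlongrightarrow> f (of_real 0)) (at_right 0)"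
      proof (rule isCont_tendsto_compose[of "of_real 0" f])
        show "isCont f (of_real 0)"
          using wirtinger_C1_continuous(1)[OF W] r0 by (simp add: continuous_on_eq_continuous_at)
      qed (intro tendsto_intros)
      then have "((\<lambda>a. norm (f (of_real a) - c)) \<longlongrightarrow> norm (f (of_real 0) - c)) (at_right 0)"
        by (intro tendsto_intros)
      then have "((\<lambda>a. norm (f (of_real a) - c)) \<longlongrightarrow> norm c) (at_right 0)" using f0 by simp
      moreover have "((\<lambda>a. C * sqrt a) \<longlongrightarrow> C * sqrt 0) (at_right 0)" by (intro tendsto_intros)
      moreover have "\<forall>\<^sub>F a in at_right 0. norm (f (of_real a) - c) \<le> C * sqrt a"
        using eventually_at_right_real[OF r]
      proof eventually_elim
        case (elim a)
        then show ?case using lead[rule_format, of "of_real a"] \<open>k = 0\<close> by simp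
      qed
      ultimately have "norm c \<le> C * sqrt 0" by (intro tendsto_le[of "at_right (0::real)"]) auto
      then show ?thesis by simp
    qed
    with c show False by simp
  qed
  define n where "n = Suc k"
  have n: "n \<ge> 2" "n \<noteq> 0" "k = n - 1" using k by (auto simp: n_def)
  define C1 where "C1 = \<bar>C\<bar>"
  define rr where "rr = min r r0"
  have rr: "0 < rr" "rr \<le> r" "rr \<le> r0" using r r0 by (auto simp: rr_def)
  have lead1: "norm (f z - c * z ^ k) \<le> C1 * norm z ^ k * sqrt (norm z)" if "norm z < rr" for z
  proof (cases "z = 0")
    case False
    then have "norm (f z - c * z ^ k) \<le> C * norm z ^ k * sqrt (norm z)" using lead that rr by auto
    also have "\<dots> \<le> C1 * norm z ^ k * sqrt (norm z)"
      unfolding C1_def by (intro mult_right_mono) auto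
    finally show ?thesis .
  qed (use f0 k in simp)
  \<comment> \<open>\<open>?V\<close> has the complex gradient \<open>f z - c * z ^ k\<close>, so
    the mean value inequality on the disc through \<open>z\<close> gains one power of
    \<open>norm z\<close>.\<close>
  have leadU: "\<bar>U z - U 0 - Re (c / of_nat n * z ^ n)\<bar> \<le> C1 * norm z ^ n * sqrt (norm z)" if z: "norm z < rr" for z
  proof -
    let ?V = "\<lambda>z. U z - Re (c / of_nat n * z ^ n)"
    have "norm (?V z - ?V 0) \<le> (C1 * norm z ^ k * sqrt (norm z)) * norm (z - 0)"
    proof (rule differentiable_bound[OF convex_cball[of 0 "norm z"]])
      fix w :: complex assume "w \<in> cball 0 (norm z)"
      then have w: "norm w \<le> norm z" by simp
      have "((\<lambda>z. c / of_nat n * z ^ n) has_field_derivative (c * w ^ k)) (at w)"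
        using n by (auto intro!: derivative_eq_intros)
      then have "((\<lambda>z. Re (c / of_nat n * z ^ n)) has_derivative (\<lambda>h. Re (c * w ^ k * h))) (at w)"
        unfolding has_field_derivative_def by (rule has_derivative_Re)
      moreover have "(U has_derivative (\<lambda>h. Re (f w * h))) (at w)"
        by (rule U) (use w z rr in linarith)
      ultimately have "(?V has_derivative (\<lambda>h. Re (f w * h) - Re (c * w ^ k * h))) (at w)"
        by (intro has_derivative_diff)
      then show "(?V has_derivative (\<lambda>h. Re ((f w - c * w ^ k) * h))) (at w within cball 0 (norm z))"
        by (simp only: left_diff_distrib minus_complex.sel has_derivative_at_withinI)
      have "norm (f w - c * w ^ k) \<le> C1 * norm w ^ k * sqrt (norm w)"
        by (rule lead1) (use w z in linarith)
      also have "\<dots> \<le> C1 * norm z ^ k * sqrt (norm z)"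
        using w by (intro mult_mono power_mono) (auto simp: C1_def)
      finally have "norm (f w - c * w ^ k) \<le> C1 * norm z ^ k * sqrt (norm z)" .
      then show "onorm (\<lambda>h. Re ((f w - c * w ^ k) * h)) \<le> C1 * norm z ^ k * sqrt (norm z)"
      proof (intro onorm_le)
        fix h
        have "norm (Re ((f w - c * w ^ k) * h)) \<le> norm (f w - c * w ^ k) * norm h"
          using abs_Re_le_cmod[of "(f w - c * w ^ k) * h"] by (simp add: norm_mult)
        also have "\<dots> \<le> C1 * norm z ^ k * sqrt (norm z) * norm h"
          by (intro mult_right_mono norm_ge_zero) fact
        finally show "norm (Re ((f w - c * w ^ k) * h)) \<le> C1 * norm z ^ k * sqrt (norm z) * norm h" .
      qed
    qed auto
    moreover have "?V z - ?V 0 = U z - U 0 - Re (c / of_nat n * z ^ n)" using n by simp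
    moreover have "(C1 * norm z ^ k * sqrt (norm z)) * norm (z - 0) = C1 * norm z ^ n * sqrt (norm z)"
      by (simp add: n_def)
    ultimately show ?thesis by (simp only: real_norm_def)
  qed
  \<comment> \<open>Substituting \<open>l * z\<close> with \<open>c * l ^ n = n\<close> turns
    \<open>c / n * z ^ n\<close> into \<open>z ^ n\<close>.\<close>
  have "of_nat n / c \<noteq> 0" using n c by simp
  from exists_complex_root_nonzero[OF this n(2)]
  obtain l where l: "l \<noteq> 0" "of_nat n / c = l ^ n" by blast
  have cl: "c * l ^ n = of_nat n" using l(2)[symmetric] c by simp
  have small: "\<exists>r>0. \<forall>z. norm z < r \<longrightarrow>
       \<bar>U (l * z) - U 0 - Re (z ^ n)\<bar> \<le> e * norm z ^ n \<and>
       norm (l * f (l * z) - of_nat n * z ^ (n - 1)) \<le> e * norm z ^ (n - 1)" if e: "0 < e" for e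
  proof -
    define B where "B = C1 * norm l ^ n + 1"
    have B: "0 < B" by (auto simp: B_def C1_def intro!: add_nonneg_pos)
    define r' where "r' = min rr ((e / B)\<^sup>2) / norm l"
    have "0 < r'" using rr e B l by (auto simp: r'_def)
    moreover have "\<bar>U (l * z) - U 0 - Re (z ^ n)\<bar> \<le> e * norm z ^ n \<and>
       norm (l * f (l * z) - of_nat n * z ^ (n - 1)) \<le> e * norm z ^ (n - 1)" if z: "norm z < r'" for z
    proof -
      have lz: "norm (l * z) < rr" "norm (l * z) \<le> (e / B)\<^sup>2"
        using z l by (auto simp: r'_def norm_mult field_simps)
      have "sqrt (norm (l * z)) \<le> e / B"
        by (rule real_le_lsqrt) (use lz e B in auto)
      then have "C1 * norm l ^ n * sqrt (norm (l * z)) \<le> B * (e / B)"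
        using B by (intro mult_mono) (auto simp: B_def)
      also have "\<dots> = e" using e B by simp
      finally have Be: "C1 * norm l ^ n * sqrt (norm (l * z)) \<le> e" .
      have "c / of_nat n * (l * z) ^ n = (c * l ^ n) / of_nat n * z ^ n" by (simp add: power_mult_distrib)
      then have c1: "c / of_nat n * (l * z) ^ n = z ^ n" using cl n by simp
      have "\<bar>U (l * z) - U 0 - Re (z ^ n)\<bar> \<le> C1 * norm (l * z) ^ n * sqrt (norm (l * z))"
        using leadU[OF lz(1)] unfolding c1 .
      also have "\<dots> = (C1 * norm l ^ n * sqrt (norm (l * z))) * norm z ^ n"
        by (simp add: norm_mult power_mult_distrib)
      also have "\<dots> \<le> e * norm z ^ n" by (intro mult_right_mono Be) simp
      finally have 1: "\<bar>U (l * z) - U 0 - Re (z ^ n)\<bar> \<le> e * norm z ^ n" .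
      have "l * f (l * z) - of_nat n * z ^ (n - 1) = l * (f (l * z) - c * (l * z) ^ k)"
        unfolding cl[symmetric] by (simp add: n_def algebra_simps power_mult_distrib)
      then have "norm (l * f (l * z) - of_nat n * z ^ (n - 1)) \<le> norm l * (C1 * norm (l * z) ^ k * sqrt (norm (l * z)))"
        using lead1[OF lz(1)] by (simp add: norm_mult mult_left_mono)
      also have "\<dots> = (C1 * norm l ^ n * sqrt (norm (l * z))) * norm z ^ (n - 1)"
        by (simp add: n_def norm_mult power_mult_distrib)
      also have "\<dots> \<le> e * norm z ^ (n - 1)" by (intro mult_right_mono Be) simp
      finally show ?thesis using 1 by blast
    qed
    ultimately show ?thesis by blast
  qed
  show ?thesis
    using n(1) l(1) small by blast
qed blast
qed

section \<open>Gradient and second derivatives of a \<open>C^2\<close> function of two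
  variables\<close>

lemma Ck_on_2D:
  assumes "Ck_on 2 S u"
  shows "x \<in> S \<Longrightarrow> (u has_derivative frechet_derivative u (at x)) (at x)"
    and "x \<in> S \<Longrightarrow> ((\<lambda>y. frechet_derivative u (at y) v) has_derivative
      frechet_derivative (\<lambda>y. frechet_derivative u (at y) v) (at x)) (at x)"
    and "continuous_on S (\<lambda>x. frechet_derivative (\<lambda>y. frechet_derivative u (at y) v) (at x) w)"
  using assms by (auto simp: numeral_2_eq_2 frechet_derivative_works)

lemma differentiable_linear_bound:
  fixes f :: "'a::real_normed_vector \<Rightarrow> 'b::real_normed_vector"
  assumes "f differentiable (at x)"
  obtains B where "\<forall>\<^sub>F y in nhds x. norm (f y - f x) \<le> B * norm (y - x)"
proof -
  obtain D where D: "(f has_derivative D) (at x)" using assms by (auto simp: differentiable_def)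
  then obtain K where K: "\<And>h. norm (D h) \<le> norm h * K"
    using bounded_linear.bounded has_derivative_bounded_linear by blast
  obtain d where d: "d > 0" "\<And>y. norm (y - x) < d \<Longrightarrow> norm (f y - f x - D (y - x)) \<le> 1 * norm (y - x)"
    using D unfolding has_derivative_at_alt by (metis zero_less_one)
  have "norm (f y - f x) \<le> (1 + K) * norm (y - x)" if "dist y x < d" for y
  proof -
    have "norm (f y - f x) \<le> norm (f y - f x - D (y - x)) + norm (D (y - x))"
      by (metis diff_add_cancel norm_triangle_ineq)
    then show ?thesis using d(2)[of y] K[of "y - x"] that by (simp add: dist_norm algebra_simps)
  qed
  then show ?thesis using d(1) that unfolding eventually_nhds_metric by blast
qed

lemma vec2_eq_axis: "v = (v $ 1) *\<^sub>R axis 1 1 + (v $ 2) *\<^sub>R (axis 2 1 :: real^2)"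
  by (simp add: vec_eq_iff forall_2 axis_def)

context
  fixes S :: "(real^2) set" and u :: "real^2 \<Rightarrow> real"
  assumes S: "open S" and C2: "Ck_on 2 S u"
begin

abbreviation "du \<equiv> \<lambda>y. frechet_derivative u (at y)"
abbreviation "ddu \<equiv> \<lambda>v y. frechet_derivative (\<lambda>y. frechet_derivative u (at y) v) (at y)"

lemma du_grad:
  assumes "x \<in> S" shows "du x v = v $ 1 * grad u x $ 1 + v $ 2 * grad u x $ 2"
proof -
  note L = has_derivative_linear[OF Ck_on_2D(1)[OF C2 assms]]
  have "du x (v $ 1 *\<^sub>R axis 1 1 + v $ 2 *\<^sub>R axis 2 1) = v $ 1 * du x (axis 1 1) + v $ 2 * du x (axis 2 1)"
    by (simp only: linear_add[OF L] linear_scale[OF L] real_scaleR_def)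
  then show ?thesis by (simp add: vec2_eq_axis[of v, symmetric] grad_def partial_def)
qed

lemma ddu_partial:
  assumes x: "x \<in> S"
  shows "ddu v x w = (\<Sum>i\<in>UNIV. \<Sum>j\<in>UNIV. w $ i * v $ j * partial i (partial j u) x)"
proof -
  have "((\<lambda>y. v $ 1 * du y (axis 1 1) + v $ 2 * du y (axis 2 1)) has_derivative
      (\<lambda>w. v $ 1 * ddu (axis 1 1) x w + v $ 2 * ddu (axis 2 1) x w)) (at x)"
    by (intro derivative_intros Ck_on_2D(2)[OF C2 x])
  then have "((\<lambda>y. du y v) has_derivative (\<lambda>w. v $ 1 * ddu (axis 1 1) x w + v $ 2 * ddu (axis 2 1) x w)) (at x)"
    by (rule has_derivative_transform_within_open[OF _ S x]) (simp add: du_grad[of _ v] grad_def partial_def)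
  then have A: "ddu v x w = v $ 1 * ddu (axis 1 1) x w + v $ 2 * ddu (axis 2 1) x w"
    by (rule fun_cong[OF has_derivative_unique[OF Ck_on_2D(2)[OF C2 x]]])
  have B: "ddu e x w = w $ 1 * ddu e x (axis 1 1) + w $ 2 * ddu e x (axis 2 1)" for e
  proof -
    note L = has_derivative_linear[OF Ck_on_2D(2)[OF C2 x, of e]]
    have "ddu e x (w $ 1 *\<^sub>R axis 1 1 + w $ 2 *\<^sub>R axis 2 1) = w $ 1 * ddu e x (axis 1 1) + w $ 2 * ddu e x (axis 2 1)"
      by (simp only: linear_add[OF L] linear_scale[OF L] real_scaleR_def)
    then show ?thesis by (simp only: vec2_eq_axis[of w, symmetric])
  qed
  have "partial i (partial j u) x = ddu (axis j 1) x (axis i 1)" for i j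
    unfolding partial_def by simp
  then show ?thesis
    by (simp only: sum_2 A B[of "axis 1 1"] B[of "axis 2 1"]) (simp only: algebra_simps)
qed

lemma ddu_symmetric: "x \<in> S \<Longrightarrow> ddu v x w = ddu w x v"
  by (rule second_derivative_symmetric[OF S _ Ck_on_2D[OF C2]])

lemma grad_continuous: "continuous_on S (\<lambda>x. grad u x $ i)"
  unfolding grad_def partial_def
  using has_derivative_continuous[OF Ck_on_2D(2)[OF C2]] by (simp add: continuous_at_imp_continuous_on)

end

lemma linear_inv_bij:
  fixes T :: "'a::euclidean_space \<Rightarrow> 'b::euclidean_space"
  assumes "linear T" "bij T"
  shows "linear (inv T)"
proof -
  obtain g where g: "linear g" "g \<circ> T = id"
    using linear_injective_left_inverse[OF assms(1) bij_is_inj[OF assms(2)]] by blast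
  have "g = inv T"
  proof
    fix y
    obtain x where "y = T x" using assms(2) by (metis bij_is_surj surjD)
    then show "g y = inv T y" using g(2) assms(2) by (simp add: bij_is_inj fun_eq_iff)
  qed
  with g show ?thesis by simp
qed

text \<open>Only the symmetric part of the matrix acts on second derivatives, whence
  \<open>a 1 2 + a 2 1\<close>. The second derivatives in the directions \<open>(s, t)\<close> and
  \<open>(0, g)\<close> add up to the operator with the coefficients \<open>a i j\<close>.\<close>

lemma Cholesky_2:
  fixes a :: "2 \<Rightarrow> 2 \<Rightarrow> real"
  assumes l: "0 < l" and pd: "\<And>\<xi>::real^2. l * (norm \<xi>)\<^sup>2 \<le> (\<Sum>i\<in>UNIV. \<Sum>j\<in>UNIV. a i j * \<xi> $ i * \<xi> $ j)"
  obtains s t g :: real where "0 < s" "0 < g" "s\<^sup>2 = a 1 1" "2 * s * t = a 1 2 + a 2 1" "t\<^sup>2 + g\<^sup>2 = a 2 2"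
proof -
  define B where "B = (a 1 2 + a 2 1) / 2"
  have B2: "2 * B = a 1 2 + a 2 1" by (simp add: B_def)
  have pd2: "0 < a 1 1 * x\<^sup>2 + (a 1 2 + a 2 1) * x * y + a 2 2 * y\<^sup>2" if "x \<noteq> 0 \<or> y \<noteq> 0" for x y :: real
  proof -
    have "vector [x, y] \<noteq> (0 :: real^2)" using that by (auto simp: vec_eq_iff forall_2)
    then have "0 < l * (norm (vector [x, y] :: real^2))\<^sup>2" using l by simp
    also note pd[of "vector [x, y]"]
    finally show ?thesis by (simp add: sum_2 power2_eq_square algebra_simps)
  qed
  have a1: "0 < a 1 1" using pd2[of 1 0] by simp
  \<comment> \<open>The vector \<open>(- B, a 1 1)\<close> gives the quadratic form the value
    \<open>a 1 1\<close> times the determinant of the symmetric part.\<close>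
  have "0 < a 1 1 * (a 1 1 * a 2 2 - B\<^sup>2)"
    using pd2[of "- B" "a 1 1", folded B2] a1 by (simp add: power2_eq_square algebra_simps)
  then have D: "0 < a 1 1 * a 2 2 - B\<^sup>2" using a1 by (simp add: zero_less_mult_iff)
  define s where "s = sqrt (a 1 1)"
  have s: "0 < s" "s\<^sup>2 = a 1 1" using a1 by (auto simp: s_def)
  have D2: "0 < a 2 2 - (B / s)\<^sup>2" using D a1 by (simp add: power_divide s field_simps)
  show ?thesis
    by (rule that[of s "sqrt (a 2 2 - (B / s)\<^sup>2)" "B / s"]) (use s D2 in \<open>auto simp: B_def\<close>)
qed

text \<open>Local arguments cannot exclude the first case. In the second, the clause that a zero of
  \<open>grad u\<close> makes \<open>f\<close> vanish is kept so that further critical points near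
  \<open>x0\<close> can be ruled out through the estimate for \<open>f\<close>.\<close>

theorem critical_point_normal_form:
  fixes u :: "real^2 \<Rightarrow> real"
  assumes S: "open S" and sol: "classical_solution a S u" and a: "\<forall>i j. smooth_on UNIV (a i j)"
    and ell: "uniformly_elliptic_along a S u" and x0: "x0 \<in> S" and crit: "grad u x0 = 0"
  shows "(\<exists>r>0. \<forall>x. dist x x0 < r \<longrightarrow> grad u x = 0) \<or>
    (\<exists>n\<ge>2. \<exists>T. linear T \<and> bij T \<and> (\<forall>e>0. \<exists>r>0. \<forall>z::complex. norm z < r \<longrightarrow>
       x0 + T z \<in> S \<and> \<bar>u (x0 + T z) - u x0 - Re (z ^ n)\<bar> \<le> e * norm z ^ n \<and>
       (\<exists>f. ((\<lambda>w. u (x0 + T w)) has_derivative (\<lambda>h. Re (f * h))) (at z) \<and>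
          (grad u (x0 + T z) = 0 \<longrightarrow> f = 0) \<and>
          norm (f - of_nat n * z ^ (n - 1)) \<le> e * norm z ^ (n - 1))))"
proof -
  have C2: "Ck_on 2 S u"
    and pde: "\<And>x. x \<in> S \<Longrightarrow> (\<Sum>i\<in>UNIV. \<Sum>j\<in>UNIV. a i j (grad u x) * partial i (partial j u) x) = 0"
    using sol by (auto simp: classical_solution_def)
  obtain l where l: "0 < l" "\<And>\<xi>::real^2. l * (norm \<xi>)\<^sup>2 \<le> (\<Sum>i\<in>UNIV. \<Sum>j\<in>UNIV. a i j 0 * \<xi> $ i * \<xi> $ j)"
    using ell x0 crit unfolding uniformly_elliptic_along_def by (elim exE conjE) (drule bspec[OF _ x0], simp)
  obtain s t g where stg: "0 < s" "0 < g" "s\<^sup>2 = a 1 1 0" "2 * s * t = a 1 2 0 + a 2 1 0" "t\<^sup>2 + g\<^sup>2 = a 2 2 0"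
    using Cholesky_2[OF l] by blast
  let ?du = "\<lambda>y. frechet_derivative u (at y)"
  let ?ddu = "\<lambda>v y. frechet_derivative (\<lambda>y. frechet_derivative u (at y) v) (at y)"
  \<comment> \<open>The rows of the Cholesky factor: \<open>T\<close> sends the coordinate
    directions to \<open>l1\<close> and \<open>l2\<close>, in which the operator frozen at
    \<open>x0\<close> is the Laplacian.\<close>
  define l1 :: "real^2" where "l1 = vector [s, t]"
  define l2 :: "real^2" where "l2 = vector [0, g]"
  define T where "T = (\<lambda>z. Re z *\<^sub>R l1 + Im z *\<^sub>R l2)"
  have linT: "linear T" unfolding T_def by (intro linearI) (auto simp: algebra_simps)
  have T_nth: "T z $ 1 = s * Re z" "T z $ 2 = t * Re z + g * Im z" for z
    by (auto simp: T_def l1_def l2_def)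
  have bijT: "bij T"
  proof (rule o_bij)
    show "T \<circ> (\<lambda>v. Complex (v $ 1 / s) ((v $ 2 - t * (v $ 1 / s)) / g)) = id"
      using stg by (auto simp: fun_eq_iff vec_eq_iff forall_2 T_nth)
    show "(\<lambda>v. Complex (v $ 1 / s) ((v $ 2 - t * (v $ 1 / s)) / g)) \<circ> T = id"
      using stg by (auto simp: fun_eq_iff T_nth complex_eq_iff)
  qed
  \<comment> \<open>The minus sign makes \<open>Re (f z * h)\<close> the derivative of
    \<open>u (x0 + T z)\<close>. Thus \<open>f\<close> is twice a Wirtinger derivative, and its dbar
    derivative \<open>q\<close> is half the Laplacian.\<close>
  define f where "f = (\<lambda>z. Complex (?du (x0 + T z) l1) (- ?du (x0 + T z) l2))"
  define D where "D = (\<lambda>e z. Complex (?ddu l1 (x0 + T z) e) (- ?ddu l2 (x0 + T z) e))"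
  define p where "p = (\<lambda>z. (D l1 z - \<i> * D l2 z) / 2)"
  define q where "q = (\<lambda>z. (D l1 z + \<i> * D l2 z) / 2)"
  have bT: "bounded_linear T" using linT by (simp add: linear_conv_bounded_linear)
  have dT: "((\<lambda>z. x0 + T z) has_derivative T) (at z)" for z
    by (rule has_derivative_eq_rhs[OF has_derivative_add[OF has_derivative_const bounded_linear_imp_has_derivative[OF bT]]]) simp
  have cT: "continuous_on A (\<lambda>z. x0 + T z)" for A
    using has_derivative_continuous[OF dT] by (simp add: continuous_at_imp_continuous_on)
  have duT: "?du y (T h) = Re h * ?du y l1 + Im h * ?du y l2" if "y \<in> S" for y h
    unfolding T_def
    by (simp only: linear_add[OF has_derivative_linear[OF Ck_on_2D(1)[OF C2 that]]]
      linear_scale[OF has_derivative_linear[OF Ck_on_2D(1)[OF C2 that]]] real_scaleR_def)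
  have dduT: "?ddu v y (T h) = Re h * ?ddu v y l1 + Im h * ?ddu v y l2" if "y \<in> S" for y h v
    unfolding T_def
    by (simp only: linear_add[OF has_derivative_linear[OF Ck_on_2D(2)[OF C2 that]]]
      linear_scale[OF has_derivative_linear[OF Ck_on_2D(2)[OF C2 that]]] real_scaleR_def)
  have W: "wirtinger_C1 A f p q" if A: "\<And>z. z \<in> A \<Longrightarrow> x0 + T z \<in> S" for A
  proof -
    have c: "continuous_on A (\<lambda>z. ?ddu v (x0 + T z) w)" for v w
      by (rule continuous_on_compose2[OF Ck_on_2D(3)[OF C2] cT]) (use A in auto)
    then have cD: "continuous_on A (D e)" for e
      unfolding D_def by (intro continuous_intros)
    have "(f has_derivative (\<lambda>h. p z * h + q z * cnj h)) (at z)" if z: "z \<in> A" for z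
    proof -
      have d: "((\<lambda>z. ?du (x0 + T z) v) has_derivative (\<lambda>h. ?ddu v (x0 + T z) (T h))) (at z)" for v
        by (rule has_derivative_compose[OF dT Ck_on_2D(2)[OF C2 A[OF z]]])
      have "(f has_derivative (\<lambda>h. Complex (?ddu l1 (x0 + T z) (T h)) (- ?ddu l2 (x0 + T z) (T h)))) (at z)"
        unfolding f_def Complex_eq
        by (intro derivative_intros d)
      moreover have "p z * h + q z * cnj h = D l1 z * of_real (Re h) + D l2 z * of_real (Im h)" for h
        unfolding p_def q_def by (simp add: complex_eq_iff field_simps)
      moreover have "Complex (?ddu l1 (x0 + T z) (T h)) (- ?ddu l2 (x0 + T z) (T h)) = D l1 z * of_real (Re h) + D l2 z * of_real (Im h)" for h
        by (simp add: complex_eq_iff D_def dduT[OF A[OF z]] mult.commute)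
      ultimately show ?thesis by (simp only:)
    qed
    then show ?thesis unfolding wirtinger_C1_def p_def q_def using cD by (auto intro!: continuous_intros)
  qed
  have dU: "((\<lambda>w. u (x0 + T w)) has_derivative (\<lambda>h. Re (f z * h))) (at z)" if z: "x0 + T z \<in> S" for z
    by (rule has_derivative_eq_rhs[OF has_derivative_compose[OF dT Ck_on_2D(1)[OF C2 z]]])
      (simp add: fun_eq_iff f_def duT[OF z] mult.commute)
  have f_grad: "Re (f z) = s * grad u (x0 + T z) $ 1 + t * grad u (x0 + T z) $ 2"
    "Im (f z) = - g * grad u (x0 + T z) $ 2" if "x0 + T z \<in> S" for z
    using du_grad[OF S C2 that] by (auto simp: f_def l1_def l2_def)
  \<comment> \<open>\<open>f\<close> determines the gradient through a triangular system;
    \<open>K\<close> is the constant from solving it backwards.\<close>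
  define K where "K = (1 + \<bar>t\<bar> / g) / s + 1 / g"
  have K0: "0 < K" using stg by (auto simp: K_def intro!: add_nonneg_pos divide_nonneg_pos)
  have grad_f: "norm (grad u (x0 + T z)) \<le> K * norm (f z)" if z: "x0 + T z \<in> S" for z
  proof -
    let ?g = "grad u (x0 + T z)"
    have "g * \<bar>?g $ 2\<bar> \<le> norm (f z)"
      using abs_Im_le_cmod[of "f z"] f_grad[OF z] stg by (simp add: abs_mult)
    then have g2: "\<bar>?g $ 2\<bar> \<le> norm (f z) / g" using stg by (simp add: pos_le_divide_eq mult.commute)
    have "s * \<bar>?g $ 1\<bar> = \<bar>Re (f z) - t * ?g $ 2\<bar>"
      using f_grad[OF z] stg by (simp add: abs_mult)
    also have "\<dots> \<le> norm (f z) + \<bar>t\<bar> * (norm (f z) / g)"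
      using abs_Re_le_cmod[of "f z"] mult_left_mono[OF g2, of "\<bar>t\<bar>"] abs_mult[of t "?g $ 2"] by linarith
    finally have g1: "\<bar>?g $ 1\<bar> \<le> (norm (f z) + \<bar>t\<bar> * (norm (f z) / g)) / s"
      using stg by (simp add: pos_le_divide_eq mult.commute)
    have "norm ?g \<le> \<bar>?g $ 1\<bar> + \<bar>?g $ 2\<bar>" using norm_le_l1_cart[of ?g] by (simp add: sum_2)
    also have "\<dots> \<le> K * norm (f z)" using g1 g2 by (simp add: K_def add_divide_distrib algebra_simps)
    finally show ?thesis .
  qed
  have q_eq: "norm (q z) = \<bar>\<Sum>i\<in>UNIV. \<Sum>j\<in>UNIV. (a i j 0 - a i j (grad u (x0 + T z))) * partial i (partial j u) (x0 + T z)\<bar> / 2"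
    if z: "x0 + T z \<in> S" for z
  proof -
    let ?y = "x0 + T z"
    have sym: "partial 1 (partial 2 u) ?y = partial 2 (partial 1 u) ?y"
      using ddu_symmetric[OF S C2 z, of "axis 1 1" "axis 2 1"] unfolding partial_def by simp
    \<comment> \<open>The imaginary part of \<open>q z\<close> cancels by the symmetry of second
      derivatives.\<close>
    have "q z = of_real ((?ddu l1 ?y l1 + ?ddu l2 ?y l2) / 2)"
      using ddu_symmetric[OF S C2 z, of l1 l2] by (simp add: q_def D_def complex_eq_iff)
    then have "norm (q z) = \<bar>?ddu l1 ?y l1 + ?ddu l2 ?y l2\<bar> / 2" by (simp only: norm_of_real) simp
    also have "?ddu l1 ?y l1 + ?ddu l2 ?y l2 = s\<^sup>2 * partial 1 (partial 1 u) ?y + 2 * s * t * partial 1 (partial 2 u) ?y + (t\<^sup>2 + g\<^sup>2) * partial 2 (partial 2 u) ?y"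
      unfolding ddu_partial[OF S C2 z] by (simp add: sum_2 l1_def l2_def sym power2_eq_square algebra_simps)
    also have "\<dots> = (\<Sum>i\<in>UNIV. \<Sum>j\<in>UNIV. a i j 0 * partial i (partial j u) ?y)"
      unfolding stg by (simp add: sum_2 sym algebra_simps)
    \<comment> \<open>Subtracting the equation at \<open>?y\<close> leaves only differences of
      coefficients, which are small with the gradient.\<close>
    also have "\<dots> = (\<Sum>i\<in>UNIV. \<Sum>j\<in>UNIV. (a i j 0 - a i j (grad u ?y)) * partial i (partial j u) ?y)"
      using pde[OF z] by (simp add: left_diff_distrib sum_subtractf)
    finally show ?thesis .
  qed
  \<comment> \<open>Differentiability of the coefficients at 0 gives a linear bound in the gradient,
    which is continuous and vanishes at \<open>x0\<close>.\<close>
  have "\<exists>B. 0 \<le> B \<and> (\<forall>\<^sub>F y in nhds x0. \<bar>a i j 0 - a i j (grad u y)\<bar> \<le> B * norm (grad u y))" for i j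
  proof -
    have "Ck_on (Suc 0) UNIV (a i j)" using a by (auto simp: smooth_on_def)
    then have "a i j differentiable (at 0)" by simp
    then obtain B where B: "\<forall>\<^sub>F y in nhds 0. norm (a i j y - a i j 0) \<le> B * norm (y - 0)"
      using differentiable_linear_bound by blast
    have "continuous_on S (grad u)"
      using continuous_on_vec_lambda[OF grad_continuous[OF S C2], of "\<lambda>i. i"] by simp
    then have "(grad u \<longlongrightarrow> grad u x0) (nhds x0)"
      using S x0 by (simp add: continuous_on_eq_continuous_at isCont_def tendsto_at_iff_tendsto_nhds)
    then have "filterlim (grad u) (nhds 0) (nhds x0)" using crit by simp
    from eventually_compose_filterlim[OF B this]
    have "\<forall>\<^sub>F y in nhds x0. \<bar>a i j 0 - a i j (grad u y)\<bar> \<le> \<bar>B\<bar> * norm (grad u y)"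
      by eventually_elim (smt (verit) diff_zero mult_right_mono norm_ge_zero norm_minus_commute real_norm_def)
    then show ?thesis by (intro exI[of _ "\<bar>B\<bar>"]) simp
  qed
  then have "\<exists>B. \<forall>i j. 0 \<le> B i j \<and> (\<forall>\<^sub>F y in nhds x0. \<bar>a i j 0 - a i j (grad u y)\<bar> \<le> B i j * norm (grad u y))"
    by (intro choice allI)
  then obtain B where B: "\<And>i j. 0 \<le> B i j" "\<And>i j. \<forall>\<^sub>F y in nhds x0. \<bar>a i j 0 - a i j (grad u y)\<bar> \<le> B i j * norm (grad u y)"
    by blast
  define C where "C = (\<lambda>i j. \<bar>partial i (partial j u) x0\<bar> + 1)"
  have C: "\<forall>\<^sub>F y in nhds x0. \<bar>partial i (partial j u) y\<bar> \<le> C i j" for i j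
  proof -
    have "continuous_on S (\<lambda>y. \<bar>partial i (partial j u) y\<bar>)"
      using Ck_on_2D(3)[OF C2, of "axis j 1" "axis i 1"] unfolding partial_def by (intro continuous_intros)
    then have "isCont (\<lambda>y. \<bar>partial i (partial j u) y\<bar>) x0"
      using S x0 by (simp add: continuous_on_eq_continuous_at)
    then have "((\<lambda>y. \<bar>partial i (partial j u) y\<bar>) \<longlongrightarrow> \<bar>partial i (partial j u) x0\<bar>) (nhds x0)"
      unfolding isCont_def by (rule iffD1[OF tendsto_at_iff_tendsto_nhds])
    from order_tendstoD(2)[OF this, of "C i j"] show ?thesis
      by (auto simp: C_def elim: eventually_mono)
  qed
  have "\<forall>\<^sub>F y in nhds x0. y \<in> S \<and> (\<forall>i j. \<bar>a i j 0 - a i j (grad u y)\<bar> \<le> B i j * norm (grad u y) \<and> \<bar>partial i (partial j u) y\<bar> \<le> C i j)"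
    by (intro eventually_conj eventually_all_finite B(2) C eventually_nhds_in_open S x0)
  then obtain \<rho> where \<rho>: "0 < \<rho>" and all: "\<And>y. dist y x0 < \<rho> \<Longrightarrow> y \<in> S \<and> (\<forall>i j. \<bar>a i j 0 - a i j (grad u y)\<bar> \<le> B i j * norm (grad u y) \<and> \<bar>partial i (partial j u) y\<bar> \<le> C i j)"
    unfolding eventually_nhds_metric by blast
  have near: "\<And>y. dist y x0 < \<rho> \<Longrightarrow> y \<in> S"
      "\<And>y i j. dist y x0 < \<rho> \<Longrightarrow> \<bar>a i j 0 - a i j (grad u y)\<bar> \<le> B i j * norm (grad u y)"
      "\<And>y i j. dist y x0 < \<rho> \<Longrightarrow> \<bar>partial i (partial j u) y\<bar> \<le> C i j"
    using all by simp_all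
  obtain Kt where Kt: "0 < Kt" "\<And>z. norm (T z) \<le> norm z * Kt" using bounded_linear.pos_bounded[OF bT] by blast
  define r0 where "r0 = \<rho> / Kt"
  have r0: "0 < r0" using \<rho> Kt by (simp add: r0_def)
  have inball: "dist (x0 + T z) x0 < \<rho>" if "norm z < r0" for z
    using Kt(2)[of z] that Kt(1) by (simp add: r0_def dist_norm field_simps) 
  define M where "M = (\<Sum>i\<in>UNIV. \<Sum>j\<in>UNIV. B i j * C i j) * K"
  have M: "0 \<le> M" unfolding M_def C_def using B(1) K0 by (intro mult_nonneg_nonneg sum_nonneg) auto
  have q: "norm (q z) \<le> M * norm (f z)" if z: "norm z < r0" for z
  proof -
    let ?y = "x0 + T z"
    note y = inball[OF z]
    have "norm (q z) \<le> \<bar>\<Sum>i\<in>UNIV. \<Sum>j\<in>UNIV. (a i j 0 - a i j (grad u ?y)) * partial i (partial j u) ?y\<bar>"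
      using q_eq[OF near(1)[OF y]] by simp
    also have "\<dots> \<le> (\<Sum>i\<in>UNIV. \<Sum>j\<in>UNIV. \<bar>(a i j 0 - a i j (grad u ?y)) * partial i (partial j u) ?y\<bar>)"
      by (rule order_trans[OF sum_abs sum_mono[OF sum_abs]])
    also have "\<dots> \<le> (\<Sum>i\<in>UNIV. \<Sum>j\<in>UNIV. (B i j * (K * norm (f z))) * C i j)"
    proof (intro sum_mono)
      fix i j
      have "\<bar>a i j 0 - a i j (grad u ?y)\<bar> \<le> B i j * (K * norm (f z))"
        using near(2)[OF y, of i j] mult_left_mono[OF grad_f[OF near(1)[OF y]] B(1)[of i j]] by linarith
      then show "\<bar>(a i j 0 - a i j (grad u ?y)) * partial i (partial j u) ?y\<bar> \<le> (B i j * (K * norm (f z))) * C i j"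
        unfolding abs_mult by (rule mult_mono[OF _ near(3)[OF y]]) (use B(1) K0 in auto)
    qed
    also have "\<dots> = M * norm (f z)" unfolding M_def by (simp add: sum_2 algebra_simps)
    finally show ?thesis .
  qed
  have W0: "wirtinger_C1 (ball 0 r0) f p q"
    by (rule W) (use inball near(1) in auto)
  have f0: "f 0 = 0"
  proof -
    have T0: "T 0 = 0" using linT by (rule linear_0)
    show ?thesis using f_grad[of 0] x0 crit by (simp add: T0 complex_eq_iff)
  qed
  consider r where "r > 0" "\<forall>z. norm z < r \<longrightarrow> f z = 0"
    | n l where "n \<ge> 2" "l \<noteq> 0" "\<forall>e>0. \<exists>r>0. \<forall>z. norm z < r \<longrightarrow>
       \<bar>u (x0 + T (l * z)) - u (x0 + T 0) - Re (z ^ n)\<bar> \<le> e * norm z ^ n \<and>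
       norm (l * f (l * z) - of_nat n * z ^ (n - 1)) \<le> e * norm z ^ (n - 1)"
    using harmonic_normal_form[OF W0 r0 M q dU f0] inball near(1) by blast
  then show ?thesis
  proof cases
    case (1 r)
    obtain Ki where Ki: "0 < Ki" "\<And>v. norm (inv T v) \<le> norm v * Ki"
    proof -
      have "linear (inv T)" using linT bijT by (rule linear_inv_bij)
      then have "bounded_linear (inv T)" by (simp add: linear_conv_bounded_linear)
      then show ?thesis using that bounded_linear.pos_bounded by blast
    qed
    define r' where "r' = min \<rho> (r / Ki)"
    have "grad u x = 0" if x: "dist x x0 < r'" for x
    proof -
      let ?z = "inv T (x - x0)"
      have Tz: "x0 + T ?z = x" using bijT by (simp add: bij_is_surj surj_f_inv_f)
      have "norm ?z < r" using Ki(2)[of "x - x0"] x Ki(1) by (simp add: r'_def dist_norm field_simps)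
      then have "f ?z = 0" using 1 by blast
      moreover have "x \<in> S" using near(1)[of x] x by (simp add: r'_def)
      ultimately have "norm (grad u x) \<le> K * norm (0::complex)" using grad_f[of ?z] Tz by metis
      then show ?thesis by simp
    qed
    moreover have "0 < r'" using 1 \<rho> Ki by (simp add: r'_def)
    ultimately show ?thesis by blast
  next
    case (2 n l)
    let ?T = "\<lambda>z. T (l * z)"
    have "linear ?T" using linear_compose[OF linear_times[of l] linT] by (simp add: o_def)
    moreover have "bij ?T"
    proof -
      have "bij (\<lambda>z. l * z)" by (rule o_bij[of "\<lambda>z. z / l"]) (use 2(2) in \<open>auto simp: fun_eq_iff\<close>)
      from bij_comp[OF this bijT] show ?thesis by (simp add: o_def)
    qed
    moreover have "\<exists>r>0. \<forall>z::complex. norm z < r \<longrightarrow>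
       x0 + ?T z \<in> S \<and> \<bar>u (x0 + ?T z) - u x0 - Re (z ^ n)\<bar> \<le> e * norm z ^ n \<and>
       (\<exists>f. ((\<lambda>w. u (x0 + ?T w)) has_derivative (\<lambda>h. Re (f * h))) (at z) \<and>
          (grad u (x0 + ?T z) = 0 \<longrightarrow> f = 0) \<and>
          norm (f - of_nat n * z ^ (n - 1)) \<le> e * norm z ^ (n - 1))" if e: "e > 0" for e
    proof -
      obtain r where r: "r > 0" "\<And>z. norm z < r \<Longrightarrow>
         \<bar>u (x0 + T (l * z)) - u (x0 + T 0) - Re (z ^ n)\<bar> \<le> e * norm z ^ n \<and>
         norm (l * f (l * z) - of_nat n * z ^ (n - 1)) \<le> e * norm z ^ (n - 1)"
        using 2(3) e by blast
      define r' where "r' = min r (r0 / norm l)"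
      have "x0 + ?T z \<in> S \<and> \<bar>u (x0 + ?T z) - u x0 - Re (z ^ n)\<bar> \<le> e * norm z ^ n \<and>
       (\<exists>f. ((\<lambda>w. u (x0 + ?T w)) has_derivative (\<lambda>h. Re (f * h))) (at z) \<and>
          (grad u (x0 + ?T z) = 0 \<longrightarrow> f = 0) \<and>
          norm (f - of_nat n * z ^ (n - 1)) \<le> e * norm z ^ (n - 1))" if z: "norm z < r'" for z
      proof -
        have "norm (l * z) < r0" using z 2(2) by (simp add: r'_def norm_mult field_simps)
        then have zS: "x0 + T (l * z) \<in> S" using inball near(1) by blast
        have "((\<lambda>w. l * w) has_derivative (\<lambda>h. l * h)) (at z)" by (auto intro!: derivative_eq_intros)
        from has_derivative_compose[OF this dU[OF zS]]
        have d: "((\<lambda>w. u (x0 + ?T w)) has_derivative (\<lambda>h. Re ((l * f (l * z)) * h))) (at z)"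
          by (rule has_derivative_eq_rhs) (simp only: fun_eq_iff mult.assoc mult.left_commute[of l] simp_thms)
        have g0: "grad u (x0 + ?T z) = 0 \<longrightarrow> l * f (l * z) = 0"
          using f_grad[OF zS] by (simp add: complex_eq_iff)
        have "x0 + T 0 = x0" using linear_0[OF linT] by simp
        with r(2)[of z] z have "\<bar>u (x0 + T (l * z)) - u x0 - Re (z ^ n)\<bar> \<le> e * norm z ^ n"
          "norm (l * f (l * z) - of_nat n * z ^ (n - 1)) \<le> e * norm z ^ (n - 1)"
          by (simp_all add: r'_def)
        then show ?thesis by (intro conjI zS exI[of _ "l * f (l * z)"] d g0)
      qed
      moreover have "0 < r'" using r r0 2(2) by (simp add: r'_def)
      ultimately show ?thesis by blast
    qed
    ultimately show ?thesis using 2(1) by blast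
  qed
qed

section \<open>The multiplicity of a saddle\<close>

text \<open>Away from its start the germ misses \<open>x0\<close>, the only point which the arcs
  \<open>h' b\<close> may share. So finitely many disjoint closed sets cover the connected set of
  parameters, and one of them is everything; the start follows by closure.\<close>

lemma arc_germ_in_one_arc:
  fixes h :: "real \<Rightarrow> 'a::metric_space" and h' :: "'b \<Rightarrow> real \<Rightarrow> 'a"
  assumes h: "arc h" "pathstart h = x0" and B: "finite B"
    and h': "\<And>b. b \<in> B \<Longrightarrow> arc (h' b)"
    and disj: "\<And>b c. b \<in> B \<Longrightarrow> c \<in> B \<Longrightarrow> b \<noteq> c \<Longrightarrow> path_image (h' b) \<inter> path_image (h' c) \<subseteq> {x0}"
    and near: "\<And>t. t \<in> {0..\<tau>} \<Longrightarrow> h t \<in> (\<Union>b\<in>B. path_image (h' b))" and \<tau>: "0 < \<tau>" "\<tau> \<le> 1"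
  obtains b where "b \<in> B" "h ` {0..\<tau>} \<subseteq> path_image (h' b)"
proof -
  define C where "C = (\<lambda>b. {t \<in> {0<..\<tau>}. h t \<in> path_image (h' b)})"
  have ch: "continuous_on {0<..\<tau>} h"
    by (rule continuous_on_subset[OF arc_imp_path[OF h(1), unfolded path_def]]) (use \<tau> in auto)
  have h0: "h t \<noteq> x0" if "t \<in> {0<..\<tau>}" for t
    using arc_imp_inj_on[OF h(1)] h(2) that \<tau> by (auto simp: pathstart_def dest!: inj_onD[of _ _ t 0])
  have closedC: "closedin (top_of_set {0<..\<tau>}) (C b)" if "b \<in> B" for b
    unfolding C_def using continuous_closedin_preimage[OF ch closed_path_image[OF arc_imp_path[OF h'[OF that]]]]
    by (simp add: vimage_def Int_def)
  obtain b where b: "b \<in> B" "\<tau> \<in> C b" using near[of \<tau>] \<tau> by (auto simp: C_def)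
  have cover: "{0<..\<tau>} \<subseteq> C b \<union> (\<Union>c\<in>B - {b}. C c)"
  proof
    fix t assume t: "t \<in> {0<..\<tau>}"
    then obtain c where "c \<in> B" "h t \<in> path_image (h' c)" using near[of t] by auto
    then show "t \<in> C b \<union> (\<Union>c\<in>B - {b}. C c)" using t by (auto simp: C_def)
  qed
  have "C b \<inter> (\<Union>c\<in>B - {b}. C c) = {}" using disj[OF b(1)] h0 unfolding C_def by blast
  moreover have "closedin (top_of_set {0<..\<tau>}) (\<Union>c\<in>B - {b}. C c)"
    using B closedC by (intro closedin_Union) auto
  moreover have "connected {0<..\<tau>}" by (rule convex_connected) (rule convex_real_interval)
  ultimately have "(\<Union>c\<in>B - {b}. C c) = {}"
    using connected_closedin[of "{0<..\<tau>}"] closedC[OF b(1)] cover b(2) by blast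
  then have sub: "h t \<in> path_image (h' b)" if "t \<in> {0<..\<tau>}" for t
  proof -
    have "t \<in> C b" using cover that \<open>(\<Union>c\<in>B - {b}. C c) = {}\<close> by blast
    then show ?thesis by (simp add: C_def)
  qed
  have "h 0 \<in> path_image (h' b)"
  proof -
    have "continuous_on {0..\<tau>} h"
      by (rule continuous_on_subset[OF arc_imp_path[OF h(1), unfolded path_def]]) (use \<tau> in auto)
    moreover have "closure {0<..\<tau>} = {0..\<tau>}" using \<tau> by simp
    moreover have "h ` {0<..\<tau>} \<subseteq> path_image (h' b)" using sub by blast
    ultimately have "h ` {0..\<tau>} \<subseteq> path_image (h' b)"
      using image_closure_subset[of "{0<..\<tau>}" h "path_image (h' b)"]
        closed_path_image[OF arc_imp_path[OF h'[OF b(1)]]] by simp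
    then show ?thesis using \<tau> by auto
  qed
  with sub have "h t \<in> path_image (h' b)" if "t \<in> {0..\<tau>}" for t using that by (cases "t = 0") auto
  then show ?thesis using that b(1) by blast
qed

text \<open>Read through the inverse of \<open>k\<close>, each germ is a continuous real function
  that starts at 0 and reaches a positive value. By the intermediate value theorem it covers an
  initial piece of \<open>k\<close>, and two initial pieces share a point other than
  \<open>x0\<close>.\<close>

lemma arc_germs_meet:
  fixes h1 h2 k :: "real \<Rightarrow> 'a::{t2_space,metric_space}"
  assumes h1: "arc h1" "pathstart h1 = x0" "h1 ` {0..\<tau>1} \<subseteq> path_image k" "0 < \<tau>1" "\<tau>1 \<le> 1"
    and h2: "arc h2" "pathstart h2 = x0" "h2 ` {0..\<tau>2} \<subseteq> path_image k" "0 < \<tau>2" "\<tau>2 \<le> 1"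
    and k: "arc k" "pathstart k = x0"
  shows "\<exists>y. y \<noteq> x0 \<and> y \<in> path_image h1 \<and> y \<in> path_image h2"
proof -
  define ki where "ki = inv_into {0..1} k"
  have inj: "inj_on k {0..1}" using arc_imp_inj_on[OF k(1)] .
  have cki: "continuous_on (path_image k) ki"
    unfolding path_image_def ki_def
    by (rule continuous_on_inv) (use arc_imp_path[OF k(1)] inj in \<open>auto simp: path_def\<close>)
  have reach: "\<exists>s>0. s \<le> 1 \<and> (\<forall>t\<in>{0..s}. k t \<in> path_image h)"
    if h: "arc h" "pathstart h = x0" "h ` {0..\<tau>} \<subseteq> path_image k" "0 < \<tau>" "\<tau> \<le> 1" for h :: "real \<Rightarrow> 'a" and \<tau>
  proof -
    have c: "continuous_on {0..\<tau>} (\<lambda>t. ki (h t))"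
      by (rule continuous_on_compose2[OF cki _ h(3)])
        (use arc_imp_path[OF h(1)] h(5) in \<open>auto simp: path_def intro: continuous_on_subset\<close>)
    have kki: "k (ki (h t)) = h t" "ki (h t) \<in> {0..1}" if "t \<in> {0..\<tau>}" for t
    proof -
      have "h t \<in> k ` {0..1}" using h(3) that unfolding path_image_def by blast
      then show "k (ki (h t)) = h t" "ki (h t) \<in> {0..1}"
        unfolding ki_def by (rule f_inv_into_f, rule inv_into_into)
    qed
    have h0: "ki (h 0) = 0"
      using h(2) k(2) inj by (auto simp: ki_def pathstart_def intro: inv_into_f_eq)
    have "h \<tau> \<noteq> x0"
      using arc_imp_inj_on[OF h(1)] h(2,4,5) by (auto simp: pathstart_def dest!: inj_onD[of _ _ \<tau> 0])
    then have "ki (h \<tau>) \<noteq> 0" using kki(1)[of \<tau>] h(4) k(2) by (auto simp: pathstart_def)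
    then have s: "0 < ki (h \<tau>)" "ki (h \<tau>) \<le> 1" using kki(2)[of \<tau>] h(4) by auto
    have "k t \<in> path_image h" if t: "t \<in> {0..ki (h \<tau>)}" for t
    proof -
      obtain x where "x \<in> {0..\<tau>}" "ki (h x) = t"
        using IVT'[of "\<lambda>t. ki (h t)" 0 t \<tau>] c h0 t h(4) by auto
      then show ?thesis using kki(1)[of x] h(5) by (auto simp: path_image_def)
    qed
    then show ?thesis using s by blast
  qed
  obtain s1 where s1: "s1 > 0" "s1 \<le> 1" "\<forall>t\<in>{0..s1}. k t \<in> path_image h1" using reach[OF h1] by blast
  obtain s2 where s2: "s2 > 0" "s2 \<le> 1" "\<forall>t\<in>{0..s2}. k t \<in> path_image h2" using reach[OF h2] by blast
  have "k (min s1 s2) \<noteq> x0"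
    using inj k(2) s1 s2 by (auto simp: pathstart_def dest!: inj_onD[of _ _ "min s1 s2" 0])
  then show ?thesis using s1 s2 by (intro exI[of _ "k (min s1 s2)"]) auto
qed

text \<open>Every arc of the first family starts inside one arc of the second. Two arcs that start
  inside the same one would meet again, so this assignment is injective; the number of branches at
  \<open>x0\<close> is therefore intrinsic.\<close>

lemma arc_germs_card_le:
  fixes h :: "'b \<Rightarrow> real \<Rightarrow> 'a::{t2_space,metric_space}" and h' :: "'c \<Rightarrow> real \<Rightarrow> 'a"
  assumes h: "\<And>a. a \<in> A \<Longrightarrow> arc (h a) \<and> pathstart (h a) = x0"
    and hd: "\<And>a b. a \<in> A \<Longrightarrow> b \<in> A \<Longrightarrow> a \<noteq> b \<Longrightarrow> path_image (h a) \<inter> path_image (h b) \<subseteq> {x0}"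
    and B: "finite B" and h': "\<And>b. b \<in> B \<Longrightarrow> arc (h' b) \<and> pathstart (h' b) = x0"
    and hd': "\<And>b c. b \<in> B \<Longrightarrow> c \<in> B \<Longrightarrow> b \<noteq> c \<Longrightarrow> path_image (h' b) \<inter> path_image (h' c) \<subseteq> {x0}"
    and V: "x0 \<in> interior V" and cover: "\<And>a. a \<in> A \<Longrightarrow> V \<inter> path_image (h a) \<subseteq> (\<Union>b\<in>B. path_image (h' b))"
  shows "card A \<le> card B"
proof -
  have ex: "\<exists>b \<tau>. b \<in> B \<and> 0 < \<tau> \<and> \<tau> \<le> 1 \<and> h a ` {0..\<tau>} \<subseteq> path_image (h' b)" if a: "a \<in> A" for a
  proof -
    have "continuous_on {0..1} (h a)" using h[OF a] arc_imp_path by (auto simp: path_def)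
    moreover have "h a 0 \<in> interior V" using h[OF a] V by (simp add: pathstart_def)
    moreover obtain e where e: "e > 0" "ball (h a 0) e \<subseteq> interior V"
      using calculation(2) open_contains_ball open_interior by blast
    ultimately obtain d where d: "d > 0" "\<And>t. t \<in> {0..1} \<Longrightarrow> dist t 0 < d \<Longrightarrow> dist (h a t) (h a 0) < e"
      unfolding continuous_on_iff by (metis atLeastAtMost_iff order_refl zero_le_one)
    define \<tau> where "\<tau> = min 1 (d / 2)"
    have \<tau>: "0 < \<tau>" "\<tau> \<le> 1" using d by (auto simp: \<tau>_def)
    have near: "h a t \<in> (\<Union>b\<in>B. path_image (h' b))" if t: "t \<in> {0..\<tau>}" for t
    proof -
      have "t \<in> {0..1}" using t by (simp add: \<tau>_def)
      moreover have "h a t \<in> V"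
      proof -
        have "h a t \<in> ball (h a 0) e" using d(2)[of t] t d(1) by (auto simp: \<tau>_def dist_commute)
        then show ?thesis using e(2) interior_subset[of V] by blast
      qed
      ultimately have "h a t \<in> V \<inter> path_image (h a)" unfolding path_image_def by blast
      then show ?thesis using cover[OF a] by blast
    qed
    show ?thesis
      by (rule arc_germ_in_one_arc[of "h a" x0 B h' \<tau>]) (use h[OF a] B h' hd' near \<tau> in auto)
  qed
  have "\<exists>f. \<forall>a\<in>A. \<exists>\<tau>. f a \<in> B \<and> 0 < \<tau> \<and> \<tau> \<le> 1 \<and> h a ` {0..\<tau>} \<subseteq> path_image (h' (f a))"
    by (intro bchoice ballI ex)
  then obtain f where "\<forall>a\<in>A. \<exists>\<tau>. f a \<in> B \<and> 0 < \<tau> \<and> \<tau> \<le> 1 \<and> h a ` {0..\<tau>} \<subseteq> path_image (h' (f a))" ..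
  then have "\<exists>\<tau>. \<forall>a\<in>A. f a \<in> B \<and> 0 < \<tau> a \<and> \<tau> a \<le> 1 \<and> h a ` {0..\<tau> a} \<subseteq> path_image (h' (f a))"
    by (rule bchoice)
  then obtain \<tau> where f: "\<And>a. a \<in> A \<Longrightarrow> f a \<in> B \<and> 0 < \<tau> a \<and> \<tau> a \<le> 1 \<and> h a ` {0..\<tau> a} \<subseteq> path_image (h' (f a))"
    by blast
  have "inj_on f A"
  proof (rule inj_onI, rule ccontr)
    fix a b assume ab: "a \<in> A" "b \<in> A" "f a = f b" "a \<noteq> b"
    have "\<exists>y. y \<noteq> x0 \<and> y \<in> path_image (h a) \<and> y \<in> path_image (h b)"
      using arc_germs_meet[of "h a" x0 "\<tau> a" "h' (f a)" "h b" "\<tau> b"] h f[OF ab(1)] f[OF ab(2)] h' ab by auto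
    then show False using hd[OF ab(1,2,4)] by blast
  qed
  then show ?thesis using B f by (intro card_inj_on_le[of f]) auto
qed

text \<open>Each arc is cut at \<open>x0\<close>; the boolean selects the half. Branches that start
  at \<open>x0\<close> can be compared between two descriptions, whereas the pairing of halves into
  arcs is arbitrary.\<close>

lemma is_multiplicity_half_arcs:
  assumes "is_multiplicity S u x0 m"
  obtains V and h :: "nat \<times> bool \<Rightarrow> real \<Rightarrow> real^2"
  where "x0 \<in> interior V" "\<And>a. a \<in> {..m} \<times> UNIV \<Longrightarrow> arc (h a) \<and> pathstart (h a) = x0"
    "\<And>a b. a \<in> {..m} \<times> UNIV \<Longrightarrow> b \<in> {..m} \<times> UNIV \<Longrightarrow> a \<noteq> b \<Longrightarrow> path_image (h a) \<inter> path_image (h b) \<subseteq> {x0}"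
    "{x \<in> V. u x = u x0} = (\<Union>a\<in>{..m} \<times> UNIV. path_image (h a))"
proof -
  from assms obtain V and g :: "nat \<Rightarrow> real \<Rightarrow> real^2" where V: "x0 \<in> interior V"
    and "\<forall>i\<le>m. arc (g i) \<and> x0 \<in> path_image (g i) - {pathstart (g i), pathfinish (g i)}"
    and "\<forall>i\<le>m. \<forall>j\<le>m. i \<noteq> j \<longrightarrow> path_image (g i) \<inter> path_image (g j) = {x0}"
    and un: "{x \<in> V. u x = u x0} = (\<Union>i\<le>m. path_image (g i))"
    unfolding is_multiplicity_def by blast
  then have g: "\<And>i. i \<le> m \<Longrightarrow> arc (g i)" "\<And>i. i \<le> m \<Longrightarrow> x0 \<in> path_image (g i) - {pathstart (g i), pathfinish (g i)}"
    and gd: "\<And>i j. i \<le> m \<Longrightarrow> j \<le> m \<Longrightarrow> i \<noteq> j \<Longrightarrow> path_image (g i) \<inter> path_image (g j) = {x0}"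
    by blast+
  have "\<exists>s. 0 < s \<and> s < 1 \<and> g i s = x0" if i: "i \<le> m" for i
  proof -
    obtain s where "s \<in> {0..1}" "g i s = x0" using g(2)[OF i] by (auto simp: path_image_def)
    moreover have "s \<noteq> 0" "s \<noteq> 1" using g(2)[OF i] calculation by (auto simp: pathstart_def pathfinish_def)
    ultimately show ?thesis by (intro exI[of _ s]) auto
  qed
  then obtain s where s: "\<And>i. i \<le> m \<Longrightarrow> 0 < s i \<and> s i < 1 \<and> g i (s i) = x0" by metis
  define h where "h = (\<lambda>(i, b). subpath (s i) (if b then 1 else 0) (g i))"
  have im: "path_image (h (i, b)) = g i ` (if b then {s i..1} else {0..s i})" if "i \<le> m" for i b
    using s[OF that] by (auto simp: h_def path_image_subpath_gen closed_segment_eq_real_ivl)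
  have sub: "path_image (h (i, b)) \<subseteq> path_image (g i)" if "i \<le> m" for i b
    unfolding im[OF that] path_image_def[of "g i"] using s[OF that] by auto
  show ?thesis
  proof (rule that[of V h])
    fix a :: "nat \<times> bool" assume a: "a \<in> {..m} \<times> UNIV"
    obtain i b where ab: "a = (i, b)" by force
    with a have i: "i \<le> m" by simp
    show "arc (h a) \<and> pathstart (h a) = x0"
      unfolding ab h_def using s[OF i] g(1)[OF i] by (auto intro!: arc_subpath_arc)
  next
    fix a b :: "nat \<times> bool" assume a: "a \<in> {..m} \<times> UNIV" and b: "b \<in> {..m} \<times> UNIV" and ne: "a \<noteq> b"
    obtain i b1 where ab: "a = (i, b1)" by force
    with a have i: "i \<le> m" by simp
    obtain j b2 where bb: "b = (j, b2)" by force
    with b have j: "j \<le> m" by simp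
    show "path_image (h a) \<inter> path_image (h b) \<subseteq> {x0}"
    proof (cases "i = j")
      case False
      have "path_image (h a) \<subseteq> path_image (g i)" "path_image (h b) \<subseteq> path_image (g j)"
        unfolding ab bb using sub[OF i] sub[OF j] by blast+
      then show ?thesis using gd[OF i j False] by blast
    next
      case True
      have inj: "inj_on (g i) {0..1}" using g(1)[OF i] by (rule arc_imp_inj_on)
      have "g i ` {s i..1} \<inter> g i ` {0..s i} = g i ` ({s i..1} \<inter> {0..s i})"
        using s[OF i] by (intro inj_on_image_Int[OF inj, symmetric]) auto
      also have "{s i..1} \<inter> {0..s i} = {s i}" using s[OF i] by auto
      finally show ?thesis using ne s[OF i] True i unfolding ab bb by (cases b1; cases b2) (auto simp: im)
    qed
  next
    have "path_image (g i) = path_image (h (i, True)) \<union> path_image (h (i, False))" if "i \<le> m" for i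
    proof -
      have "{0..1} = {s i..1} \<union> {0..s i}" using s[OF that] by auto
      then show ?thesis unfolding im[OF that] path_image_def[of "g i"] by (simp add: image_Un)
    qed
    then have "(\<Union>i\<le>m. path_image (g i)) = (\<Union>a\<in>{..m} \<times> UNIV. path_image (h a))"
      by (auto simp: UNIV_bool)
    then show "{x \<in> V. u x = u x0} = (\<Union>a\<in>{..m} \<times> UNIV. path_image (h a))" using un by simp
  qed (use V in simp)
qed

lemma is_multiplicity_le:
  assumes "is_multiplicity S u x0 m" "is_multiplicity S u x0 m'"
  shows "m \<le> m'"
proof -
  obtain V and h :: "nat \<times> bool \<Rightarrow> real \<Rightarrow> real^2" where h: "x0 \<in> interior V" "\<And>a. a \<in> {..m} \<times> UNIV \<Longrightarrow> arc (h a) \<and> pathstart (h a) = x0"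
    "\<And>a b. a \<in> {..m} \<times> UNIV \<Longrightarrow> b \<in> {..m} \<times> UNIV \<Longrightarrow> a \<noteq> b \<Longrightarrow> path_image (h a) \<inter> path_image (h b) \<subseteq> {x0}"
    "{x \<in> V. u x = u x0} = (\<Union>a\<in>{..m} \<times> UNIV. path_image (h a))"
    using is_multiplicity_half_arcs[OF assms(1)] by blast
  obtain V' and h' :: "nat \<times> bool \<Rightarrow> real \<Rightarrow> real^2" where h': "x0 \<in> interior V'" "\<And>a. a \<in> {..m'} \<times> UNIV \<Longrightarrow> arc (h' a) \<and> pathstart (h' a) = x0"
    "\<And>a b. a \<in> {..m'} \<times> UNIV \<Longrightarrow> b \<in> {..m'} \<times> UNIV \<Longrightarrow> a \<noteq> b \<Longrightarrow> path_image (h' a) \<inter> path_image (h' b) \<subseteq> {x0}"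
    "{x \<in> V'. u x = u x0} = (\<Union>a\<in>{..m'} \<times> UNIV. path_image (h' a))"
    using is_multiplicity_half_arcs[OF assms(2)] by blast
  have "card ({..m} \<times> (UNIV :: bool set)) \<le> card ({..m'} \<times> (UNIV :: bool set))"
  proof (rule arc_germs_card_le[OF h(2,3) _ h'(2,3) h'(1)])
    fix a :: "nat \<times> bool" assume "a \<in> {..m} \<times> UNIV"
    then have "path_image (h a) \<subseteq> {x \<in> V. u x = u x0}" using h(4) by blast
    then show "V' \<inter> path_image (h a) \<subseteq> (\<Union>b\<in>{..m'} \<times> UNIV. path_image (h' b))"
      unfolding h'(4)[symmetric] by blast
  qed auto
  then show ?thesis by (simp add: card_cartesian_product)
qed

lemma is_multiplicity_unique:
  "is_multiplicity S u x0 m \<Longrightarrow> is_multiplicity S u x0 m' \<Longrightarrow> m = m'"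
  by (simp add: is_multiplicity_le order_antisym)

text \<open>Since the error factor \<open>1/2\<close> is smaller than \<open>cos (pi / 4)\<close>, on each circle \<open>U\<close> vanishes only
  within the angle \<open>\<delta>\<close> of a zero of the leading term \<open>Re (z ^ n)\<close>, and it is strictly monotone there.\<close>

locale saddle_form =
  fixes U :: "complex \<Rightarrow> real" and f :: "complex \<Rightarrow> complex" and n :: nat and r :: real
  assumes n: "1 \<le> n" and r: "0 < r"
    and U_lead: "\<And>z. norm z \<le> r \<Longrightarrow> \<bar>U z - Re (z ^ n)\<bar> \<le> 1/2 * norm z ^ n"
    and f_lead: "\<And>z. norm z \<le> r \<Longrightarrow> norm (f z - of_nat n * z ^ (n - 1)) \<le> 1/2 * norm z ^ (n - 1)"
    and U_deriv: "\<And>z. norm z \<le> r \<Longrightarrow> (U has_derivative (\<lambda>h. Re (f z * h))) (at z)"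
begin

text \<open>The \<open>j\<close>-th direction in which \<open>Re (z ^ n)\<close> vanishes.
  Neighbouring directions differ by \<open>pi / n\<close>, which is \<open>4 * \<delta>\<close>, so
  the sectors around them meet only at 0.\<close>

definition ctr :: "nat \<Rightarrow> real" where "ctr j = (2 * real j + 1) * pi / (2 * real n)"

definition \<delta> :: real where "\<delta> = pi / (4 * real n)"

definition sector :: "nat \<Rightarrow> complex set" where
  "sector j = (\<lambda>(\<rho>, \<phi>). of_real \<rho> * cis (ctr j + \<phi>)) ` ({0..r} \<times> {-\<delta>..\<delta>})"

definition zeros :: "nat \<Rightarrow> complex set" where "zeros j = {z \<in> sector j. U z = 0}"

lemma \<delta>_pos: "0 < \<delta>" using n by (simp add: \<delta>_def)

lemma U_0: "U 0 = 0" using U_lead[of 0] r n by (simp add: power_0_left)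

lemma U_polar:
  assumes "0 \<le> \<rho>" "\<rho> \<le> r"
  shows "\<bar>U (of_real \<rho> * cis \<theta>) - \<rho> ^ n * cos (real n * \<theta>)\<bar> \<le> 1/2 * \<rho> ^ n"
  using U_lead[of "of_real \<rho> * cis \<theta>"] assms
  by (simp add: norm_mult power_mult_distrib Complex.DeMoivre flip: of_real_power)

lemma U_polar_deriv:
  assumes "0 < \<rho>" "\<rho> \<le> r"
  obtains d where "((\<lambda>\<theta>. U (of_real \<rho> * cis \<theta>)) has_real_derivative d) (at \<theta>)"
    "\<bar>d + real n * \<rho> ^ n * sin (real n * \<theta>)\<bar> \<le> 1/2 * \<rho> ^ n"
proof -
  let ?z = "of_real \<rho> * cis \<theta>"
  have z: "norm ?z = \<rho>" using assms by (simp add: norm_mult)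
  have "((\<lambda>\<theta>. of_real \<rho> * cis \<theta>) has_vector_derivative (\<i> * ?z)) (at \<theta>)"
    unfolding cis_conv_exp
    by (rule has_vector_derivative_eq_rhs, rule has_vector_derivative_real_field, (rule derivative_eq_intros refl | simp)+)
  then have "((\<lambda>\<theta>. of_real \<rho> * cis \<theta>) has_derivative (\<lambda>h. h *\<^sub>R (\<i> * ?z))) (at \<theta>)"
    by (simp add: has_vector_derivative_def)
  from has_derivative_compose[OF this U_deriv]
  have "((\<lambda>\<theta>. U (of_real \<rho> * cis \<theta>)) has_derivative (\<lambda>h. Re (f ?z * (h *\<^sub>R (\<i> * ?z))))) (at \<theta>)"
    using z assms by simp
  moreover have "Re (f ?z * (h *\<^sub>R (\<i> * ?z))) = Re (f ?z * (\<i> * ?z)) * h" for h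
    by (simp only: mult_scaleR_right scaleR_complex.sel mult.commute)
  ultimately have 1: "((\<lambda>\<theta>. U (of_real \<rho> * cis \<theta>)) has_real_derivative (Re (f ?z * (\<i> * ?z)))) (at \<theta>)"
    unfolding has_field_derivative_def by (simp only:)
  have "of_nat n * ?z ^ (n - 1) * (\<i> * ?z) = of_nat n * \<i> * ?z ^ n"
    using n by (cases n) auto
  also have "?z ^ n = of_real (\<rho> ^ n) * cis (real n * \<theta>)" by (simp add: power_mult_distrib Complex.DeMoivre)
  also have "of_nat n * \<i> * (of_real (\<rho> ^ n) * cis (real n * \<theta>)) = of_real (real n * \<rho> ^ n) * (\<i> * cis (real n * \<theta>))" by simp
  finally have eq: "of_nat n * ?z ^ (n - 1) * (\<i> * ?z) = of_real (real n * \<rho> ^ n) * (\<i> * cis (real n * \<theta>))" .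
  have 2: "Re (of_nat n * ?z ^ (n - 1) * (\<i> * ?z)) = - (real n * \<rho> ^ n * sin (real n * \<theta>))"
    unfolding eq by simp
  have "\<bar>Re (f ?z * (\<i> * ?z)) + real n * \<rho> ^ n * sin (real n * \<theta>)\<bar> = \<bar>Re ((f ?z - of_nat n * ?z ^ (n - 1)) * (\<i> * ?z))\<bar>"
    using 2 by (simp only: left_diff_distrib minus_complex.sel)
  also have "\<dots> \<le> norm ((f ?z - of_nat n * ?z ^ (n - 1)) * (\<i> * ?z))" by (rule abs_Re_le_cmod)
  also have "\<dots> = norm (f ?z - of_nat n * ?z ^ (n - 1)) * \<rho>" using z by (simp only: norm_mult norm_ii mult_1)
  also have "\<dots> \<le> (1/2 * \<rho> ^ (n - 1)) * \<rho>" using f_lead[of ?z] z assms by (intro mult_right_mono) auto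
  also have "\<dots> = 1/2 * \<rho> ^ n" using n by (cases n) auto
  finally show ?thesis using 1 that by blast
qed

lemma cos_sin_ctr:
  "cos (real n * (ctr j + \<phi>)) = - ((-1) ^ j * sin (real n * \<phi>))" "sin (real n * (ctr j + \<phi>)) = (-1) ^ j * cos (real n * \<phi>)"
proof -
  have "real n * (ctr j + \<phi>) = real j * pi + (pi / 2 + real n * \<phi>)"
    using n by (simp add: ctr_def field_simps)
  moreover have "cos (real j * pi + x) = (-1) ^ j * cos x" "sin (real j * pi + x) = (-1) ^ j * sin x" for x
    by (simp_all add: cos_add sin_add)
  ultimately show "cos (real n * (ctr j + \<phi>)) = - ((-1) ^ j * sin (real n * \<phi>))" "sin (real n * (ctr j + \<phi>)) = (-1) ^ j * cos (real n * \<phi>)"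
    by (simp_all add: cos_add sin_add)
qed

lemma sqrt2_half: "(1::real) / 2 < sqrt 2 / 2"
  using real_less_rsqrt[of 1 2] by simp

lemma cos_gt_half: "\<bar>\<phi>\<bar> \<le> \<delta> \<Longrightarrow> 1/2 < cos (real n * \<phi>)"
proof -
  assume "\<bar>\<phi>\<bar> \<le> \<delta>"
  then have "real n * \<bar>\<phi>\<bar> \<le> real n * \<delta>" by (intro mult_left_mono) auto
  then have "\<bar>real n * \<phi>\<bar> \<le> pi / 4" using n by (simp add: \<delta>_def abs_mult)
  then have "cos (pi / 4) \<le> cos \<bar>real n * \<phi>\<bar>" using pi_gt_zero by (intro cos_monotone_0_pi_le) auto
  then show ?thesis using sqrt2_half by (simp only: cos_45 cos_abs_real)
qed

lemma unique_zero:
  assumes \<rho>: "0 < \<rho>" "\<rho> \<le> r"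
  shows "\<exists>!\<phi>. \<phi> \<in> {-\<delta>..\<delta>} \<and> U (of_real \<rho> * cis (ctr j + \<phi>)) = 0"
proof -
  \<comment> \<open>The sign makes \<open>?G\<close> close to
    \<open>\<rho> ^ n * sin (n * \<phi>)\<close> for every \<open>j\<close>. At the edges the sine
    is \<open>sqrt 2 / 2\<close> in modulus and beats the error 1/2, so \<open>?G\<close> changes
    sign; inside, the cosine exceeds 1/2 and the derivative is positive.\<close>
  let ?G = "\<lambda>\<phi>. - ((-1) ^ j * U (of_real \<rho> * cis (ctr j + \<phi>)))"
  have \<rho>n: "0 < \<rho> ^ n" using \<rho> by simp
  have sq: "(-1 :: real) ^ j * (-1) ^ j = 1" by (simp flip: power_add)
  have ab: "\<bar>(-1 :: real) ^ j * x\<bar> = \<bar>x\<bar>" for x by (simp add: abs_mult power_abs)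
  have G: "\<bar>?G \<phi> - \<rho> ^ n * sin (real n * \<phi>)\<bar> \<le> 1/2 * \<rho> ^ n" for \<phi>
  proof -
    have "?G \<phi> - \<rho> ^ n * sin (real n * \<phi>) = - ((-1) ^ j * (U (of_real \<rho> * cis (ctr j + \<phi>)) - \<rho> ^ n * cos (real n * (ctr j + \<phi>))))"
      using sq unfolding cos_sin_ctr by (simp add: algebra_simps)
    then show ?thesis using U_polar[of \<rho> "ctr j + \<phi>"] \<rho> by (simp add: ab del: mult_minus_right)
  qed
  have dG: "\<exists>d>0. (?G has_real_derivative d) (at \<phi>)" if \<phi>: "\<bar>\<phi>\<bar> \<le> \<delta>" for \<phi>
  proof -
    obtain d where d: "((\<lambda>\<theta>. U (of_real \<rho> * cis \<theta>)) has_real_derivative d) (at (ctr j + \<phi>))"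
      "\<bar>d + real n * \<rho> ^ n * sin (real n * (ctr j + \<phi>))\<bar> \<le> 1/2 * \<rho> ^ n"
      using U_polar_deriv[OF \<rho>] by blast
    have "((\<lambda>\<phi>. U (of_real \<rho> * cis (ctr j + \<phi>))) has_real_derivative d * 1) (at \<phi>)"
      by (rule DERIV_chain2[where g="\<lambda>\<phi>. ctr j + \<phi>" and x=\<phi>, OF d(1)]) (auto intro!: derivative_eq_intros)
    then have 1: "(?G has_real_derivative - ((-1) ^ j * d)) (at \<phi>)"
      by (auto intro!: derivative_eq_intros)
    have "(-1) ^ j * d + real n * \<rho> ^ n * cos (real n * \<phi>) = (-1) ^ j * (d + real n * \<rho> ^ n * sin (real n * (ctr j + \<phi>)))"
      using sq unfolding cos_sin_ctr by (simp add: algebra_simps)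
    then have "\<bar>(-1) ^ j * d + real n * \<rho> ^ n * cos (real n * \<phi>)\<bar> \<le> 1/2 * \<rho> ^ n" using d(2) by (simp add: ab)
    moreover have "1/2 * \<rho> ^ n < real n * \<rho> ^ n * cos (real n * \<phi>)"
    proof -
      have "1/2 * \<rho> ^ n < cos (real n * \<phi>) * \<rho> ^ n" using cos_gt_half[OF \<phi>] \<rho>n by (rule mult_strict_right_mono)
      also have "\<dots> \<le> real n * (cos (real n * \<phi>) * \<rho> ^ n)"
        using n cos_gt_half[OF \<phi>] \<rho>n mult_right_mono[of 1 "real n" "cos (real n * \<phi>) * \<rho> ^ n"] by simp
      finally show ?thesis by (simp add: mult.commute mult.left_commute)
    qed
    ultimately have "0 < - ((-1) ^ j * d)" by linarith
    with 1 show ?thesis by blast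
  qed
  have mono: "?G a < ?G b" if "-\<delta> \<le> a" "a < b" "b \<le> \<delta>" for a b
  proof (rule DERIV_pos_imp_increasing[OF that(2)])
    fix x assume "a \<le> x" "x \<le> b"
    then have "\<bar>x\<bar> \<le> \<delta>" using that by (simp add: abs_le_iff)
    then show "\<exists>y. DERIV ?G x :> y \<and> y > 0" using dG by blast
  qed
  have cG: "continuous_on {-\<delta>..\<delta>} ?G"
  proof (intro continuous_at_imp_continuous_on ballI)
    fix x assume "x \<in> {-\<delta>..\<delta>}"
    then have "\<bar>x\<bar> \<le> \<delta>" by (simp add: abs_le_iff)
    then show "isCont ?G x" using dG DERIV_isCont by blast
  qed
  have s45: "sin (real n * \<delta>) = sqrt 2 / 2" "sin (real n * - \<delta>) = - sqrt 2 / 2"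
    using n by (auto simp: \<delta>_def sin_45)
  have "1/2 * \<rho> ^ n < \<rho> ^ n * (sqrt 2 / 2)" using mult_strict_right_mono[OF sqrt2_half \<rho>n] by (simp add: mult.commute)
  then have "?G (-\<delta>) \<le> 0" "0 \<le> ?G \<delta>"
    using G[of "-\<delta>"] G[of \<delta>] unfolding s45 by linarith+
  then obtain \<phi> where \<phi>: "-\<delta> \<le> \<phi>" "\<phi> \<le> \<delta>" "?G \<phi> = 0"
    using IVT'[of ?G "-\<delta>" 0 \<delta>] cG \<delta>_pos by auto
  have Gz: "?G \<phi> = 0 \<longleftrightarrow> U (of_real \<rho> * cis (ctr j + \<phi>)) = 0" for \<phi> by simp
  show ?thesis
  proof (rule ex1I[of _ \<phi>])
    show "\<phi> \<in> {-\<delta>..\<delta>} \<and> U (of_real \<rho> * cis (ctr j + \<phi>)) = 0" using \<phi> Gz by auto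
    fix \<phi>' assume "\<phi>' \<in> {-\<delta>..\<delta>} \<and> U (of_real \<rho> * cis (ctr j + \<phi>')) = 0"
    then have "?G \<phi>' = 0" "-\<delta> \<le> \<phi>'" "\<phi>' \<le> \<delta>" by auto
    then show "\<phi>' = \<phi>" using mono[of \<phi> \<phi>'] mono[of \<phi>' \<phi>] \<phi> by (cases \<phi> \<phi>' rule: linorder_cases) auto
  qed
qed

lemma sector_norm: "z \<in> sector j \<Longrightarrow> norm z \<le> r"
  by (auto simp: sector_def norm_mult)

lemma sectorE:
  assumes "z \<in> sector j"
  obtains \<phi> where "\<bar>\<phi>\<bar> \<le> \<delta>" "z = of_real (norm z) * cis (ctr j + \<phi>)"
proof -
  obtain \<rho> \<phi> where z: "0 \<le> \<rho>" "-\<delta> \<le> \<phi>" "\<phi> \<le> \<delta>" "z = of_real \<rho> * cis (ctr j + \<phi>)"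
    using assms by (auto simp: sector_def)
  then have "norm z = \<rho>" by (simp add: norm_mult)
  with z show ?thesis using that[of \<phi>] by auto
qed

lemma U_continuous: "continuous_on (cball 0 r) U"
  using has_derivative_continuous[OF U_deriv] by (intro continuous_at_imp_continuous_on) auto

lemma compact_zeros: "compact (zeros j)"
proof -
  have "compact (sector j)"
    unfolding sector_def by (intro compact_continuous_image compact_Times compact_Icc)
      (auto simp: split_beta intro!: continuous_intros)
  moreover have "zeros j = sector j \<inter> (U -` {0} \<inter> cball 0 r)"
    using sector_norm by (auto simp: zeros_def)
  moreover have "closed (U -` {0} \<inter> cball 0 r)"
    using continuous_closed_preimage[OF U_continuous closed_cball closed_singleton] by (simp add: Int_commute)
  ultimately show ?thesis using compact_Int_closed by metis
qed

text \<open>Each circle carries exactly one zero in the sector, so the zero set is a graph over the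
  radius.\<close>

lemma zeros_norm_bij: "bij_betw norm (zeros j) {0..r}"
proof (rule bij_betw_imageI)
  have eq: "z = w" if z: "z \<in> zeros j" and w: "w \<in> zeros j" and nz: "norm z = norm w" for z w
  proof (cases "norm z = 0")
    case False
    obtain \<phi> where \<phi>: "\<bar>\<phi>\<bar> \<le> \<delta>" "z = of_real (norm z) * cis (ctr j + \<phi>)"
      using z sectorE unfolding zeros_def by blast
    obtain \<psi> where \<psi>: "\<bar>\<psi>\<bar> \<le> \<delta>" "w = of_real (norm w) * cis (ctr j + \<psi>)"
      using w sectorE unfolding zeros_def by blast
    have zr: "0 < norm z" "norm z \<le> r" using False z sector_norm by (auto simp: zeros_def)
    have "U (of_real (norm z) * cis (ctr j + \<phi>)) = 0" "U (of_real (norm z) * cis (ctr j + \<psi>)) = 0"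
    proof -
      have "U z = 0" "U w = 0" using z w by (auto simp: zeros_def)
      then show "U (of_real (norm z) * cis (ctr j + \<phi>)) = 0" "U (of_real (norm z) * cis (ctr j + \<psi>)) = 0"
        by (simp only: \<phi>(2)[symmetric], simp only: nz \<psi>(2)[symmetric])
    qed
    moreover have "\<phi> \<in> {-\<delta>..\<delta>}" "\<psi> \<in> {-\<delta>..\<delta>}" using \<phi>(1) \<psi>(1) by (auto simp: abs_le_iff)
    ultimately have "\<phi> = \<psi>" using unique_zero[OF zr, of j] by blast
    then have "of_real (norm z) * cis (ctr j + \<phi>) = of_real (norm w) * cis (ctr j + \<psi>)" using nz by simp
    then show ?thesis by (rule trans[OF trans[OF \<phi>(2)] \<psi>(2)[symmetric]])
  qed (use nz in simp)
  then show "inj_on norm (zeros j)" by (auto intro!: inj_onI)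
  show "norm ` zeros j = {0..r}"
  proof
    show "norm ` zeros j \<subseteq> {0..r}" using sector_norm by (auto simp: zeros_def)
    show "{0..r} \<subseteq> norm ` zeros j"
    proof
      fix \<rho> assume \<rho>: "\<rho> \<in> {0..r}"
      show "\<rho> \<in> norm ` zeros j"
      proof (cases "\<rho> = 0")
        case True
        have "0 \<in> sector j" unfolding sector_def using r \<delta>_pos by (auto intro!: image_eqI[of _ _ "(0, 0)"])
        then show ?thesis using True U_0 by (auto simp: zeros_def intro!: image_eqI[of _ _ 0])
      next
        case False
        then obtain \<phi> where "\<phi> \<in> {-\<delta>..\<delta>}" "U (of_real \<rho> * cis (ctr j + \<phi>)) = 0"
          using unique_zero[of \<rho> j] \<rho> by auto
        then show ?thesis using \<rho> unfolding zeros_def sector_def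
          by (intro image_eqI[of _ _ "of_real \<rho> * cis (ctr j + \<phi>)"]) (auto simp: norm_mult)
      qed
    qed
  qed
qed

text \<open>A common point other than 0 would have equal angles modulo \<open>2 * pi\<close>. In
  units of \<open>pi / n\<close> the centres differ by an integer and the deviations by at most 1/2,
  so the centres themselves agree modulo \<open>2 * n\<close>.\<close>

lemma zeros_inter: "i < 2 * n \<Longrightarrow> j < 2 * n \<Longrightarrow> i \<noteq> j \<Longrightarrow> zeros i \<inter> zeros j \<subseteq> {0}"
proof
  fix z assume ij: "i < 2 * n" "j < 2 * n" "i \<noteq> j" and z: "z \<in> zeros i \<inter> zeros j"
  show "z \<in> {0}"
  proof (rule ccontr)
    assume "z \<notin> {0}"
    then have z0: "norm z \<noteq> 0" by simp
    obtain \<phi> where \<phi>: "\<bar>\<phi>\<bar> \<le> \<delta>" "z = of_real (norm z) * cis (ctr i + \<phi>)"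
      using z sectorE unfolding zeros_def by blast
    obtain \<psi> where \<psi>: "\<bar>\<psi>\<bar> \<le> \<delta>" "z = of_real (norm z) * cis (ctr j + \<psi>)"
      using z sectorE unfolding zeros_def by blast
    have "cis (ctr i + \<phi>) = cis (ctr j + \<psi>)" using \<phi>(2) \<psi>(2) z0 by (metis mult_cancel_left of_real_eq_0_iff)
    then have "cis (ctr i + \<phi> - (ctr j + \<psi>)) = 1" by (simp flip: cis_divide)
    then have "cos (ctr i + \<phi> - (ctr j + \<psi>)) = 1" by (metis cis.sel(1) one_complex.sel(1))
    then obtain k :: int where k: "ctr i + \<phi> - (ctr j + \<psi>) = of_int k * 2 * pi"
      by (auto simp: cos_one_2pi_int)
    let ?d = "real i - real j"
    have d: "ctr i - ctr j = ?d * (pi / n)" using n by (simp add: ctr_def field_simps)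
    have small: "\<bar>\<phi> - \<psi>\<bar> \<le> (1/2) * (pi / n)"
    proof -
      have "\<bar>\<phi> - \<psi>\<bar> \<le> 2 * \<delta>" using \<phi>(1) \<psi>(1) by linarith
      then show ?thesis by (simp add: \<delta>_def)
    qed
    have "\<bar>?d - 2 * of_int k * n\<bar> * (pi / n) = \<bar>\<phi> - \<psi>\<bar>"
    proof -
      have "(?d - 2 * of_int k * n) * (pi / n) = ?d * (pi / n) - of_int k * 2 * pi" using n by (simp add: field_simps)
      then have "(?d - 2 * of_int k * n) * (pi / n) = \<psi> - \<phi>" using k d by linarith
      then have "\<bar>?d - 2 * of_int k * n\<bar> * \<bar>pi / n\<bar> = \<bar>\<psi> - \<phi>\<bar>" by (simp only: flip: abs_mult)
      then show ?thesis by (simp add: abs_minus_commute)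
    qed
    then have "\<bar>?d - 2 * of_int k * n\<bar> * (pi / n) \<le> (1/2) * (pi / n)" using small by simp
    then have "\<bar>?d - 2 * of_int k * n\<bar> \<le> 1/2" by (rule mult_right_le_imp_le) (use n in simp)
    moreover have "?d - 2 * of_int k * n = of_int (int i - int j - 2 * k * int n)" by simp
    ultimately have "\<bar>real_of_int (int i - int j - 2 * k * int n)\<bar> \<le> 1/2" by (simp only:)
    then have e: "int i - int j = 2 * k * int n" by linarith
    have "\<bar>int i - int j\<bar> < 2 * int n" using ij by linarith
    then have "\<bar>k\<bar> * (2 * int n) < 1 * (2 * int n)" unfolding e by (simp add: abs_mult)
    then have "\<bar>k\<bar> < 1" using mult_right_mono[of 1 "\<bar>k\<bar>" "2 * int n"] by linarith
    then show False using e ij by simp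
  qed
qed

lemma zeros_cover:
  assumes "norm z \<le> r" "U z = 0"
  shows "\<exists>j<2 * n. z \<in> zeros j"
proof (cases "z = 0")
  case True
  have "0 \<in> sector 0" unfolding sector_def using r \<delta>_pos by (auto intro!: image_eqI[of _ _ "(0, 0)"])
  then show ?thesis using True U_0 n by (intro exI[of _ 0]) (auto simp: zeros_def)
next
  case False
  let ?\<rho> = "norm z"
  have \<rho>: "0 < ?\<rho>" "?\<rho> \<le> r" using False assms by auto
  define \<theta> where "\<theta> = Arg2pi z"
  have \<theta>: "0 \<le> \<theta>" "\<theta> < 2 * pi" "z = of_real ?\<rho> * cis \<theta>"
    using Arg2pi[of z] by (auto simp: \<theta>_def cis_conv_exp is_Arg_def mult.commute)
  \<comment> \<open>\<open>ctr j\<close> is the midpoint of the angular interval of length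
    \<open>pi / n\<close> that contains \<open>\<theta>\<close>.\<close>
  define j where "j = nat \<lfloor>real n * \<theta> / pi\<rfloor>"
  have nt: "0 \<le> real n * \<theta> / pi" using \<theta> by simp
  have j: "real j \<le> real n * \<theta> / pi" "real n * \<theta> / pi < real j + 1"
    using nt unfolding j_def by linarith+
  have "real j < 2 * real n"
  proof -
    have "real n * \<theta> < real n * (2 * pi)" using \<theta> n by (intro mult_strict_left_mono) auto
    then have "real n * \<theta> / pi < 2 * real n" by (simp add: divide_less_eq)
    then show ?thesis using j by linarith
  qed
  then have j2: "j < 2 * n" by linarith
  define \<phi> where "\<phi> = \<theta> - ctr j"
  have n\<phi>: "real n * \<phi> = real n * \<theta> - (real j + 1/2) * pi" using n by (simp add: \<phi>_def ctr_def field_simps)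
  have jp: "real j * pi \<le> real n * \<theta>" "real n * \<theta> < (real j + 1) * pi"
    using j by (auto simp: le_divide_eq divide_less_eq)
  have bnd: "\<bar>real n * \<phi>\<bar> \<le> pi / 2" using jp unfolding n\<phi> distrib_right by linarith
  have "\<bar>?\<rho> ^ n * cos (real n * \<theta>)\<bar> \<le> 1/2 * ?\<rho> ^ n"
    using U_polar[of ?\<rho> \<theta>] \<rho> assms(2) \<theta>(3) by simp
  then have "\<bar>cos (real n * \<theta>)\<bar> * ?\<rho> ^ n \<le> 1/2 * ?\<rho> ^ n" by (simp add: abs_mult mult.commute)
  then have "\<bar>cos (real n * \<theta>)\<bar> \<le> 1/2" by (rule mult_right_le_imp_le) (use \<rho> in simp)
  then have c: "\<bar>sin (real n * \<phi>)\<bar> \<le> 1/2"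
    using cos_sin_ctr(1)[of j \<phi>] by (simp add: \<phi>_def abs_mult power_abs)
  have "\<bar>real n * \<phi>\<bar> \<le> pi / 4"
  proof (rule ccontr)
    assume "\<not> ?thesis"
    then have "sin (pi / 4) \<le> sin \<bar>real n * \<phi>\<bar>" using bnd by (intro sin_monotone_2pi_le) auto
    moreover have "sin \<bar>real n * \<phi>\<bar> \<le> \<bar>sin (real n * \<phi>)\<bar>" by (cases "real n * \<phi> \<ge> 0") (auto simp: abs_if)
    ultimately show False using c sqrt2_half by (simp add: sin_45)
  qed
  then have "\<bar>\<phi>\<bar> \<le> \<delta>" using n by (simp add: \<delta>_def abs_mult field_simps)
  then have "z \<in> sector j" unfolding sector_def using \<theta>(3) \<rho>
    by (intro image_eqI[of _ _ "(?\<rho>, \<phi>)"]) (auto simp: \<phi>_def)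
  then show ?thesis using j2 assms(2) by (auto simp: zeros_def)
qed

text \<open>An arm is the inverse of \<open>norm\<close> on \<open>zeros j\<close>. As the inverse
  of a continuous bijection of a compact set it is continuous, and the implicit function theorem is
  avoided.\<close>

lemma zero_arms:
  obtains A :: "nat \<Rightarrow> real \<Rightarrow> complex"
  where "\<And>j. arc (A j)" "\<And>j. pathstart (A j) = 0" "\<And>j. pathfinish (A j) \<noteq> 0"
    "\<And>i j. i < 2 * n \<Longrightarrow> j < 2 * n \<Longrightarrow> i \<noteq> j \<Longrightarrow> path_image (A i) \<inter> path_image (A j) = {0}"
    "{z \<in> cball 0 r. U z = 0} = (\<Union>j<2 * n. path_image (A j))"
proof -
  define A where "A = (\<lambda>j t. inv_into (zeros j) norm (r * t))"
  have inv: "norm (A j t) = r * t" "A j t \<in> zeros j" if "t \<in> {0..1}" for j t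
  proof -
    have "r * t \<in> norm ` zeros j"
      using zeros_norm_bij[of j] that r by (auto simp: bij_betw_def mult_left_le)
    then show "norm (A j t) = r * t" "A j t \<in> zeros j"
      unfolding A_def by (rule f_inv_into_f, rule inv_into_into)
  qed
  have im: "path_image (A j) = zeros j" for j
  proof
    show "path_image (A j) \<subseteq> zeros j" using inv by (auto simp: path_image_def)
    show "zeros j \<subseteq> path_image (A j)"
    proof
      fix z assume z: "z \<in> zeros j"
      have t: "norm z / r \<in> {0..1}" using z sector_norm r by (auto simp: zeros_def)
      have "A j (norm z / r) = z" unfolding A_def
        using z r zeros_norm_bij[of j] by (simp add: bij_betw_def)
      then show "z \<in> path_image (A j)" using t by (force simp: path_image_def)
    qed
  qed
  have A0: "A j 0 = 0" for j using inv(1)[of 0 j] by simp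
  have arcA: "arc (A j)" for j
    unfolding arc_def path_def
  proof
    have "continuous_on (norm ` zeros j) (inv_into (zeros j) norm)"
      by (rule continuous_on_inv[OF _ compact_zeros])
        (use zeros_norm_bij[of j] in \<open>auto simp: bij_betw_def intro!: continuous_intros\<close>)
    then have "continuous_on {0..r} (inv_into (zeros j) norm)"
      using zeros_norm_bij[of j] by (simp add: bij_betw_def)
    then show "continuous_on {0..1} (A j)" unfolding A_def
      by (rule continuous_on_compose2) (use r in \<open>auto intro!: continuous_intros simp: mult_left_le\<close>)
    show "inj_on (A j) {0..1}"
      by (rule inj_onI) (metis inv(1) mult_cancel_left order_less_irrefl r)
  qed
  show ?thesis
  proof (rule that[of A])
    show "pathstart (A j) = 0" "pathfinish (A j) \<noteq> 0" for j
      using A0 inv(1)[of 1 j] r by (auto simp: pathstart_def pathfinish_def)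
    show "path_image (A i) \<inter> path_image (A j) = {0}" if "i < 2 * n" "j < 2 * n" "i \<noteq> j" for i j
      using zeros_inter[OF that] A0[of i] A0[of j] inv(2)[of 0 i] inv(2)[of 0 j] unfolding im by auto
    show "{z \<in> cball 0 r. U z = 0} = (\<Union>j<2 * n. path_image (A j))"
      unfolding im
    proof
      show "{z \<in> cball 0 r. U z = 0} \<subseteq> (\<Union>j<2 * n. zeros j)" using zeros_cover by auto
      show "(\<Union>j<2 * n. zeros j) \<subseteq> {z \<in> cball 0 r. U z = 0}"
        using sector_norm by (auto simp: zeros_def)
    qed
  qed (rule arcA)
qed

text \<open>Opposite zero arms are joined to one arc through the saddle point.\<close>

lemma saddle_multiplicity:
  fixes T :: "complex \<Rightarrow> real^2"
  assumes n2: "2 \<le> n" and T: "linear T" "bij T" and U: "\<And>z. norm z \<le> r \<Longrightarrow> U z = u (x0 + T z) - u x0"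
    and S: "\<And>z. norm z \<le> r \<Longrightarrow> x0 + T z \<in> S"
  shows "is_multiplicity S u x0 (n - 1)"
proof -
  obtain A :: "nat \<Rightarrow> real \<Rightarrow> complex"
    where A: "\<And>j. arc (A j)" "\<And>j. pathstart (A j) = 0" "\<And>j. pathfinish (A j) \<noteq> 0"
    and Ad: "\<And>i j. i < 2 * n \<Longrightarrow> j < 2 * n \<Longrightarrow> i \<noteq> j \<Longrightarrow> path_image (A i) \<inter> path_image (A j) = {0}"
    and Au: "{z \<in> cball 0 r. U z = 0} = (\<Union>j<2 * n. path_image (A j))"
    using zero_arms by blast
  define \<Psi> where "\<Psi> = (\<lambda>z. x0 + T z)"
  have inj: "inj \<Psi>" using bij_is_inj[OF T(2)] by (auto simp: \<Psi>_def inj_def)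
  have cont: "continuous_on X \<Psi>" for X
    unfolding \<Psi>_def by (intro continuous_intros linear_continuous_on T(1)[unfolded linear_conv_bounded_linear])
  have \<Psi>0: "\<Psi> 0 = x0" using linear_0[OF T(1)] by (simp add: \<Psi>_def)
  define J where "J = (\<lambda>i. reversepath (A i) +++ A (i + n))"
  have Jarc: "arc (J i)" if "i < n" for i
    unfolding J_def using A Ad[of i "i + n"] that by (intro arc_join) (auto simp: arc_reversepath)
  have Jim: "path_image (J i) = path_image (A i) \<union> path_image (A (i + n))" for i
    unfolding J_def using A by (subst path_image_join) auto
  define g where "g = (\<lambda>i. \<Psi> \<circ> J i)"
  have gim: "path_image (g i) = \<Psi> ` path_image (J i)" for i unfolding g_def by (rule path_image_compose)
  show ?thesis
    unfolding is_multiplicity_def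
  proof (intro conjI exI)
    show "1 \<le> n - 1" using n2 by simp
    show "\<Psi> ` cball 0 r \<subseteq> S" using S by (auto simp: \<Psi>_def)
    show "x0 \<in> interior (\<Psi> ` cball 0 r)"
    proof (rule interiorI)
      have "open (T ` ball 0 r)" using T by (intro open_surjective_linear_image) (auto simp: bij_is_surj)
      from open_translation[OF this, of x0]
      show "open (\<Psi> ` ball 0 r)" by (simp add: \<Psi>_def image_image)
      show "x0 \<in> \<Psi> ` ball 0 r" using \<Psi>0 r by (metis centre_in_ball imageI)
    qed auto
    show "\<forall>i\<le>n - 1. arc (g i) \<and> x0 \<in> path_image (g i) - {pathstart (g i), pathfinish (g i)}"
    proof (intro allI impI conjI)
      fix i assume "i \<le> n - 1"
      then have i: "i < n" using n by simp
      show "arc (g i)" unfolding g_def arc_def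
        using Jarc[OF i] inj by (auto simp: arc_def intro!: path_continuous_image cont comp_inj_on intro: inj_on_subset)
      have "0 \<in> path_image (J i)" using A(2)[of i] pathstart_in_path_image[of "A i"] unfolding Jim by auto
      moreover have "pathstart (g i) = \<Psi> (pathfinish (A i))" "pathfinish (g i) = \<Psi> (pathfinish (A (i + n)))"
        unfolding g_def J_def by (simp_all add: pathstart_compose pathfinish_compose)
      ultimately show "x0 \<in> path_image (g i) - {pathstart (g i), pathfinish (g i)}"
        using \<Psi>0 A(3)[of i] A(3)[of "i + n"] inj unfolding gim by (auto simp: inj_eq simp flip: \<Psi>0)
    qed
    show "\<forall>i\<le>n - 1. \<forall>j\<le>n - 1. i \<noteq> j \<longrightarrow> path_image (g i) \<inter> path_image (g j) = {x0}"
    proof (intro allI impI)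
      fix i j assume "i \<le> n - 1" "j \<le> n - 1" and ne: "i \<noteq> j"
      then have ij: "i < n" "j < n" using n by auto
      have "path_image (J i) \<inter> path_image (J j) = {0}"
        unfolding Jim using Ad[of i j] Ad[of i "j + n"] Ad[of "i + n" j] Ad[of "i + n" "j + n"] ij ne by auto
      then show "path_image (g i) \<inter> path_image (g j) = {x0}"
        unfolding gim image_Int[OF inj, symmetric] using \<Psi>0 by simp
    qed
    have "{x \<in> \<Psi> ` cball 0 r. u x = u x0} = \<Psi> ` {z \<in> cball 0 r. U z = 0}"
      using U by (auto simp: \<Psi>_def)
    also have "(\<Union>j<2 * n. path_image (A j)) = (\<Union>i\<le>n - 1. path_image (J i))"
    proof -
      have "(\<Union>j<2 * n. path_image (A j)) = (\<Union>i<n. path_image (A i)) \<union> (\<Union>i<n. path_image (A (i + n)))"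
      proof -
        have "{..<2 * n} = {..<n} \<union> (\<lambda>i. i + n) ` {..<n}"
        proof -
          have "j \<in> (\<lambda>i. i + n) ` {..<n}" if "j < 2 * n" "\<not> j < n" for j
            using that by (intro image_eqI[of _ _ "j - n"]) auto
          then show ?thesis by auto
        qed
        then show ?thesis by (simp add: image_image UN_Un)
      qed
      also have "\<dots> = (\<Union>i<n. path_image (J i))" unfolding Jim by auto
      also have "{..<n} = {..n - 1}" using n by auto
      finally show ?thesis .
    qed
    then have "\<Psi> ` {z \<in> cball 0 r. U z = 0} = (\<Union>i\<le>n - 1. path_image (g i))"
      unfolding Au gim by (simp add: image_UN)
    finally show "{x \<in> \<Psi> ` cball 0 r. u x = u x0} = (\<Union>i\<le>n - 1. path_image (g i))" .
  qed
qed

end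

section \<open>Local extrema on closed curves\<close>

text \<open>A new largest element of \<open>A\<close> brings an element of \<open>B\<close> beyond
  the old maximum; counting only the part of \<open>B\<close> strictly between the extremes of
  \<open>A\<close> ensures that this element is new.\<close>

lemma card_le_of_interleaving:
  fixes A B :: "'a::linorder set"
  assumes "finite A" "A \<noteq> {}" "finite B"
    and "\<And>a b. a \<in> A \<Longrightarrow> b \<in> A \<Longrightarrow> a < b \<Longrightarrow> \<exists>z\<in>B. a < z \<and> z < b"
  shows "card A \<le> card (B \<inter> {Min A<..<Max A}) + 1"
  using assms(1,2,4)
proof (induction A rule: finite_linorder_max_induct)
  case (insert b A)
  show ?case
  proof (cases "A = {}")
    case False
    have IH: "card A \<le> card (B \<inter> {Min A<..<Max A}) + 1" using insert False by auto
    have mx: "Max (insert b A) = b" "Min (insert b A) = Min A"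
      using insert False by (auto intro!: Max_eqI Min_eqI simp: less_imp_le Min_le_iff)
    obtain z where z: "z \<in> B" "Max A < z" "z < b"
      using insert.prems(2)[of "Max A" b] insert.hyps False by auto
    have "insert z (B \<inter> {Min A<..<Max A}) \<subseteq> B \<inter> {Min A<..<b}"
    proof -
      have "Min A \<le> Max A" "Max A < b" using False insert.hyps by auto
      moreover have "insert z (B \<inter> {p<..<q}) \<subseteq> B \<inter> {p<..<b}" if "p \<le> q" "q < z" "q < b" for p q
        using that z by auto
      ultimately show ?thesis using z(2) by blast
    qed
    then have "card (insert z (B \<inter> {Min A<..<Max A})) \<le> card (B \<inter> {Min A<..<b})"
      using assms(3) by (intro card_mono) auto
    moreover have "card (insert z (B \<inter> {Min A<..<Max A})) = card (B \<inter> {Min A<..<Max A}) + 1"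
      using assms(3) z by (subst card_insert_disjoint) auto
    moreover have "b \<notin> A" using insert.hyps(2) by auto
    then have "card (insert b A) = card A + 1" using insert.hyps(1) by simp
    ultimately show ?thesis using IH mx by simp
  qed simp
qed simp

locale periodic_curve =
  fixes c :: "real \<Rightarrow> 'a::metric_space"
  assumes c_cont: "continuous_on UNIV c" and c_per: "\<And>t. c (t + 1) = c t" and c_inj: "inj_on c {0..<1}"
begin

lemma c_int: "c (t + of_int k) = c t"
proof -
  have nat: "c (t + of_nat n) = c t" for t n
    by (induction n) (auto simp: add.assoc[symmetric] c_per add.commute[of 1])
  show ?thesis
  proof (cases k rule: int_cases2)
    case (nonpos n)
    then show ?thesis using nat[of "t - real n" n] by simp
  qed (use nat in simp)
qed

lemma c_eq_iff: "c s = c t \<longleftrightarrow> (\<exists>k::int. s = t + of_int k)"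
proof
  assume "c s = c t"
  moreover have "c x = c (frac x)" for x using c_int[of "frac x" "\<lfloor>x\<rfloor>"] by (simp add: frac_def)
  ultimately have "c (frac s) = c (frac t)" by metis
  then have "frac s = frac t" by (rule inj_onD[OF c_inj]) (auto simp: frac_lt_1)
  then show "\<exists>k::int. s = t + of_int k"
    by (intro exI[of _ "\<lfloor>s\<rfloor> - \<lfloor>t\<rfloor>"]) (simp add: frac_def)
qed (auto simp: c_int)

lemma c_repr:
  assumes "y \<in> range c" obtains s where "a \<le> s" "s < a + 1" "y = c s"
proof -
  obtain s0 where s0: "y = c s0" using assms by blast
  show ?thesis
  proof (rule that[of "a + frac (s0 - a)"])
    show "a \<le> a + frac (s0 - a)" "a + frac (s0 - a) < a + 1" by (auto simp: frac_lt_1)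
    have "a + frac (s0 - a) = s0 + of_int (- \<lfloor>s0 - a\<rfloor>)" by (simp add: frac_def)
    then show "y = c (a + frac (s0 - a))" using s0 c_int by metis
  qed
qed

text \<open>By compactness the part of the curve whose parameters are away from \<open>t\<close> has
  a positive distance from \<open>c t\<close>. Hence being near on the curve and being near in the
  parameter are the same.\<close>

lemma far_part:
  assumes e: "0 < e" "e \<le> 1/2"
  obtains d where "0 < d" "\<And>s. c s \<in> ball (c t) d \<Longrightarrow> t - 1/2 \<le> s \<Longrightarrow> s < t + 1/2 \<Longrightarrow> \<bar>s - t\<bar> < e"
proof -
  let ?A = "c ` ({t - 1/2..t - e} \<union> {t + e..t + 1/2})"
  have "compact ?A"
    by (intro compact_continuous_image compact_Un compact_Icc continuous_on_subset[OF c_cont]) auto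
  moreover have "c t \<notin> ?A"
  proof
    assume "c t \<in> ?A"
    then obtain s where s: "s \<in> {t - 1/2..t - e} \<union> {t + e..t + 1/2}" "c s = c t" by (metis imageE)
    then obtain k :: int where "s = t + of_int k" using c_eq_iff by blast
    moreover from this have "\<bar>real_of_int k\<bar> \<le> 1/2" "k \<noteq> 0" using s e by auto
    ultimately show False by linarith
  qed
  ultimately obtain d where d: "0 < d" "ball (c t) d \<subseteq> - ?A"
    by (metis Compl_iff compact_imp_closed open_Compl open_contains_ball)
  show ?thesis
  proof (rule that[OF d(1)])
    fix s assume s: "c s \<in> ball (c t) d" "t - 1/2 \<le> s" "s < t + 1/2"
    show "\<bar>s - t\<bar> < e"
    proof (rule ccontr)
      assume "\<not> ?thesis"
      then have "s \<in> {t - 1/2..t - e} \<union> {t + e..t + 1/2}" using s by auto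
      then show False using d s by blast
    qed
  qed
qed

lemma local_max_lift:
  assumes e: "0 < e" and m: "\<And>s. \<bar>s - t\<bar> < e \<Longrightarrow> f (c s) \<le> f (c t)"
  shows "c t \<in> local_max_points (range c) f"
proof -
  have "0 < min e (1/2)" "min e (1/2) \<le> 1/2" using e by auto
  then obtain d where d: "0 < d" "\<And>s. c s \<in> ball (c t) d \<Longrightarrow> t - 1/2 \<le> s \<Longrightarrow> s < t + 1/2 \<Longrightarrow> \<bar>s - t\<bar> < min e (1/2)"
    using far_part[of "min e (1/2)" t] by metis
  have "f y \<le> f (c t)" if y: "y \<in> range c \<inter> ball (c t) d" for y
  proof -
    obtain s where "t - 1/2 \<le> s" "s < t - 1/2 + 1" "y = c s" using c_repr[of y "t - 1/2"] y by blast
    then show ?thesis using d(2)[of s] m[of s] y by auto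
  qed
  then show ?thesis using d(1) by (auto simp: local_max_points_def)
qed

lemma local_max_descend:
  assumes "c t \<in> local_max_points (range c) f"
  obtains e where "0 < e" "\<And>s. \<bar>s - t\<bar> < e \<Longrightarrow> f (c s) \<le> f (c t)"
proof -
  obtain d where d: "d > 0" "\<And>y. y \<in> range c \<inter> ball (c t) d \<Longrightarrow> f y \<le> f (c t)"
    using assms by (auto simp: local_max_points_def)
  obtain e where "e > 0" "\<And>s. dist s t < e \<Longrightarrow> dist (c s) (c t) < d"
    using c_cont d(1) unfolding continuous_on_iff by (metis UNIV_I)
  then show ?thesis using that[of e] d(2) by (auto simp: dist_real_def dist_commute)
qed

text \<open>The maximum over the closed interval may be attained at an end point. This end point is
  also a local minimum, so \<open>f\<close> is constant on an adjacent piece of the interval, and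
  the interior points of this plateau are local maxima, which need not be strict.\<close>

lemma max_between_minima:
  assumes g: "continuous_on UNIV (\<lambda>t. f (c t))" and ab: "a < b"
    and "c a \<in> local_max_points (range c) (\<lambda>x. - f x)" "c b \<in> local_max_points (range c) (\<lambda>x. - f x)"
  shows "\<exists>z. a < z \<and> z < b \<and> c z \<in> local_max_points (range c) f"
proof -
  have plateau: "\<exists>z. a < z \<and> z < b \<and> c z \<in> local_max_points (range c) f"
    if p: "c p \<in> local_max_points (range c) (\<lambda>x. - f x)" "p = a \<or> p = b"
      and top: "\<And>s. a \<le> s \<Longrightarrow> s \<le> b \<Longrightarrow> f (c s) \<le> f (c p)" for p
  proof -
    obtain e where e: "0 < e" "\<And>s. \<bar>s - p\<bar> < e \<Longrightarrow> - f (c s) \<le> - f (c p)"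
      using local_max_descend[OF p(1)] by blast
    define h where "h = min e (b - a) / 2"
    have h: "0 < h" "2 * h \<le> e" "2 * h \<le> b - a" using e(1) ab by (auto simp: h_def)
    define z where "z = (if p = a then a + h else b - h)"
    have z: "a < z" "z < b" "\<bar>z - p\<bar> = h" using h p(2) ab by (auto simp: z_def)
    have flat: "f (c s) = f (c p)" if "\<bar>s - z\<bar> < h" for s
    proof -
      have "\<bar>s - p\<bar> < e" "a \<le> s" "s \<le> b" using that z h p(2) by (auto simp: z_def split: if_splits)
      then show ?thesis using e(2)[of s] top[of s] by simp
    qed
    have "c z \<in> local_max_points (range c) f"
      by (rule local_max_lift[OF h(1)]) (use flat flat[of z] h in simp)
    then show ?thesis using z by blast
  qed
  have ne: "{a..b} \<noteq> {}" and cont: "continuous_on {a..b} (\<lambda>t. f (c t))"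
    using ab continuous_on_subset[OF g] by auto
  obtain z where z: "z \<in> {a..b}" "\<And>s. s \<in> {a..b} \<Longrightarrow> f (c s) \<le> f (c z)"
    using continuous_attains_sup[OF compact_Icc ne cont] by blast
  show ?thesis
  proof (cases "z = a \<or> z = b")
    case True
    then show ?thesis using plateau[of z] assms(3,4) z by auto
  next
    case False
    then have "0 < min (z - a) (b - z)" using z(1) by auto
    then have "c z \<in> local_max_points (range c) f"
    proof (rule local_max_lift)
      fix s assume "\<bar>s - z\<bar> < min (z - a) (b - z)"
      then have "a \<le> s" "s \<le> b" by linarith+
      then show "f (c s) \<le> f (c z)" using z(2) by simp
    qed
    then show ?thesis using z(1) False by (intro exI[of _ z]) auto
  qed
qed

text \<open>Between two minima lies a maximum, and a closed curve has as many gaps as minima. The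
  count is done for finite sets of minima, because finiteness of all minima is itself a
  consequence.\<close>

lemma card_local_minima_le:
  assumes f: "continuous_on (range c) f" and fin: "finite (local_max_points (range c) f)"
  shows "finite (local_max_points (range c) (\<lambda>x. - f x)) \<and>
    card (local_max_points (range c) (\<lambda>x. - f x)) \<le> card (local_max_points (range c) f)"
proof -
  let ?L = "local_max_points (range c) (\<lambda>x. - f x)"
  have g: "continuous_on UNIV (\<lambda>t. f (c t))"
    by (rule continuous_on_compose2[OF f c_cont]) auto
  have "card P \<le> card (local_max_points (range c) f)" if P: "P \<subseteq> ?L" "finite P" "P \<noteq> {}" for P
  proof -
    define A where "A = {t \<in> {0..<1}. c t \<in> P}"
    have cA: "c ` A = P"
    proof
      show "P \<subseteq> c ` A"
      proof
        fix y assume y: "y \<in> P"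
        then have "y \<in> range c" using P by (auto simp: local_max_points_def)
        then obtain s where "0 \<le> s" "s < 0 + 1" "y = c s" by (rule c_repr)
        then show "y \<in> c ` A" using y by (auto simp: A_def)
      qed
    qed (auto simp: A_def)
    have injA: "inj_on c A" by (rule inj_on_subset[OF c_inj]) (auto simp: A_def)
    have finA: "finite A" using cA P(2) injA finite_imageD by blast
    have neA: "A \<noteq> {}" using cA P(3) by blast
    define t0 where "t0 = Min A"
    have t0: "t0 \<in> A" "\<And>t. t \<in> A \<Longrightarrow> t0 \<le> t" using finA neA by (auto simp: t0_def)
    \<comment> \<open>The curve is cut open at the minimum \<open>t0\<close>, which is repeated at
      \<open>t0 + 1\<close>. The extra element cancels the \<open>+ 1\<close> of the interleaving
      bound.\<close>
    define A' where "A' = insert (t0 + 1) A"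
    have lt: "t < t0 + 1" if "t \<in> A" for t using that t0 by (auto simp: A_def)
    have A': "finite A'" "A' \<noteq> {}" "card A' = card A + 1" "Min A' = t0" "Max A' = t0 + 1"
    proof -
      show "finite A'" "A' \<noteq> {}" using finA by (auto simp: A'_def)
      have "t0 + 1 \<notin> A" using lt by blast
      then show "card A' = card A + 1" using finA by (simp add: A'_def)
      show "Min A' = t0" by (rule Min_eqI) (use finA t0 in \<open>auto simp: A'_def\<close>)
      show "Max A' = t0 + 1" by (rule Max_eqI) (use finA lt in \<open>auto simp: A'_def less_imp_le\<close>)
    qed
    define B where "B = {t \<in> {t0<..<t0 + 1}. c t \<in> local_max_points (range c) f}"
    have injB: "inj_on c B"
    proof (rule inj_onI)
      fix x y assume xy: "x \<in> B" "y \<in> B" "c x = c y"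
      then obtain k :: int where k: "x = y + of_int k" using c_eq_iff by blast
      moreover have "\<bar>x - y\<bar> < 1" using xy by (auto simp: B_def)
      ultimately have "k = 0" by linarith
      then show "x = y" using k by simp
    qed
    have finB: "finite B"
      by (rule finite_imageD[OF _ injB]) (rule finite_subset[OF _ fin], auto simp: B_def)
    have inL: "c t \<in> ?L" if "t \<in> A'" for t
      using that t0(1) P(1) c_per[of t0] by (auto simp: A'_def A_def)
    have "card A' \<le> card (B \<inter> {Min A'<..<Max A'}) + 1"
    proof (rule card_le_of_interleaving[OF A'(1,2) finB])
      fix a b assume ab: "a \<in> A'" "b \<in> A'" "a < b"
      obtain z where z: "a < z" "z < b" "c z \<in> local_max_points (range c) f"
        using max_between_minima[OF g ab(3) inL inL] ab by blast
      have "t0 \<le> a" "b \<le> t0 + 1" using ab t0 lt by (auto simp: A'_def less_imp_le)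
      then show "\<exists>z\<in>B. a < z \<and> z < b" using z by (intro bexI[of _ z]) (auto simp: B_def)
    qed
    then have "card A + 1 \<le> card (B \<inter> {Min A'<..<Max A'}) + 1" using A'(3) by simp
    also have "B \<inter> {Min A'<..<Max A'} = B" using A'(4,5) by (auto simp: B_def)
    finally have "card A \<le> card B" by simp
    also have "card B \<le> card (local_max_points (range c) f)"
      by (rule card_inj_on_le[OF injB _ fin]) (auto simp: B_def)
    finally show ?thesis using card_image[OF injA] cA by simp
  qed
  then have le: "card P \<le> card (local_max_points (range c) f)" if "P \<subseteq> ?L" "finite P" for P
    using that by (cases "P = {}") auto
  have "finite ?L"
  proof (rule ccontr)
    assume "infinite ?L"
    then obtain P where "finite P" "card P = Suc (card (local_max_points (range c) f))" "P \<subseteq> ?L"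
      using infinite_arbitrarily_large by blast
    then show False using le[of P] by simp
  qed
  then show ?thesis using le by blast
qed

end

section \<open>Smooth Jordan curves\<close>

locale regular_closed_curve = periodic_curve c for c :: "real \<Rightarrow> complex" +
  fixes c' :: "real \<Rightarrow> complex"
  assumes c_deriv: "\<And>t. (c has_vector_derivative c' t) (at t)"
    and c'_cont: "continuous_on UNIV c'" and c'_nz: "\<And>t. c' t \<noteq> 0"
begin

lemma path_image_c: "path_image c = range c"
proof
  show "range c \<subseteq> path_image c"
  proof
    fix y assume "y \<in> range c"
    then obtain s where "0 \<le> s" "s < 0 + 1" "y = c s" by (rule c_repr)
    then show "y \<in> path_image c" by (auto simp: path_image_def)
  qed
qed (auto simp: path_image_def)

lemma simple_loop: "simple_path c" "pathfinish c = pathstart c"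
proof -
  show "pathfinish c = pathstart c" using c_per[of 0] by (simp add: pathfinish_def pathstart_def)
  have "x = y \<or> x = 0 \<and> y = 1 \<or> x = 1 \<and> y = 0" if xy: "x \<in> {0..1}" "y \<in> {0..1}" "c x = c y" for x y
  proof -
    obtain k :: int where k: "x = y + of_int k" using xy(3) c_eq_iff by blast
    moreover have "\<bar>x - y\<bar> \<le> 1" using xy by auto
    ultimately have "\<bar>k\<bar> \<le> 1" by linarith
    then have "k = 0 \<or> k = 1 \<or> k = -1" by linarith
    then show ?thesis using k xy by auto
  qed
  then show "simple_path c"
    using continuous_on_subset[OF c_cont] by (auto simp: simple_path_def loop_free_def path_def)
qed

text \<open>Adding a multiple of the normal \<open>\<i> * c' t0\<close> straightens the curve near \<open>t0\<close>.\<close>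

definition straighten :: "real \<Rightarrow> complex \<Rightarrow> complex" where
  "straighten t0 w = c (Re w) + of_real (Im w) * (\<i> * c' t0)"

lemma straighten_real: "straighten t0 (of_real s) = c s"
  by (simp add: straighten_def)

lemma continuous_straighten: "continuous_on S (straighten t0)"
  unfolding straighten_def
  by (intro continuous_intros continuous_on_compose2[OF c_cont]) auto

text \<open>Near \<open>t0\<close> the map differs from multiplication by \<open>c' t0\<close>, up
  to a constant, by a function with Lipschitz constant \<open>norm (c' t0) / 4\<close>, which is too
  small to destroy injectivity.\<close>

lemma straighten_inj:
  obtains d where "0 < d" "inj_on (straighten t0) (ball (of_real t0) d)"
proof -
  have pos: "0 < norm (c' t0) / 4" using c'_nz by simp
  obtain d where d: "0 < d" "\<And>t. dist t t0 < d \<Longrightarrow> dist (c' t) (c' t0) < norm (c' t0) / 4"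
    using c'_cont pos unfolding continuous_on_iff by (metis UNIV_I)
  have lip: "norm ((c s - of_real s * c' t0) - (c t - of_real t * c' t0)) \<le> norm (c' t0) / 4 * norm (s - t)"
    if "s \<in> ball t0 d" "t \<in> ball t0 d" for s t
  proof (rule differentiable_bound[OF convex_ball _ _ that])
    fix x assume x: "x \<in> ball t0 d"
    have "((\<lambda>s. c s - of_real s * c' t0) has_vector_derivative (c' x - c' t0)) (at x within ball t0 d)"
      by (rule has_vector_derivative_eq_rhs[OF has_vector_derivative_diff[OF has_vector_derivative_at_within[OF c_deriv]
          has_vector_derivative_mult_left[OF has_vector_derivative_of_real[OF DERIV_ident]]]]) simp
    then show "((\<lambda>s. c s - of_real s * c' t0) has_derivative (\<lambda>h. h *\<^sub>R (c' x - c' t0))) (at x within ball t0 d)"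
      by (simp add: has_vector_derivative_def)
    have "norm (c' x - c' t0) \<le> norm (c' t0) / 4"
    proof -
      have "dist x t0 < d" using x by (simp add: dist_commute)
      from d(2)[OF this] show ?thesis by (simp add: dist_norm)
    qed
    note le = this
    show "onorm (\<lambda>h. h *\<^sub>R (c' x - c' t0)) \<le> norm (c' t0) / 4"
    proof (intro onorm_le)
      fix h
      from mult_left_mono[OF le, of "\<bar>h\<bar>"]
      show "norm (h *\<^sub>R (c' x - c' t0)) \<le> norm (c' t0) / 4 * norm h" by (simp add: mult.commute)
    qed
  qed
  have "inj_on (straighten t0) (ball (of_real t0) d)"
  proof (rule inj_onI)
    fix w z assume w: "w \<in> ball (of_real t0) d" and z: "z \<in> ball (of_real t0) d"
      and eq: "straighten t0 w = straighten t0 z"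
    have "Re w \<in> ball t0 d" "Re z \<in> ball t0 d"
      using w z abs_Re_le_cmod[of "of_real t0 - w"] abs_Re_le_cmod[of "of_real t0 - z"]
      by (auto simp: dist_norm)
    note l = lip[OF this]
    have "(c (Re w) - of_real (Re w) * c' t0) - (c (Re z) - of_real (Re z) * c' t0) = - ((w - z) * c' t0)"
    proof -
      have e1: "c (Re w) - c (Re z) = of_real (Im z) * (\<i> * c' t0) - of_real (Im w) * (\<i> * c' t0)"
        using eq by (simp add: straighten_def algebra_simps)
      have e2: "w - z = of_real (Re w) - of_real (Re z) + \<i> * (of_real (Im w) - of_real (Im z))"
        by (simp add: complex_eq_iff)
      have "(c (Re w) - of_real (Re w) * c' t0) - (c (Re z) - of_real (Re z) * c' t0)
          = (c (Re w) - c (Re z)) - (of_real (Re w) - of_real (Re z)) * c' t0" by (simp add: algebra_simps)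
      also have "\<dots> = - ((w - z) * c' t0)" unfolding e1 e2 by (simp add: algebra_simps)
      finally show ?thesis .
    qed
    then have "norm (w - z) * norm (c' t0) \<le> norm (c' t0) / 4 * \<bar>Re w - Re z\<bar>"
      using l by (simp only: norm_minus_cancel norm_mult real_norm_def)
    also have "\<dots> \<le> norm (c' t0) / 4 * norm (w - z)"
      using abs_Re_le_cmod[of "w - z"] by (intro mult_left_mono) auto
    finally have "norm (c' t0) * (norm (w - z) * (3/4)) \<le> norm (c' t0) * 0" by (simp add: algebra_simps)
    then have "norm (w - z) * (3/4) \<le> 0" using c'_nz by (simp add: mult_le_0_iff)
    then show "w = z" by simp
  qed
  then show ?thesis using d(1) that by blast
qed

text \<open>In straightened coordinates the curve is the real axis, and one of the two half-discs is
  the trace of the inside. Hence the inside is connected near each boundary point, which ties a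
  boundary point to a single component of a sublevel set.\<close>

lemma inside_local_structure:
  assumes y: "y \<in> range c" and U: "open U" "y \<in> U"
  obtains B W where "open W" "y \<in> W" "B \<noteq> {}" "connected B" "B \<subseteq> inside (range c)" "W \<inter> inside (range c) = B" "W \<subseteq> U"
proof -
  obtain t0 where t0: "y = c t0" using y by blast
  let ?F = "straighten t0"
  let ?o = "complex_of_real t0"
  have Fo: "?F ?o = y" using straighten_real t0 by simp
  obtain d1 where d1: "0 < d1" "inj_on ?F (ball ?o d1)" by (rule straighten_inj)
  define e where "e = min d1 (1/2)"
  have e: "0 < e" "e \<le> 1/2" "e \<le> d1" using d1 by (auto simp: e_def)
  obtain d2 where d2: "0 < d2" "\<And>s. c s \<in> ball (c t0) d2 \<Longrightarrow> t0 - 1/2 \<le> s \<Longrightarrow> s < t0 + 1/2 \<Longrightarrow> \<bar>s - t0\<bar> < e"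
    using far_part[OF e(1,2), of t0] by metis
  obtain d3 where d3: "0 < d3" "d3 \<le> d1" "?F ` ball ?o d3 \<subseteq> U \<inter> ball (c t0) d2"
  proof -
    let ?A = "?F -` (U \<inter> ball (c t0) d2)"
    have "open ?A" by (rule open_vimage[OF _ continuous_straighten]) (use U(1) in auto)
    moreover have "?o \<in> ?A" using U(2) t0 Fo d2(1) by auto
    ultimately obtain r where r: "r > 0" "ball ?o r \<subseteq> ?A" using open_contains_ball by blast
    have "?F ` ball ?o (min r d1) \<subseteq> U \<inter> ball (c t0) d2" using r(2) by auto
    then show ?thesis using that[of "min r d1"] r(1) d1(1) by auto
  qed
  let ?b = "ball ?o d3"
  define W where "W = ?F ` ?b"
  have inj3: "inj_on ?F ?b" using inj_on_subset[OF d1(2) subset_ball[OF d3(2)]] .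
  have openW: "open W" unfolding W_def
    by (rule invariance_of_domain[OF continuous_straighten open_ball inj3])
  have yW: "y \<in> W" unfolding W_def using Fo d3(1) by (metis centre_in_ball imageI)
  \<comment> \<open>\<open>d2\<close> excludes that a distant part of the curve returns into the
    neighbourhood; for the near part injectivity of the straightening identifies \<open>w\<close>
    with a real parameter.\<close>
  have real: "Im w = 0" if w: "w \<in> ?b" "?F w \<in> range c" for w
  proof -
    obtain s where s: "t0 - 1/2 \<le> s" "s < t0 - 1/2 + 1" "?F w = c s" using c_repr[OF w(2)] by blast
    have "c s \<in> ball (c t0) d2" using s(3) w(1) d3(3) by force
    then have "\<bar>s - t0\<bar> < e" using d2(2) s by simp
    then have "of_real s \<in> ball ?o d1" using e(3) by (simp add: dist_norm flip: of_real_diff)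
    moreover have "w \<in> ball ?o d1" using w(1) d3(2) by auto
    moreover have "?F w = ?F (of_real s)" using s(3) straighten_real by simp
    ultimately have "w = of_real s" using d1(2) by (meson inj_onD)
    then show ?thesis by simp
  qed
  define Hp where "Hp = ?b \<inter> {w. 0 < Im w}"
  define Hm where "Hm = ?b \<inter> {w. Im w < 0}"
  have conn: "connected (?F ` Hp)" "connected (?F ` Hm)"
    unfolding Hp_def Hm_def
    by (intro connected_continuous_image continuous_straighten convex_connected convex_Int convex_ball
        convex_halfspace_Im_gt convex_halfspace_Im_lt)+
  have disj: "?F ` Hp \<inter> range c = {}" "?F ` Hm \<inter> range c = {}"
    using real by (auto simp: Hp_def Hm_def)
  have Wsplit: "W \<subseteq> ?F ` Hp \<union> ?F ` Hm \<union> range c"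
  proof
    fix z assume "z \<in> W"
    then obtain w where w: "w \<in> ?b" "z = ?F w" by (auto simp: W_def)
    consider "0 < Im w" | "Im w < 0" | "Im w = 0" by linarith
    then show "z \<in> ?F ` Hp \<union> ?F ` Hm \<union> range c"
      using w by cases (auto simp: Hp_def Hm_def straighten_def)
  qed
  let ?I = "inside (range c)" and ?O = "outside (range c)"
  have J: "open ?I" "open ?O" "frontier ?I = range c" "frontier ?O = range c" "?I \<inter> ?O = {}" "?I \<union> ?O = - range c"
    using Jordan_inside_outside[OF simple_loop] inside_Int_outside inside_Un_outside unfolding path_image_c by auto
  have one_side: "X \<subseteq> ?I \<or> X \<subseteq> ?O" if "connected X" "X \<inter> range c = {}" for X
    using connectedD[OF that(1) J(1,2)] J(5,6) that(2) by blast
  \<comment> \<open>By the Jordan curve theorem each neighbourhood of \<open>y\<close> meets both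
    sides, so the two half-discs cannot lie on the same side.\<close>
  have meetI: "W \<inter> ?I \<noteq> {}" and meetO: "W \<inter> ?O \<noteq> {}"
  proof -
    have "y \<in> closure ?I" "y \<in> closure ?O" using J(3,4) y by (auto simp: frontier_def)
    then show "W \<inter> ?I \<noteq> {}" "W \<inter> ?O \<noteq> {}"
      using open_Int_closure_eq_empty[OF openW] yW by blast+
  qed
  have WI: "W \<inter> ?I \<subseteq> ?F ` Hp \<union> ?F ` Hm" "W \<inter> ?O \<subseteq> ?F ` Hp \<union> ?F ` Hm"
    using Wsplit J(6) by blast+
  have sub: "?F ` Hp \<subseteq> W" "?F ` Hm \<subseteq> W" by (auto simp: Hp_def Hm_def W_def)
  have "?F ` Hp \<subseteq> ?I \<and> ?F ` Hm \<subseteq> ?O \<or> ?F ` Hp \<subseteq> ?O \<and> ?F ` Hm \<subseteq> ?I"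
  proof -
    have aux: "P \<subseteq> I \<and> Q \<subseteq> O' \<or> P \<subseteq> O' \<and> Q \<subseteq> I"
      if "P \<subseteq> I \<or> P \<subseteq> O'" "Q \<subseteq> I \<or> Q \<subseteq> O'" "V \<inter> I \<subseteq> P \<union> Q" "V \<inter> O' \<subseteq> P \<union> Q" "V \<inter> I \<noteq> {}" "V \<inter> O' \<noteq> {}" "I \<inter> O' = {}"
      for P Q I O' V :: "complex set"
      using that(1,2)
    proof (elim disjE)
      assume "P \<subseteq> I" "Q \<subseteq> I"
      then have "V \<inter> O' \<subseteq> I" using that(4) by blast
      then show ?thesis using that(6,7) by blast
    next
      assume "P \<subseteq> O'" "Q \<subseteq> O'"
      then have "V \<inter> I \<subseteq> O'" using that(3) by blast
      then show ?thesis using that(5,7) by blast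
    qed blast+
    show ?thesis
      by (rule aux[OF one_side[OF conn(1) disj(1)] one_side[OF conn(2) disj(2)] WI meetI meetO J(5)])
  qed
  moreover have pick: "V \<inter> I = P"
    if "P \<subseteq> I" "Q \<subseteq> O'" "V \<inter> I \<subseteq> P \<union> Q" "I \<inter> O' = {}" "P \<subseteq> V" for P Q I O' V :: "complex set"
    using that by blast
  ultimately have "W \<inter> ?I = ?F ` Hp \<or> W \<inter> ?I = ?F ` Hm"
    using pick[OF _ _ WI(1) J(5) sub(1)] pick[OF _ _ WI(1)[unfolded Un_commute[of "?F ` Hp"]] J(5) sub(2)] by metis
  moreover have "W \<subseteq> U" unfolding W_def using d3(3) by auto
  ultimately show ?thesis
    using that[OF openW yW meetI _ _ refl] conn by auto
qed

end

section \<open>Components of sublevel sets\<close>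

lemma cis_inj: "cis a = cis b \<Longrightarrow> \<bar>a - b\<bar> < 2 * pi \<Longrightarrow> a = b"
proof -
  assume eq: "cis a = cis b" and small: "\<bar>a - b\<bar> < 2 * pi"
  have "cis (a - b) = 1" using eq by (simp flip: cis_divide)
  then have "cos (a - b) = 1" by (metis cis.sel(1) one_complex.sel(1))
  then obtain k :: int where k: "a - b = of_int k * 2 * pi" by (auto simp: cos_one_2pi_int)
  then have "\<bar>real_of_int k\<bar> * (2 * pi) < 1 * (2 * pi)" using small by (simp add: abs_mult)
  then have "\<bar>real_of_int k\<bar> < 1" by (rule mult_right_less_imp_less) simp
  then have "k = 0" by linarith
  then show ?thesis using k by simp
qed

lemma scaleR_cis_inj:
  assumes "a *\<^sub>R cis \<theta> = b *\<^sub>R cis \<phi>" "0 < a" "0 \<le> b" "\<bar>\<theta> - \<phi>\<bar> < 2 * pi"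
  shows "a = b \<and> \<theta> = \<phi>"
proof -
  have "norm (a *\<^sub>R cis \<theta>) = norm (b *\<^sub>R cis \<phi>)" using assms(1) by simp
  then have "a = b" using assms(2,3) by simp
  then show ?thesis using assms cis_inj by auto
qed

lemma polar_from:
  fixes z :: complex
  assumes "z \<noteq> 0"
  obtains \<phi> where "\<theta> \<le> \<phi>" "\<phi> < \<theta> + 2 * pi" "z = norm z *\<^sub>R cis \<phi>"
proof -
  define w where "w = z * cis (- \<theta>)"
  have w: "w \<noteq> 0" "norm w = norm z" using assms by (auto simp: w_def norm_mult)
  have A: "0 \<le> Arg2pi w" "Arg2pi w < 2 * pi" "w = norm w *\<^sub>R cis (Arg2pi w)"
    using Arg2pi[of w] by (auto simp: is_Arg_def cis_conv_exp scaleR_conv_of_real)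
  have "z = w * cis \<theta>" by (simp add: w_def mult.assoc cis_mult)
  also have "\<dots> = norm z *\<^sub>R (cis (Arg2pi w) * cis \<theta>)" using A(3) w(2) by (metis mult_scaleR_left)
  finally have "z = norm z *\<^sub>R cis (Arg2pi w + \<theta>)" by (simp only: cis_mult)
  then show ?thesis using that[of "Arg2pi w + \<theta>"] A by simp
qed

text \<open>Half-open, as the trace of a ray on an open ball around 0.\<close>

definition radius :: "real \<Rightarrow> real \<Rightarrow> complex set" where
  "radius \<theta> r = (\<lambda>\<rho>. \<rho> *\<^sub>R cis \<theta>) ` {0..<r}"

definition open_sector :: "real \<Rightarrow> real \<Rightarrow> real \<Rightarrow> complex set" where
  "open_sector \<alpha> \<beta> r = (\<lambda>(\<rho>, \<phi>). \<rho> *\<^sub>R cis \<phi>) ` ({0<..<r} \<times> {\<alpha><..<\<beta>})"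

text \<open>Near a corner a closed curve cuts the disc into two sectors, and its inside contains one of them.\<close>

lemma inside_contains_sector:
  fixes A :: "complex \<Rightarrow> complex"
  assumes A: "continuous_on UNIV A" "inj A"
    and \<Gamma>: "simple_path \<Gamma>" "pathfinish \<Gamma> = pathstart \<Gamma>"
    and r: "0 < r" and ang: "\<alpha> < \<beta>" "\<beta> < \<alpha> + 2 * pi"
    and cut: "path_image \<Gamma> \<inter> A ` ball 0 r = A ` (radius \<alpha> r \<union> radius \<beta> r)"
  shows "A ` open_sector \<alpha> \<beta> r \<subseteq> inside (path_image \<Gamma>) \<or> A ` open_sector \<beta> (\<alpha> + 2 * pi) r \<subseteq> inside (path_image \<Gamma>)"
proof -
  let ?I = "inside (path_image \<Gamma>)" and ?O = "outside (path_image \<Gamma>)"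
  have J: "open ?I" "open ?O" "frontier ?I = path_image \<Gamma>" "?I \<inter> ?O = {}" "?I \<union> ?O = - path_image \<Gamma>"
    using Jordan_inside_outside[OF \<Gamma>] inside_Int_outside inside_Un_outside by auto
  have openA: "open (A ` ball 0 r)"
    by (rule invariance_of_domain) (use A in \<open>auto intro: continuous_on_subset inj_on_subset\<close>)
  have in_ball: "open_sector a b r \<subseteq> ball 0 r" for a b by (auto simp: open_sector_def)
  have A0: "A 0 \<in> path_image \<Gamma>" "A 0 \<in> A ` ball 0 r"
  proof -
    have "0 \<in> radius \<alpha> r" using r by (auto simp: radius_def intro!: image_eqI[of _ _ 0])
    then show "A 0 \<in> path_image \<Gamma>" using cut by blast
    show "A 0 \<in> A ` ball 0 r" using r by simp
  qed
  \<comment> \<open>The corner belongs to the frontier of the inside, so some point of the disc lies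
    inside. Its sector is connected and off the curve and therefore follows it.\<close>
  have "A 0 \<in> closure ?I" using A0(1) J(3) by (auto simp: frontier_def)
  then have "A ` ball 0 r \<inter> ?I \<noteq> {}"
    using open_Int_closure_eq_empty[OF openA] A0(2) by blast
  then obtain z where z: "z \<in> ball 0 r" "A z \<in> ?I" by blast
  have "A z \<notin> path_image \<Gamma>" using z(2) J(5) by blast
  then have zr: "z \<notin> radius \<alpha> r \<union> radius \<beta> r" using cut z(1) by blast
  have z0: "z \<noteq> 0" using \<open>A z \<notin> path_image \<Gamma>\<close> A0(1) by metis
  obtain \<phi> where \<phi>: "\<alpha> \<le> \<phi>" "\<phi> < \<alpha> + 2 * pi" "z = norm z *\<^sub>R cis \<phi>" by (rule polar_from[OF z0])
  have nz: "norm z \<in> {0<..<r}" using z z0 by auto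
  have "\<phi> \<noteq> \<alpha>" "\<phi> \<noteq> \<beta>" using zr \<phi>(3) nz by (auto simp: radius_def)
  have sec: "z \<in> open_sector \<alpha> \<beta> r \<or> z \<in> open_sector \<beta> (\<alpha> + 2 * pi) r"
  proof (cases "\<phi> < \<beta>")
    case True
    then have "(norm z, \<phi>) \<in> {0<..<r} \<times> {\<alpha><..<\<beta>}" using nz \<phi> \<open>\<phi> \<noteq> \<alpha>\<close> by auto
    then show ?thesis unfolding open_sector_def using \<phi>(3) by (intro disjI1 image_eqI[of _ _ "(norm z, \<phi>)"]) auto
  next
    case False
    then have "(norm z, \<phi>) \<in> {0<..<r} \<times> {\<beta><..<\<alpha> + 2 * pi}" using nz \<phi> \<open>\<phi> \<noteq> \<beta>\<close> by auto
    then show ?thesis unfolding open_sector_def using \<phi>(3) by (intro disjI2 image_eqI[of _ _ "(norm z, \<phi>)"]) auto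
  qed
  have grow: "A ` open_sector a b r \<subseteq> ?I"
    if "z \<in> open_sector a b r" and ab: "\<alpha> \<le> a" "b \<le> \<alpha> + 2 * pi" "b \<le> \<beta> \<or> \<beta> \<le> a" for a b
  proof -
    have "connected (A ` open_sector a b r)"
      unfolding open_sector_def
      by (intro connected_continuous_image continuous_on_subset[OF A(1)] connected_Times) (auto simp: split_beta intro!: continuous_intros)
    moreover have "A ` open_sector a b r \<inter> path_image \<Gamma> = {}"
    proof (rule ccontr)
      assume "A ` open_sector a b r \<inter> path_image \<Gamma> \<noteq> {}"
      then obtain w where w: "w \<in> open_sector a b r" "A w \<in> path_image \<Gamma>" by blast
      then have "A w \<in> A ` (radius \<alpha> r \<union> radius \<beta> r)" using cut in_ball by blast
      then have "w \<in> radius \<alpha> r \<union> radius \<beta> r" using A(2) by (auto dest: injD)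
      then obtain \<rho>' \<theta> where \<rho>': "\<rho>' \<in> {0..<r}" "w = \<rho>' *\<^sub>R cis \<theta>" "\<theta> = \<alpha> \<or> \<theta> = \<beta>"
        unfolding radius_def by blast
      obtain \<rho> \<psi> where \<rho>: "0 < \<rho>" "a < \<psi>" "\<psi> < b" "w = \<rho> *\<^sub>R cis \<psi>" using w(1) by (auto simp: open_sector_def)
      have "\<bar>\<psi> - \<theta>\<bar> < 2 * pi" using \<rho> \<rho>'(3) ab ang by auto
      then have "\<psi> = \<theta>" using scaleR_cis_inj[of \<rho> \<psi> \<rho>' \<theta>] \<rho> \<rho>' by simp
      then show False using \<rho> \<rho>'(3) ab by auto
    qed
    ultimately have "A ` open_sector a b r \<subseteq> ?I \<or> A ` open_sector a b r \<subseteq> ?O"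
      using connectedD[of "A ` open_sector a b r" ?I ?O] J by blast
    then show ?thesis using that(1) z(2) J(4) by blast
  qed
  show ?thesis using sec grow[of \<alpha> \<beta>] grow[of \<beta> "\<alpha> + 2 * pi"] ang by auto
qed

text \<open>A point of \<open>inside S\<close> outside \<open>D\<close> would have the whole
  unbounded complement of \<open>D\<close> in its component of \<open>- S\<close>. Filled domains
  thus contain everything that their loops enclose.\<close>

lemma inside_subset_of_connected_complement:
  fixes S D :: "'a::real_normed_vector set"
  assumes "connected (- D)" "\<not> bounded (- D)" "S \<subseteq> D"
  shows "inside S \<subseteq> D"
proof
  fix z assume z: "z \<in> inside S"
  show "z \<in> D"
  proof (rule ccontr)
    assume "z \<notin> D"
    then have "- D \<subseteq> connected_component_set (- S) z"
      using assms by (intro connected_component_maximal) auto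
    moreover have "bounded (connected_component_set (- S) z)" using z by (simp add: inside_def)
    ultimately show False using assms(2) bounded_subset by blast
  qed
qed

text \<open>\<open>D\<close> is the domain with its hole filled in, \<open>\<gamma>\<close> the
  outer curve, \<open>K\<close> the filled hole with its boundary curve and \<open>v\<close> the
  extension of \<open>u\<close> by \<open>H\<close>. Interior extrema are excluded off
  \<open>K\<close> only. By \<open>local_structure\<close> no boundary point is approached from two
  sides.\<close>

locale annular_levels =
  fixes D K \<gamma> :: "complex set" and v :: "complex \<Rightarrow> real" and H :: real
  assumes D: "open D" "bounded D" "connected (- D)" and closure_D: "closure D = D \<union> \<gamma>"
    and local_structure: "\<And>y U. y \<in> \<gamma> \<Longrightarrow> open U \<Longrightarrow> y \<in> U \<Longrightarrow>
      \<exists>B W. open W \<and> y \<in> W \<and> B \<noteq> {} \<and> connected B \<and> W \<inter> D = B \<and> W \<subseteq> U"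
    and v_cont: "continuous_on (closure D) v"
    and K: "K \<subseteq> D" "connected K" "K \<noteq> {}" "\<And>z. z \<in> K \<Longrightarrow> v z = H"
    and v_low: "\<And>y. y \<in> \<gamma> \<Longrightarrow> H \<le> v y"
    and no_max: "\<And>p e. p \<in> D - K \<Longrightarrow> 0 < e \<Longrightarrow> \<exists>y\<in>D \<inter> ball p e. v p < v y"
    and no_min: "\<And>p e. p \<in> D - K \<Longrightarrow> 0 < e \<Longrightarrow> \<exists>y\<in>D \<inter> ball p e. v y < v p"
    and fin: "finite (local_max_points \<gamma> (\<lambda>x. - v x))"
begin

text \<open>Here \<open>n\<close> is one more than the multiplicity. The rays are those on which
  \<open>Re (z ^ n)\<close> is extremal: even \<open>j\<close> are positive and odd \<open>j\<close>
  negative directions.\<close>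

definition saddle :: "complex \<Rightarrow> nat \<Rightarrow> bool" where
  "saddle x n \<longleftrightarrow> x \<in> D - K \<and> 1 \<le> n \<and> (\<exists>T r. linear T \<and> inj (T :: complex \<Rightarrow> complex) \<and> 0 < r \<and>
     (\<forall>j \<rho>. 0 < \<rho> \<longrightarrow> \<rho> \<le> r \<longrightarrow> x + T (\<rho> *\<^sub>R cis (real j * pi / real n)) \<in> D \<and>
       (if even j then v x < v (x + T (\<rho> *\<^sub>R cis (real j * pi / real n)))
        else v (x + T (\<rho> *\<^sub>R cis (real j * pi / real n))) < v x)))"

lemma unbounded_complement: "\<not> bounded (- D)"
proof
  assume "bounded (- D)"
  then have "bounded (D \<union> - D)" using D(2) bounded_Un by blast
  then show False by simp
qed

lemma compact_closure_D: "compact (closure D)" using D(2) by simp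

lemma v_cont_D: "continuous_on D v" using v_cont closure_subset continuous_on_subset by blast

text \<open>The minimum over the compact closure lies on \<open>K\<close> or
  \<open>\<gamma>\<close>, so it is at least \<open>H\<close>; the value \<open>H\<close> off
  \<open>K\<close> would be an interior minimum.\<close>

lemma above_H:
  assumes z: "z \<in> D - K" shows "H < v z"
proof -
  have "closure D \<noteq> {}" using z closure_subset by blast
  then obtain q where q: "q \<in> closure D" "\<And>w. w \<in> closure D \<Longrightarrow> v q \<le> v w"
    using continuous_attains_inf[OF compact_closure_D _ v_cont] by blast
  have not_min: "p \<notin> D - K" if "\<And>w. w \<in> closure D \<Longrightarrow> v p \<le> v w" for p
  proof
    assume "p \<in> D - K"
    then obtain y where "y \<in> D" "v y < v p" using no_min[of p 1] by auto
    then show False using that[of y] closure_subset by fastforce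
  qed
  then have "q \<in> K \<or> q \<in> \<gamma>" using q closure_D by blast
  then have "H \<le> v q" using K(4) v_low by auto
  then have ge: "H \<le> v w" if "w \<in> closure D" for w using q(2)[OF that] by simp
  show ?thesis
  proof (rule ccontr)
    assume "\<not> ?thesis"
    then have "v z = H" using ge[of z] z closure_subset by fastforce
    then show False using not_min[of z] ge z by auto
  qed
qed

definition sublevel :: "real \<Rightarrow> complex set" where "sublevel t = {z \<in> D. v z < t}"

lemma open_sublevel: "open (sublevel t)"
proof -
  have "open (D \<inter> v -` {..<t})" by (rule continuous_open_preimage[OF v_cont_D D(1)]) simp
  moreover have "D \<inter> v -` {..<t} = sublevel t" by (auto simp: sublevel_def)
  ultimately show ?thesis by simp
qed

text \<open>The enclosed set may contain \<open>K\<close>. A maximum above \<open>t\<close> cannot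
  lie there, since \<open>v\<close> equals \<open>H \<le> t\<close> on \<open>K\<close>, and off
  \<open>K\<close> interior maxima do not exist.\<close>

lemma max_principle_inside:
  assumes "compact S" "S \<subseteq> D" "\<And>z. z \<in> S \<Longrightarrow> v z \<le> t" "H \<le> t" "z \<in> inside S"
  shows "v z \<le> t"
proof (rule ccontr)
  assume nt: "\<not> v z \<le> t"
  have iD: "inside S \<subseteq> D" by (rule inside_subset_of_connected_complement[OF D(3) unbounded_complement assms(2)])
  have op: "open (inside S)" using assms(1) by (simp add: compact_imp_closed open_inside)
  have cl: "closure (inside S) \<subseteq> inside S \<union> S"
    using frontier_inside_subset[OF compact_imp_closed[OF assms(1)]] closure_Un_frontier[of "inside S"] by auto
  have "compact (closure (inside S))" using D(2) iD bounded_subset by auto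
  moreover have "closure (inside S) \<noteq> {}" using assms(5) closure_subset by blast
  moreover have "continuous_on (closure (inside S)) v"
    using cl iD assms(2) by (intro continuous_on_subset[OF v_cont_D]) blast
  ultimately obtain q where q: "q \<in> closure (inside S)" "\<And>w. w \<in> closure (inside S) \<Longrightarrow> v w \<le> v q"
    using continuous_attains_sup by metis
  have "v z \<le> v q" using q(2) assms(5) closure_subset by blast
  then have vq: "t < v q" using nt by simp
  then have qi: "q \<in> inside S" using q(1) cl assms(3) by fastforce
  have "q \<notin> K" using K(4) vq assms(4) by force
  moreover obtain e where e: "0 < e" "ball q e \<subseteq> inside S" using op qi open_contains_ball by blast
  ultimately obtain y where "y \<in> D \<inter> ball q e" "v q < v y" using no_max[of q e] qi iD by blast
  then show False using q(2)[of y] e(2) closure_subset by fastforce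
qed

text \<open>Two negative directions of a saddle cannot be joined below its level: the loop formed by the
  connecting arc and the two radii would enclose points of a positive sector.\<close>

lemma negative_rays_separated:
  fixes T :: "complex \<Rightarrow> complex"
  assumes x: "x \<in> D - K" and n: "1 \<le> n" and T: "linear T" "inj T" and r: "0 < r"
    and rays: "\<And>j \<rho>. 0 < \<rho> \<Longrightarrow> \<rho> \<le> r \<Longrightarrow> x + T (\<rho> *\<^sub>R cis (real j * pi / real n)) \<in> D \<and>
       (if even j then v x < v (x + T (\<rho> *\<^sub>R cis (real j * pi / real n)))
        else v (x + T (\<rho> *\<^sub>R cis (real j * pi / real n))) < v x)"
    and S: "S \<subseteq> D" "x \<notin> S" "\<And>z. z \<in> S \<Longrightarrow> v z \<le> v x"
    and j: "odd j1" "odd j2" "j1 < j2" "j2 < 2 * n"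
  shows "\<not> path_component S (x + T (r *\<^sub>R cis (real j1 * pi / real n))) (x + T (r *\<^sub>R cis (real j2 * pi / real n)))"
proof
  define A where "A = (\<lambda>z. x + T z)"
  define \<theta> where "\<theta> = (\<lambda>j. real j * pi / real n)"
  let ?\<alpha> = "\<theta> j1" and ?\<beta> = "\<theta> j2"
  assume "path_component S (x + T (r *\<^sub>R cis (real j1 * pi / real n))) (x + T (r *\<^sub>R cis (real j2 * pi / real n)))"
  then obtain g0 where g0: "path g0" "path_image g0 \<subseteq> S" "pathstart g0 = A (r *\<^sub>R cis ?\<alpha>)" "pathfinish g0 = A (r *\<^sub>R cis ?\<beta>)"
    unfolding path_component_def A_def \<theta>_def by blast
  have A: "continuous_on X A" "inj A" for X
    unfolding A_def
    by (intro continuous_intros linear_continuous_on T(1)[unfolded linear_conv_bounded_linear]) (use T(2) in \<open>auto simp: inj_def\<close>)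
  have A0: "A 0 = x" using linear_0[OF T(1)] by (simp add: A_def)
  have \<theta>_mono: "\<theta> i < \<theta> k \<longleftrightarrow> i < k" for i k using n by (simp add: \<theta>_def divide_less_cancel)
  have \<theta>_period: "\<theta> (i + 2 * n) = \<theta> i + 2 * pi" for i using n by (simp add: \<theta>_def field_simps)
  have ang: "?\<alpha> < ?\<beta>" "?\<beta> < ?\<alpha> + 2 * pi" using j \<theta>_mono \<theta>_period[of j1] by (auto simp flip: \<theta>_period)
  have ray: "A (\<rho> *\<^sub>R cis (\<theta> k)) \<in> D" "even k \<Longrightarrow> v x < v (A (\<rho> *\<^sub>R cis (\<theta> k)))" "odd k \<Longrightarrow> v (A (\<rho> *\<^sub>R cis (\<theta> k))) < v x"
    if "0 < \<rho>" "\<rho> \<le> r" for \<rho> k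
    using rays[OF that, of k] by (auto simp: A_def \<theta>_def)
  have sg: "closed_segment x (A (\<rho> *\<^sub>R cis \<phi>)) = (\<lambda>s. A (s *\<^sub>R cis \<phi>)) ` {0..\<rho>}" if "0 \<le> \<rho>" for \<rho> \<phi>
  proof -
    have "closed_segment x (A (\<rho> *\<^sub>R cis \<phi>)) = (\<lambda>u. A ((u * \<rho>) *\<^sub>R cis \<phi>)) ` {0..1}"
      unfolding closed_segment_image_interval A_def
      by (intro image_cong) (auto simp: linear_scale[OF T(1)] algebra_simps simp flip: scaleR_scaleR)
    also have "\<dots> = (\<lambda>s. A (s *\<^sub>R cis \<phi>)) ` ((\<lambda>u. u * \<rho>) ` {0..1})" by (simp add: image_image)
    also have "(\<lambda>u. u * \<rho>) ` {0..1} = {0..\<rho>}" using that image_mult_atLeastAtMost_if'[of \<rho> 0 1] by simp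
    finally show ?thesis .
  qed
  define seg where "seg = (\<lambda>\<phi>. (\<lambda>s. A (s *\<^sub>R cis \<phi>)) ` {0..r})"
  have compact_seg: "compact (seg \<phi>)" for \<phi>
    unfolding seg_def by (intro compact_continuous_image compact_Icc continuous_on_compose2[OF A(1)[of UNIV]]) (auto intro!: continuous_intros)
  have seg_meet: "y = x" if y: "y \<in> seg ?\<alpha>" "y \<in> seg ?\<beta>" for y
  proof -
    obtain a b where ab: "0 \<le> a" "0 \<le> b" "y = A (a *\<^sub>R cis ?\<alpha>)" "y = A (b *\<^sub>R cis ?\<beta>)"
      using y by (auto simp: seg_def)
    then have "a *\<^sub>R cis ?\<alpha> = b *\<^sub>R cis ?\<beta>" using A(2) by (metis injD)
    then have "a = 0" using scaleR_cis_inj[of a ?\<alpha> b ?\<beta>] ab ang by fastforce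
    then show ?thesis using ab(3) A0 by simp
  qed
  have ends_ne: "pathstart g0 \<noteq> pathfinish g0"
  proof
    assume "pathstart g0 = pathfinish g0"
    then have "r *\<^sub>R cis ?\<alpha> = r *\<^sub>R cis ?\<beta>" using g0 A(2) by (metis injD)
    then show False using scaleR_cis_inj[of r ?\<alpha> r ?\<beta>] r ang by fastforce
  qed
  obtain g where g: "arc g" "path_image g \<subseteq> S" "pathstart g = A (r *\<^sub>R cis ?\<alpha>)" "pathfinish g = A (r *\<^sub>R cis ?\<beta>)"
    using path_contains_arc[OF g0(1) _ _ ends_ne] g0 by (metis subset_trans)
  have cg: "continuous_on {0..1} g" using arc_imp_path[OF g(1)] by (simp add: path_def)
  have gS: "g s \<in> S" if "s \<in> {0..1}" for s using that g(2) by (auto simp: path_image_def)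
  have last: "compact {s \<in> {a..1}. g s \<in> seg \<phi>}" if "0 \<le> a" for a \<phi>
  proof -
    have "closed ({a..1} \<inter> g -` seg \<phi>)"
      using compact_imp_closed[OF compact_seg] cg that
      by (intro continuous_closed_preimage continuous_on_subset[OF cg]) auto
    moreover have "{a..1} \<inter> g -` seg \<phi> = {s \<in> {a..1}. g s \<in> seg \<phi>}" by auto
    moreover have "bounded {s \<in> {a..1}. g s \<in> seg \<phi>}" by (rule bounded_subset[of "{a..1}"]) auto
    ultimately show ?thesis by (simp add: compact_eq_bounded_closed)
  qed
  have "g 0 \<in> seg ?\<alpha>" "g 1 \<in> seg ?\<beta>"
    using g(3,4) r by (auto simp: seg_def pathstart_def pathfinish_def)
  then have ne: "{s \<in> {0..1}. g s \<in> seg ?\<alpha>} \<noteq> {}" and g1: "g 1 \<in> seg ?\<beta>" by (auto intro!: exI[of _ 0])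
  \<comment> \<open>The last point on the first ray, and after it the first point on the second ray:
    between them the arc touches the rays only at its ends, which makes the loop simple.\<close>
  obtain \<sigma> where \<sigma>: "\<sigma> \<in> {0..1}" "g \<sigma> \<in> seg ?\<alpha>" "\<And>s. s \<in> {0..1} \<Longrightarrow> g s \<in> seg ?\<alpha> \<Longrightarrow> s \<le> \<sigma>"
    using compact_attains_sup[OF last[of 0 ?\<alpha>, OF order_refl] ne] by blast
  have "1 \<in> {s \<in> {\<sigma>..1}. g s \<in> seg ?\<beta>}" using g1 \<sigma>(1) by simp
  then have ne2: "{s \<in> {\<sigma>..1}. g s \<in> seg ?\<beta>} \<noteq> {}" by blast
  have "0 \<le> \<sigma>" using \<sigma>(1) by simp
  obtain \<tau> where \<tau>: "\<tau> \<in> {\<sigma>..1}" "g \<tau> \<in> seg ?\<beta>" "\<And>s. s \<in> {\<sigma>..1} \<Longrightarrow> g s \<in> seg ?\<beta> \<Longrightarrow> \<tau> \<le> s"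
    using compact_attains_inf[OF last[OF \<open>0 \<le> \<sigma>\<close>] ne2] by blast
  have gx: "g s \<noteq> x" if "s \<in> {0..1}" for s using gS[OF that] S(2) by blast
  have \<sigma>\<tau>: "\<sigma> < \<tau>" "\<tau> \<in> {0..1}"
  proof -
    show "\<tau> \<in> {0..1}" using \<sigma>(1) \<tau>(1) by auto
    have "\<sigma> \<noteq> \<tau>" using seg_meet[of "g \<sigma>"] \<sigma>(2) \<tau>(2) gx[OF \<sigma>(1)] by auto
    then show "\<sigma> < \<tau>" using \<tau>(1) by auto
  qed
  obtain a where a: "0 < a" "a \<le> r" "g \<sigma> = A (a *\<^sub>R cis ?\<alpha>)"
  proof -
    obtain a where "a \<in> {0..r}" "g \<sigma> = A (a *\<^sub>R cis ?\<alpha>)" using \<sigma>(2) unfolding seg_def by blast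
    moreover have "a \<noteq> 0" using calculation(2) gx[OF \<sigma>(1)] A0 by auto
    ultimately show ?thesis using that[of a] by auto
  qed
  obtain b where b: "0 < b" "b \<le> r" "g \<tau> = A (b *\<^sub>R cis ?\<beta>)"
  proof -
    obtain b where "b \<in> {0..r}" "g \<tau> = A (b *\<^sub>R cis ?\<beta>)" using \<tau>(2) unfolding seg_def by blast
    moreover have "b \<noteq> 0" using calculation(2) gx[OF \<sigma>\<tau>(2)] A0 by auto
    ultimately show ?thesis using that[of b] by auto
  qed
  define h where "h = subpath \<sigma> \<tau> g"
  have h: "arc h" "pathstart h = g \<sigma>" "pathfinish h = g \<tau>" "path_image h = g ` {\<sigma>..\<tau>}"
    using g(1) \<sigma>(1) \<sigma>\<tau> by (auto simp: h_def path_image_subpath intro!: arc_subpath_arc)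
  have s1: "closed_segment x (g \<sigma>) = (\<lambda>s. A (s *\<^sub>R cis ?\<alpha>)) ` {0..a}" unfolding a(3) using a by (intro sg) simp
  have s2: "closed_segment x (g \<tau>) = (\<lambda>s. A (s *\<^sub>R cis ?\<beta>)) ` {0..b}" unfolding b(3) using b by (intro sg) simp
  have sub1: "closed_segment x (g \<sigma>) \<subseteq> seg ?\<alpha>" unfolding s1 seg_def using a by auto
  have sub2: "closed_segment x (g \<tau>) \<subseteq> seg ?\<beta>" unfolding s2 seg_def using b by auto
  have h1: "path_image h \<inter> seg ?\<alpha> \<subseteq> {g \<sigma>}"
  proof
    fix y assume y: "y \<in> path_image h \<inter> seg ?\<alpha>"
    then have "y \<in> g ` {\<sigma>..\<tau>}" unfolding h(4)[symmetric] by simp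
    then obtain s where s: "y = g s" "s \<in> {\<sigma>..\<tau>}" by (rule imageE)
    moreover from y s(1) have "g s \<in> seg ?\<alpha>" by simp
    ultimately have "s \<in> {\<sigma>..\<tau>}" "y = g s" "g s \<in> seg ?\<alpha>" by simp_all
    then show "y \<in> {g \<sigma>}" using \<sigma>(3)[of s] \<sigma>(1) \<sigma>\<tau> by simp
  qed
  have h2: "path_image h \<inter> seg ?\<beta> \<subseteq> {g \<tau>}"
  proof
    fix y assume y: "y \<in> path_image h \<inter> seg ?\<beta>"
    then have "y \<in> g ` {\<sigma>..\<tau>}" unfolding h(4)[symmetric] by simp
    then obtain s where s: "y = g s" "s \<in> {\<sigma>..\<tau>}" by (rule imageE)
    moreover from y s(1) have "g s \<in> seg ?\<beta>" by simp
    ultimately have "s \<in> {\<sigma>..\<tau>}" "y = g s" "g s \<in> seg ?\<beta>" by simp_all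
    then show "y \<in> {g \<tau>}" using \<tau>(3)[of s] \<sigma>(1) \<sigma>\<tau> by simp
  qed
  define \<Gamma> where "\<Gamma> = linepath x (g \<sigma>) +++ (h +++ linepath (g \<tau>) x)"
  have arc2: "arc (h +++ linepath (g \<tau>) x)"
    using h h2 sub2 gx[OF \<sigma>\<tau>(2)] by (intro arc_join arc_linepath) (auto simp: closed_segment_commute)
  have im2: "path_image (h +++ linepath (g \<tau>) x) = path_image h \<union> closed_segment x (g \<tau>)"
    using h(3) by (simp add: path_image_join closed_segment_commute)
  have \<Gamma>: "simple_path \<Gamma>" "pathfinish \<Gamma> = pathstart \<Gamma>"
    "path_image \<Gamma> = closed_segment x (g \<sigma>) \<union> path_image h \<union> closed_segment x (g \<tau>)"
  proof -
    have "path_image (linepath x (g \<sigma>)) \<inter> path_image (h +++ linepath (g \<tau>) x) \<subseteq> {x, g \<sigma>}"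
      unfolding im2 using sub1 sub2 h1 seg_meet by fastforce
    then show "simple_path \<Gamma>" unfolding \<Gamma>_def
      using arc2 h(2) gx[OF \<sigma>(1)] by (intro simple_path_join_loop arc_linepath) (auto simp: insert_commute)
    show "pathfinish \<Gamma> = pathstart \<Gamma>" unfolding \<Gamma>_def by simp
    show "path_image \<Gamma> = closed_segment x (g \<sigma>) \<union> path_image h \<union> closed_segment x (g \<tau>)"
      unfolding \<Gamma>_def using im2 h(2) by (subst path_image_join) auto
  qed
  have seg_low: "y \<in> D \<and> v y \<le> v x" if y: "y \<in> seg (\<theta> k)" and k: "odd k" for y k
  proof -
    obtain s where s: "s \<in> {0..r}" "y = A (s *\<^sub>R cis (\<theta> k))" using y unfolding seg_def by blast
    show ?thesis
    proof (cases "s = 0")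
      case True
      then show ?thesis using s(2) A0 x by simp
    next
      case False
      then have "0 < s" "s \<le> r" using s(1) by auto
      then show ?thesis using ray(1,3)[of s k] k s(2) by auto
    qed
  qed
  have hS: "path_image h \<subseteq> S"
    using path_image_subpath_subset[of \<sigma> \<tau> g] \<sigma>(1) \<sigma>\<tau>(2) g(2) unfolding h_def by simp
  have low: "y \<in> D \<and> v y \<le> v x" if "y \<in> path_image \<Gamma>" for y
  proof -
    have "path_image \<Gamma> \<subseteq> seg ?\<alpha> \<union> S \<union> seg ?\<beta>" unfolding \<Gamma>(3) by (intro Un_mono sub1 sub2 hS)
    from subsetD[OF this that] consider "y \<in> seg ?\<alpha>" | "y \<in> S" | "y \<in> seg ?\<beta>" by (elim UnE)
    then show ?thesis
    proof cases
      case 1 then show ?thesis by (rule seg_low[OF _ j(1)])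
    next
      case 2 then show ?thesis using S(1) S(3)[of y] by blast
    next
      case 3 then show ?thesis by (rule seg_low[OF _ j(2)])
    qed
  qed
  \<comment> \<open>The connecting arc stays away from \<open>x\<close>, so in a small disc the loop
    consists of the two radii alone.\<close>
  obtain \<epsilon> where \<epsilon>: "0 < \<epsilon>" "\<epsilon> \<le> a" "\<epsilon> \<le> b" "A ` ball 0 \<epsilon> \<inter> path_image h = {}"
  proof -
    have "open (A -` (- path_image h))"
      using closed_path_image[OF arc_imp_path[OF h(1)]] by (intro open_vimage A(1)) auto
    moreover have "0 \<in> A -` (- path_image h)" using A0 hS S(2) by auto
    ultimately obtain e where e: "e > 0" "ball 0 e \<subseteq> A -` (- path_image h)" using open_contains_ball by blast
    show ?thesis
    proof (rule that[of "min e (min a b)"])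
      have "ball 0 (min e (min a b)) \<subseteq> A -` (- path_image h)" using e(2) by auto
      then show "A ` ball 0 (min e (min a b)) \<inter> path_image h = {}" by blast
    qed (use e(1) a b in auto)
  qed
  have part: "(\<lambda>s. A (s *\<^sub>R cis \<phi>)) ` {0..c} \<inter> A ` ball 0 \<epsilon> = A ` radius \<phi> \<epsilon>" if "\<epsilon> \<le> c" for \<phi> c
  proof -
    have "(\<lambda>s. A (s *\<^sub>R cis \<phi>)) ` {0..c} = A ` ((\<lambda>s. s *\<^sub>R cis \<phi>) ` {0..c})" by (simp add: image_image)
    moreover have "(\<lambda>s. s *\<^sub>R cis \<phi>) ` {0..c} \<inter> ball 0 \<epsilon> = radius \<phi> \<epsilon>"
      using that by (auto simp: radius_def)
    ultimately show ?thesis using image_Int[OF A(2)] by metis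
  qed
  have "path_image \<Gamma> \<inter> A ` ball 0 \<epsilon> = A ` (radius ?\<alpha> \<epsilon> \<union> radius ?\<beta> \<epsilon>)"
    unfolding \<Gamma>(3) Int_Un_distrib2 s1 s2 part[OF \<epsilon>(2)] part[OF \<epsilon>(3)] image_Un using \<epsilon>(4) by blast
  from inside_contains_sector[OF A(1,2) \<Gamma>(1,2) \<epsilon>(1) ang this]
  have "A ` open_sector ?\<alpha> ?\<beta> \<epsilon> \<subseteq> inside (path_image \<Gamma>) \<or> A ` open_sector ?\<beta> (?\<alpha> + 2 * pi) \<epsilon> \<subseteq> inside (path_image \<Gamma>)" .
  moreover have in_sector: "A ((\<epsilon> / 2) *\<^sub>R cis \<phi>) \<in> A ` open_sector p q \<epsilon>" if "p < \<phi>" "\<phi> < q" for \<phi> p q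
    unfolding open_sector_def using that \<epsilon>(1) by (intro imageI image_eqI[of _ _ "(\<epsilon> / 2, \<phi>)"]) auto
  \<comment> \<open>Both indices are odd, so there is a positive direction on either side:
    \<open>j1 + 1\<close> in one sector and \<open>j2 + 1\<close> in the other. Whichever sector is
    inside, the maximum principle fails there.\<close>
  moreover have "j1 + 1 \<noteq> j2" "1 \<le> j1" using j by (auto elim: oddE)
  then have "j1 < j1 + 1" "j1 + 1 < j2" "j2 < j2 + 1" "j2 + 1 < j1 + 2 * n" using j by linarith+
  then have "?\<alpha> < \<theta> (j1 + 1)" "\<theta> (j1 + 1) < ?\<beta>" "?\<beta> < \<theta> (j2 + 1)" "\<theta> (j2 + 1) < ?\<alpha> + 2 * pi"
    unfolding \<theta>_period[symmetric] \<theta>_mono .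
  ultimately have in_inside: "A ((\<epsilon> / 2) *\<^sub>R cis (\<theta> (j1 + 1))) \<in> inside (path_image \<Gamma>) \<or> A ((\<epsilon> / 2) *\<^sub>R cis (\<theta> (j2 + 1))) \<in> inside (path_image \<Gamma>)"
    by blast
  obtain k where k: "even k" "A ((\<epsilon> / 2) *\<^sub>R cis (\<theta> k)) \<in> inside (path_image \<Gamma>)"
  proof -
    have "even (j1 + 1)" "even (j2 + 1)" using j by simp_all
    then show ?thesis using that[of "j1 + 1"] that[of "j2 + 1"] in_inside by blast
  qed
  have "v (A ((\<epsilon> / 2) *\<^sub>R cis (\<theta> k))) \<le> v x"
  proof (rule max_principle_inside[OF _ _ _ _ k(2)])
    show "compact (path_image \<Gamma>)" using \<Gamma>(1) by (simp add: compact_path_image simple_path_imp_path)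
    show "H \<le> v x" using above_H[OF x] by simp
  qed (use low in auto)
  moreover have "v x < v (A ((\<epsilon> / 2) *\<^sub>R cis (\<theta> k)))" using k(1) \<epsilon> a by (intro ray(2)) auto
  ultimately show False by simp
qed

text \<open>A component of a sublevel set which misses \<open>K\<close> attains its minimum only on \<open>\<gamma>\<close>, at a local
  minimum of the boundary values; a point of \<open>D\<close> close to it marks the component.\<close>

lemma markers:
  assumes V: "finite V" "\<And>t. t \<in> V \<Longrightarrow> H < t"
  obtains M where "finite M" "M \<noteq> {}" "card M \<le> card (local_max_points \<gamma> (\<lambda>x. - v x)) + 1"
    "\<And>t z. t \<in> V \<Longrightarrow> z \<in> sublevel t \<Longrightarrow> \<exists>w\<in>M. path_component (sublevel t) z w"
proof -
  let ?L = "local_max_points \<gamma> (\<lambda>x. - v x)"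
  obtain k where k: "k \<in> K" using K(3) by blast
  have ex: "\<exists>w W. open W \<and> y \<in> W \<and> connected (W \<inter> D) \<and> w \<in> W \<inter> D \<and> (\<forall>t\<in>V. v y < t \<longrightarrow> W \<inter> D \<subseteq> sublevel t)"
    if y: "y \<in> \<gamma>" for y
  proof -
    have yc: "y \<in> closure D" using y closure_D by blast
    \<comment> \<open>Finitely many levels admit a common radius, so that a single marker near
      \<open>y\<close> serves all of them.\<close>
    have "\<exists>e>0. \<forall>t\<in>V. v y < t \<longrightarrow> (\<forall>z\<in>closure D. dist z y < e \<longrightarrow> v z < t)"
      using V(1)
    proof (induction V)
      case empty
      show ?case by (intro exI[of _ 1]) simp
    next
      case (insert t V)
      then obtain e where e: "e > 0" "\<forall>t\<in>V. v y < t \<longrightarrow> (\<forall>z\<in>closure D. dist z y < e \<longrightarrow> v z < t)" by blast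
      show ?case
      proof (cases "v y < t")
        case True
        then have "0 < t - v y" by simp
        with v_cont yc obtain d where d: "d > 0" "\<forall>z\<in>closure D. dist z y < d \<longrightarrow> dist (v z) (v y) < t - v y"
          unfolding continuous_on_iff by meson
        then have "\<forall>z\<in>closure D. dist z y < d \<longrightarrow> v z < t" by (auto simp: dist_real_def)
        then show ?thesis using e d(1) by (intro exI[of _ "min e d"]) auto
      qed (use e in auto)
    qed
    then obtain e where e: "e > 0" "\<And>t z. t \<in> V \<Longrightarrow> v y < t \<Longrightarrow> z \<in> closure D \<Longrightarrow> dist z y < e \<Longrightarrow> v z < t" by blast
    have "y \<in> ball y e" using e(1) by simp
    from local_structure[OF y open_ball this]
    obtain B W where BW: "open W" "y \<in> W" "B \<noteq> {}" "connected B" "W \<inter> D = B" "W \<subseteq> ball y e"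
      by (elim exE conjE)
    have "W \<inter> D \<subseteq> sublevel t" if t: "t \<in> V" "v y < t" for t
    proof
      fix z assume z: "z \<in> W \<inter> D"
      then have "z \<in> closure D" "dist z y < e" using closure_subset[of D] BW(6) by (auto simp: dist_commute)
      then show "z \<in> sublevel t" using e(2)[OF t] z by (simp add: sublevel_def)
    qed
    then show ?thesis using BW by blast
  qed
  then have "\<exists>w. \<forall>y\<in>\<gamma>. \<exists>W. open W \<and> y \<in> W \<and> connected (W \<inter> D) \<and> w y \<in> W \<inter> D \<and> (\<forall>t\<in>V. v y < t \<longrightarrow> W \<inter> D \<subseteq> sublevel t)"
    by (intro bchoice ballI)
  then obtain w where w: "\<And>y. y \<in> \<gamma> \<Longrightarrow> \<exists>W. open W \<and> y \<in> W \<and> connected (W \<inter> D) \<and> w y \<in> W \<inter> D \<and> (\<forall>t\<in>V. v y < t \<longrightarrow> W \<inter> D \<subseteq> sublevel t)"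
    by blast
  \<comment> \<open>The point \<open>k\<close> marks the component that contains \<open>K\<close>;
    it accounts for the \<open>+ 1\<close>.\<close>
  define M where "M = insert k (w ` ?L)"
  have "card M \<le> card (w ` ?L) + 1" unfolding M_def using fin by (simp add: card_insert_if)
  then have card: "card M \<le> card ?L + 1" using card_image_le[OF fin, of w] by linarith
  have main: "\<exists>w\<in>M. path_component (sublevel t) z w" if t: "t \<in> V" and z: "z \<in> sublevel t" for t z
  proof -
    let ?N = "sublevel t"
    define C where "C = connected_component_set ?N z"
    have C: "open C" "z \<in> C" "C \<subseteq> ?N"
      unfolding C_def using open_connected_component[OF open_sublevel] z
      by (simp, simp, intro connected_component_subset)
    have grow: "X \<subseteq> C" if X: "connected X" "X \<subseteq> ?N" "X \<inter> C \<noteq> {}" for X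
    proof -
      obtain p where p: "p \<in> X" "p \<in> C" using X(3) by blast
      have "X \<subseteq> connected_component_set ?N p" by (rule connected_component_maximal[OF p(1) X(1,2)])
      also have "connected_component_set ?N p = C"
        unfolding C_def using p(2) connected_component_eq[of p ?N z] by (simp add: C_def)
      finally show ?thesis .
    qed
    have path: "path_component ?N z p" if "p \<in> C" for p
      using that path_component_eq_connected_component_set[OF open_imp_locally_path_connected[OF open_sublevel[of t]], of z] unfolding C_def by auto
    have CD: "C \<subseteq> D" using C(3) by (auto simp: sublevel_def)
    show ?thesis
    proof (cases "K \<inter> C = {}")
      case False
      have "K \<subseteq> ?N" using K(1,4) V(2)[OF t] by (auto simp: sublevel_def)
      then have "K \<subseteq> C" using grow[OF K(2)] False by blast
      then show ?thesis using path[of k] k by (auto simp: M_def)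
    next
      case True
      have clC: "closure C \<subseteq> closure D" using CD by (rule closure_mono)
      have "compact (closure C)" using D(2) CD bounded_subset by auto
      moreover have "closure C \<noteq> {}" using C(2) closure_subset by blast
      ultimately obtain y where y: "y \<in> closure C" "\<And>p. p \<in> closure C \<Longrightarrow> v y \<le> v p"
        using continuous_attains_inf continuous_on_subset[OF v_cont clC] by metis
      have "v y \<le> v z" using y(2) C(2) closure_subset by blast
      then have vy: "v y < t" using z by (simp add: sublevel_def)
      \<comment> \<open>A minimum point in \<open>D\<close> would have a whole ball in the
        component, and \<open>no_min\<close> finds a smaller value in it.\<close>
      have "y \<notin> D"
      proof
        assume "y \<in> D"
        then have yN: "y \<in> ?N" using vy by (simp add: sublevel_def)
        then obtain e where e: "e > 0" "ball y e \<subseteq> ?N" using open_sublevel open_contains_ball by blast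
        have "ball y e \<inter> C \<noteq> {}"
        proof -
          have "y \<in> ball y e" using e(1) by simp
          then show ?thesis using y(1) open_Int_closure_eq_empty[OF open_ball, of y e C] by blast
        qed
        then have "ball y e \<subseteq> C" using grow[OF connected_ball e(2)] by blast
        then have yC: "ball y e \<subseteq> C" "y \<in> C" using e(1) by auto
        then have "y \<in> D - K" using True CD by blast
        then obtain p where "p \<in> D \<inter> ball y e" "v p < v y" using no_min e(1) by blast
        then show False using y(2)[of p] yC(1) closure_subset[of C] by fastforce
      qed
      then have y\<gamma>: "y \<in> \<gamma>" using y(1) clC closure_D by blast
      obtain W where W: "open W" "y \<in> W" "connected (W \<inter> D)" "w y \<in> W \<inter> D" "\<forall>t\<in>V. v y < t \<longrightarrow> W \<inter> D \<subseteq> sublevel t"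
        using w[OF y\<gamma>] by blast
      have "W \<inter> C \<noteq> {}" using y(1) W(1,2) open_Int_closure_eq_empty[of W C] by blast
      \<comment> \<open>All points of \<open>D\<close> near \<open>y\<close> belong to the
        component. Hence the nearby boundary points lie in its closure, where \<open>v y\<close> is
        minimal, and the marker of \<open>y\<close> lies in the component.\<close>
      then have WC: "W \<inter> D \<subseteq> C" using grow[OF W(3)] W(5) t vy CD by blast
      obtain e where e: "e > 0" "ball y e \<subseteq> W" using W(1,2) open_contains_ball by blast
      have "- v p \<le> - v y" if p: "p \<in> \<gamma> \<inter> ball y e" for p
      proof -
        have "p \<in> W \<inter> closure D" using p e(2) closure_D by blast
        then have "p \<in> closure (W \<inter> D)" using open_Int_closure_subset[OF W(1)] by blast
        then have "p \<in> closure C" using closure_mono[OF WC] by blast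
        then show ?thesis using y(2) by simp
      qed
      then have "y \<in> ?L" using y\<gamma> e(1) by (auto simp: local_max_points_def)
      then have "w y \<in> M" by (simp add: M_def)
      moreover have "w y \<in> C" using W(4) WC by blast
      ultimately show ?thesis using path by blast
    qed
  qed
  show ?thesis
    by (rule that[of M]) (use fin card main in \<open>auto simp: M_def\<close>)
qed

text \<open>Each saddle with \<open>n\<close> negative sectors merges \<open>n\<close> components, so at most \<open>card M - 1\<close> mergers are
  possible. The saddles are added in the order of their levels; \<open>Q\<close> contains representatives of
  the classes of markers which are connected at the current stage.\<close>

lemma sum_saddle_orders_le:
  assumes X: "finite X" "\<And>x. x \<in> X \<Longrightarrow> saddle x (ord x)"
  shows "(\<Sum>x\<in>X. ord x - 1) \<le> card (local_max_points \<gamma> (\<lambda>x. - v x))"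
proof -
  have XD: "x \<in> D - K" if "x \<in> X" for x using X(2)[OF that] by (simp add: saddle_def)
  obtain M where M: "finite M" "M \<noteq> {}" "card M \<le> card (local_max_points \<gamma> (\<lambda>x. - v x)) + 1"
    and mark: "\<And>t z. t \<in> v ` X \<Longrightarrow> z \<in> sublevel t \<Longrightarrow> \<exists>w\<in>M. path_component (sublevel t) z w"
    using markers[of "v ` X"] X(1) above_H XD by blast
  \<comment> \<open>Everything strictly below some saddle already added, together with these saddles
    themselves, through which the merged components are joined.\<close>
  define S where "S = (\<lambda>Y. {z \<in> D. \<exists>y\<in>Y. v z < v y} \<union> Y)"
  define P where "P = (\<lambda>Y. \<exists>Q\<subseteq>M. card Q + (\<Sum>x\<in>Y. ord x - 1) \<le> card M \<and> (\<forall>a\<in>M. \<exists>q\<in>Q. a = q \<or> path_component (S Y) a q))"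
  have "Y \<subseteq> X \<longrightarrow> P Y" if "finite Y" for Y
    using that
  proof (induction Y rule: finite_ranking_induct[where f = v])
    case empty
    show ?case unfolding P_def by (intro impI exI[of _ M]) auto
  next
    case (insert x Y)
    show ?case
    proof (intro impI)
      assume sub: "insert x Y \<subseteq> X"
      show "P (insert x Y)"
      proof (cases "x \<in> Y")
        case True
        then show ?thesis using insert sub by (simp add: insert_absorb)
      next
        case False
        obtain Q where Q: "Q \<subseteq> M" "card Q + (\<Sum>x\<in>Y. ord x - 1) \<le> card M" "\<And>a. a \<in> M \<Longrightarrow> \<exists>q\<in>Q. a = q \<or> path_component (S Y) a q"
          using insert.IH sub unfolding P_def by blast
        have finQ: "finite Q" using Q(1) M(1) finite_subset by blast
        \<comment> \<open>The stage just before \<open>x\<close> is inserted: all of the sublevel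
          set of \<open>x\<close> and the earlier saddles, possibly of the same level, but not
          \<open>x\<close>. The negative rays of \<open>x\<close> are still separated in it.\<close>
        define S1 where "S1 = sublevel (v x) \<union> Y"
        have S_sub: "S Y \<subseteq> S1" unfolding S_def S1_def sublevel_def using insert.hyps(2) by fastforce
        have S2: "S (insert x Y) = insert x S1"
          unfolding S_def S1_def sublevel_def using insert.hyps(2) by fastforce
        obtain T :: "complex \<Rightarrow> complex" and r where T: "linear T" "inj T" "0 < r" and n: "1 \<le> ord x"
          and rays: "\<And>j \<rho>. 0 < \<rho> \<Longrightarrow> \<rho> \<le> r \<Longrightarrow> x + T (\<rho> *\<^sub>R cis (real j * pi / real (ord x))) \<in> D \<and>
            (if even j then v x < v (x + T (\<rho> *\<^sub>R cis (real j * pi / real (ord x))))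
             else v (x + T (\<rho> *\<^sub>R cis (real j * pi / real (ord x)))) < v x)"
          using X(2)[of x] sub unfolding saddle_def by blast
        let ?n = "ord x"
        define R where "R = (\<lambda>i \<rho>. x + T (\<rho> *\<^sub>R cis (real (2 * i + 1) * pi / real ?n)))"
        have R_low: "R i \<rho> \<in> sublevel (v x)" if "0 < \<rho>" "\<rho> \<le> r" for i \<rho>
          using rays[OF that, of "2 * i + 1"] by (simp add: R_def sublevel_def)
        have sep: "\<not> path_component S1 (R i r) (R k r)" if "i < ?n" "k < ?n" "i < k" for i k
          unfolding R_def
        proof (rule negative_rays_separated[OF _ n T rays])
          show "x \<in> D - K" using XD sub by simp
          show "S1 \<subseteq> D" unfolding S1_def sublevel_def using XD sub by blast
          show "x \<notin> S1" unfolding S1_def sublevel_def using False by auto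
          show "v z \<le> v x" if "z \<in> S1" for z using that insert.hyps(2) by (auto simp: S1_def sublevel_def)
        qed (use that in auto)
        have "\<exists>q\<in>Q. path_component S1 (R i r) q" for i
        proof -
          obtain a where a: "a \<in> M" "path_component (sublevel (v x)) (R i r) a"
            using mark[of "v x" "R i r"] R_low[of r i] T(3) sub by auto
          then have a1: "path_component S1 (R i r) a"
            by (auto simp: S1_def intro: path_component_of_subset)
          obtain q where "q \<in> Q" "a = q \<or> path_component (S Y) a q" using Q(3)[OF a(1)] by blast
          then show ?thesis using a1 path_component_of_subset[OF S_sub] path_component_trans by blast
        qed
        then obtain q where q: "\<And>i. q i \<in> Q" "\<And>i. path_component S1 (R i r) (q i)" by metis
        have q_ne: "q i \<noteq> q k" if "i < ?n" "k < ?n" "i < k" for i k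
          using sep[OF that] q(2)[of i] q(2)[of k] path_component_sym path_component_trans by metis
        have q_inj: "inj_on q {..<?n}"
          by (rule inj_onI) (metis q_ne lessThan_iff linorder_neqE_nat)
        \<comment> \<open>The representatives of the \<open>n\<close> negative rays are distinct,
          and at \<open>x\<close> their classes become one; \<open>q 0\<close> is kept for it, so
          \<open>n - 1\<close> representatives are saved.\<close>
        define Q' where "Q' = Q - q ` {1..<?n}"
        have "q ` {1..<?n} \<subseteq> Q" using q(1) by blast
        moreover have "card (q ` {1..<?n}) = ?n - 1"
        proof -
          have "{1..<?n} \<subseteq> {..<?n}" by auto
          from card_image[OF inj_on_subset[OF q_inj this]] show ?thesis by simp
        qed
        ultimately have cardQ': "card Q' + (?n - 1) = card Q"
          unfolding Q'_def using card_Diff_subset[of "q ` {1..<?n}" Q] card_mono[OF finQ, of "q ` {1..<?n}"] by simp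
        have q0: "q 0 \<in> Q'" unfolding Q'_def using q(1) q_ne[of 0] n by fastforce
        have to_x: "path_component (insert x S1) (R i r) x" for i
        proof -
          have "closed_segment (R i r) x \<subseteq> insert x S1"
          proof
            fix y assume "y \<in> closed_segment (R i r) x"
            then obtain s where s: "0 \<le> s" "s \<le> 1" "y = (1 - s) *\<^sub>R x + s *\<^sub>R R i r"
              using closed_segment_commute[of x] by (auto simp: closed_segment_def)
            have "y = R i (s * r)"
              unfolding s(3) R_def by (simp add: algebra_simps linear_scale[OF T(1)] scaleR_left_commute flip: scaleR_scaleR)
            moreover have "R i 0 = x" unfolding R_def using linear_0[OF T(1)] by simp
            ultimately show "y \<in> insert x S1"
              using R_low[of "s * r" i] s T(3) by (cases "s = 0") (auto simp: S1_def mult_left_le_one_le)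
          qed
          then show ?thesis
            unfolding path_component_def by (intro exI[of _ "linepath (R i r) x"]) auto
        qed
        have up: "path_component (insert x S1) a b" if "path_component S1 a b" for a b
          using that by (rule path_component_of_subset[OF subset_insertI])
        have qx: "path_component (insert x S1) (q i) x" for i
          using up[OF q(2)[of i]] to_x[of i] path_component_sym path_component_trans by metis
        have reach: "\<exists>p\<in>Q'. a = p \<or> path_component (S (insert x Y)) a p" if a: "a \<in> M" for a
        proof -
          obtain p where p: "p \<in> Q" "a = p \<or> path_component (S Y) a p" using Q(3)[OF a] by blast
          then have p': "a = p \<or> path_component (insert x S1) a p"
            using path_component_of_subset[of "S Y" "insert x S1"] S_sub by blast
          show ?thesis
          proof (cases "p \<in> Q'")
            case True
            then show ?thesis using p' S2 by auto
          next
            case False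
            then obtain i where "p = q i" using p(1) by (auto simp: Q'_def)
            then have "path_component (insert x S1) p (q 0)"
              using qx[of i] qx[of 0] path_component_sym path_component_trans by metis
            then have "path_component (insert x S1) a (q 0)" using p' path_component_trans by metis
            then show ?thesis using q0 S2 by auto
          qed
        qed
        have "card Q' + (\<Sum>x\<in>insert x Y. ord x - 1) \<le> card M"
          using Q(2) cardQ' False insert.hyps(1) by simp
        then show ?thesis unfolding P_def using reach Q(1) Q'_def by (intro exI[of _ Q']) auto
      qed
    qed
  qed
  from this[OF X(1)] have "P X" by simp
  then obtain Q where Q: "Q \<subseteq> M" "card Q + (\<Sum>x\<in>X. ord x - 1) \<le> card M" "\<forall>a\<in>M. \<exists>q\<in>Q. a = q \<or> path_component (S X) a q"
    unfolding P_def by blast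
  \<comment> \<open>One representative always remains; it offsets the additional marker for
    \<open>K\<close>.\<close>
  have "Q \<noteq> {}" using Q(3) M(2) by blast
  then have "1 \<le> card Q" using Q(1) M(1) finite_subset card_0_eq by (metis One_nat_def Suc_leI card_gt_0_iff)
  then show ?thesis using Q(2) M(3) by linarith
qed

end

section \<open>The annular domain\<close>

context regular_closed_curve
begin

lemma Jordan:
  "open (inside (range c))" "open (outside (range c))" "connected (inside (range c))" "connected (outside (range c))"
  "frontier (inside (range c)) = range c" "frontier (outside (range c)) = range c" "bounded (inside (range c))"
  using Jordan_inside_outside[OF simple_loop] unfolding path_image_c by auto

lemma closure_inside: "closure (inside (range c)) = inside (range c) \<union> range c"
  using Jordan(5) closure_Un_frontier[of "inside (range c)"] by simp

lemma connected_complement_inside: "connected (- inside (range c))"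
proof -
  have "- inside (range c) = outside (range c) \<union> range c"
    using inside_Un_outside[of "range c"] inside_Int_outside[of "range c"] by blast
  also have "\<dots> = closure (outside (range c))"
    using Jordan(6) closure_Un_frontier[of "outside (range c)"] by simp
  finally show ?thesis using connected_imp_connected_closure[OF Jordan(4)] by simp
qed

text \<open>Of \<open>\<Omega>\<close> only the frontier is known, so the shape of the hole has to
  be derived. The principle is that a connected set which misses the frontier lies in
  \<open>\<Omega>\<close> or is disjoint from it.\<close>

lemma annulus_core:
  assumes \<Omega>: "open \<Omega>" "connected \<Omega>" and \<gamma>I: "closed \<gamma>I" "connected \<gamma>I" "\<gamma>I \<noteq> {}"
    and fr: "frontier \<Omega> = \<gamma>I \<union> range c" and sub: "\<gamma>I \<subseteq> inside (range c)"
  defines "D \<equiv> inside (range c)"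
  shows "\<Omega> \<subseteq> D" "closed (D - \<Omega>)" "connected (D - \<Omega>)" "\<gamma>I \<subseteq> D - \<Omega>"
proof -
  have D: "open D" "connected D" "closure D = D \<union> range c" "D \<inter> range c = {}"
    unfolding D_def using Jordan closure_inside inside_no_overlap by auto
  have \<Omega>fr: "\<Omega> \<inter> (\<gamma>I \<union> range c) = {}"
    using frontier_disjoint_eq[of \<Omega>] \<Omega>(1) fr by auto
  show \<gamma>IK: "\<gamma>I \<subseteq> D - \<Omega>" using sub \<Omega>fr unfolding D_def by blast
  have "\<Omega> \<inter> D \<noteq> {}"
  proof -
    obtain p where "p \<in> \<gamma>I" using \<gamma>I(3) by blast
    then have "p \<in> closure \<Omega>" "p \<in> D" using fr sub unfolding frontier_def D_def by blast+
    then show ?thesis using open_Int_closure_eq_empty[OF D(1), of \<Omega>] by blast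
  qed
  moreover have "\<Omega> \<subseteq> D \<union> outside (range c)"
    using \<Omega>fr inside_Un_outside[of "range c"] unfolding D_def by blast
  moreover have "D \<inter> outside (range c) = {}" unfolding D_def by (rule inside_Int_outside)
  ultimately show \<Omega>D: "\<Omega> \<subseteq> D"
    using connectedD[OF \<Omega>(2) D(1) Jordan(2)] by blast
  have all_or_none: "X \<subseteq> \<Omega> \<or> X \<inter> \<Omega> = {}" if "connected X" "X \<inter> (\<gamma>I \<union> range c) = {}" for X
    using connected_Int_frontier[OF that(1), of \<Omega>] that(2) fr by blast
  show "closed (D - \<Omega>)"
    unfolding closed_limpt
  proof (intro allI impI)
    fix p assume "p islimpt (D - \<Omega>)"
    then have p: "p \<in> closure (D - \<Omega>)" by (simp add: closure_def)
    then have "p \<in> closure D" using closure_mono[of "D - \<Omega>" D] by blast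
    moreover have "p \<notin> \<Omega>"
    proof
      assume "p \<in> \<Omega>"
      then have "\<Omega> \<inter> (D - \<Omega>) \<noteq> {}" using p open_Int_closure_eq_empty[OF \<Omega>(1), of "D - \<Omega>"] by blast
      then show False by blast
    qed
    moreover have "p \<notin> range c"
    proof
      assume pc: "p \<in> range c"
      then have "p \<in> - \<gamma>I" using sub D(4) unfolding D_def by blast
      moreover have "open (- \<gamma>I)" using \<gamma>I(1) by (rule open_Compl)
      ultimately obtain B W where BW: "open W" "p \<in> W" "B \<noteq> {}" "connected B" "B \<subseteq> D" "W \<inter> D = B" "W \<subseteq> - \<gamma>I"
        using inside_local_structure[OF pc] unfolding D_def by metis
      \<comment> \<open>Near the outer curve \<open>D\<close> is connected and free of frontier
        points. As \<open>\<Omega>\<close> accumulates there, it fills this part of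
        \<open>D\<close>, and the hole cannot reach the outer curve.\<close>
      have "B \<inter> (\<gamma>I \<union> range c) = {}" using BW(5,6,7) D(4) by blast
      then have "B \<subseteq> \<Omega> \<or> B \<inter> \<Omega> = {}" by (rule all_or_none[OF BW(4)])
      moreover have "p \<in> closure \<Omega>" using pc fr unfolding frontier_def by blast
      then have "W \<inter> \<Omega> \<noteq> {}" using BW(1,2) open_Int_closure_eq_empty[of W \<Omega>] by blast
      then have "B \<inter> \<Omega> \<noteq> {}" using \<Omega>D BW(6) by blast
      moreover have "W \<inter> (D - \<Omega>) \<noteq> {}" using BW(1,2) p open_Int_closure_eq_empty[of W "D - \<Omega>"] by blast
      then have "\<not> B \<subseteq> \<Omega>" using BW(6) by blast
      ultimately show False by blast
    qed
    ultimately show "p \<in> D - \<Omega>" using D(3) by blast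
  qed
  show "connected (D - \<Omega>)"
  proof -
    define F where "F = {C. connected C \<and> \<gamma>I \<subseteq> C \<and> C \<subseteq> D - \<Omega>}"
    have "\<exists>C\<in>F. z \<in> C" if z: "z \<in> D - \<Omega>" for z
    proof (cases "z \<in> \<gamma>I")
      case True
      then show ?thesis using \<gamma>IK \<gamma>I(2) by (auto simp: F_def)
    next
      case False
      let ?S = "- (\<gamma>I \<union> range c)"
      define Q where "Q = connected_component_set ?S z"
      have zS: "z \<in> ?S" using False z D(4) by blast
      have "compact (range c)" using compact_path_image[of c] simple_loop simple_path_imp_path path_image_c by auto
      then have S: "open ?S" using \<gamma>I(1) by (intro open_Compl closed_Un) (auto simp: compact_imp_closed)
      have Q: "open Q" "connected Q" "z \<in> Q" "Q \<subseteq> ?S"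
        unfolding Q_def using open_connected_component[OF S] zS by (simp, simp, simp, intro connected_component_subset)
      have Q\<Omega>: "Q \<inter> \<Omega> = {}" using all_or_none[OF Q(2)] Q(3,4) z by blast
      have "Q \<subseteq> D \<union> outside (range c)"
        using Q(4) inside_Un_outside[of "range c"] unfolding D_def by blast
      then have QD: "Q \<subseteq> D"
        using connectedD[OF Q(2) D(1) Jordan(2)] Q(3) z inside_Int_outside[of "range c"] unfolding D_def by blast
      have frQ: "frontier Q \<subseteq> \<gamma>I \<union> range c"
      proof -
        have "frontier Q \<subseteq> frontier ?S" unfolding Q_def by (rule frontier_of_connected_component_subset)
        also have "frontier ?S = frontier (\<gamma>I \<union> range c)" by (rule frontier_complement)
        also have "\<dots> \<subseteq> \<gamma>I \<union> range c"
          using S by (intro frontier_subset_closed) (simp only: closed_def)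
        finally show ?thesis .
      qed
      \<comment> \<open>Otherwise the frontier of \<open>Q\<close> would lie on the outer curve and
        \<open>Q\<close> would be all of the connected set \<open>D\<close>, although
        \<open>D\<close> contains \<open>\<gamma>I\<close>. So every piece of the hole is attached
        to \<open>\<gamma>I\<close>.\<close>
      have "closure Q \<inter> \<gamma>I \<noteq> {}"
      proof
        assume e: "closure Q \<inter> \<gamma>I = {}"
        have "D \<inter> Q \<noteq> {}" using Q(3) z by blast
        moreover have "D - Q \<noteq> {}" using \<gamma>IK \<gamma>I(3) Q(4) by blast
        ultimately have "D \<inter> frontier Q \<noteq> {}" by (rule connected_Int_frontier[OF D(2)])
        then show False using frQ D(4) e unfolding frontier_def by blast
      qed
      then obtain p where p: "p \<in> closure Q" "p \<in> \<gamma>I" by blast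
      have "connected (insert p Q)"
        by (rule connected_intermediate_closure[OF Q(2)]) (use p(1) closure_subset in auto)
      then have "connected (insert p Q \<union> \<gamma>I)" using \<gamma>I(2) p(2) by (intro connected_Un) auto
      then have "insert p Q \<union> \<gamma>I \<in> F" using QD Q\<Omega> \<gamma>IK p(2) by (auto simp: F_def)
      then show ?thesis using Q(3) by (intro bexI[of _ "insert p Q \<union> \<gamma>I"]) auto
    qed
    then have "\<Union>F = D - \<Omega>" by (auto simp: F_def)
    moreover have "connected (\<Union>F)"
      by (rule connected_Union) (use \<gamma>I(3) in \<open>auto simp: F_def\<close>)
    ultimately show ?thesis by simp
  qed
qed

end

section \<open>Critical points and extrema of a nonconstant solution\<close>

lemma grad_zero_deriv:
  fixes u :: "real^2 \<Rightarrow> real"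
  assumes "Ck_on 2 S u" "open S" "y \<in> S" "grad u y = 0"
  shows "(u has_derivative (\<lambda>_. 0)) (at y)"
proof -
  have "frechet_derivative u (at y) v = 0" for v
    using du_grad[OF assms(2,1,3), of v] assms(4) by simp
  then show ?thesis using Ck_on_2D(1)[OF assms(1,3)] by (metis ext)
qed

lemma grad_eq_0_of_deriv_0:
  assumes "(u has_derivative (\<lambda>_. 0)) (at y)" shows "grad u y = 0"
  using frechet_derivative_at[OF assms] by (simp add: grad_def partial_def vec_eq_iff fun_eq_iff flip: zero_vec_def) 

locale elliptic_solution =
  fixes S :: "(real^2) set" and a :: "2 \<Rightarrow> 2 \<Rightarrow> real^2 \<Rightarrow> real" and u :: "real^2 \<Rightarrow> real"
  assumes S: "open S" "connected S" and sol: "classical_solution a S u"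
    and a: "\<forall>i j. smooth_on UNIV (a i j)" and ell: "uniformly_elliptic_along a S u"
    and nonconst: "\<not> u constant_on closure S"
begin

lemma C2: "Ck_on 2 S u" using sol by (simp add: classical_solution_def)

text \<open>The interior of the set of critical points is open, and the normal form shows it to be
  relatively closed: a limit point is critical, but in the second case it would be an isolated
  critical point. By connectedness a flat point makes \<open>u\<close> constant, up to the closure
  by continuity.\<close>

lemma not_flat:
  assumes x: "x \<in> S" and r: "0 < r" and flat: "\<And>y. dist y x < r \<Longrightarrow> grad u y = 0"
  shows False
proof -
  define Z where "Z = {x \<in> S. \<exists>r>0. \<forall>y. dist y x < r \<longrightarrow> grad u y = 0}"
  have openZ: "open Z"
    unfolding open_contains_ball
  proof
    fix p assume "p \<in> Z"
    then obtain r where p: "p \<in> S" "0 < r" "\<forall>y. dist y p < r \<longrightarrow> grad u y = 0" by (auto simp: Z_def)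
    obtain e where e: "0 < e" "ball p e \<subseteq> S" using S(1) p(1) open_contains_ball by blast
    have "ball p (min e (r / 2)) \<subseteq> Z"
    proof
      fix q assume q: "q \<in> ball p (min e (r / 2))"
      have "grad u y = 0" if "dist y q < r / 2" for y
        using p(3) dist_triangle[of y p q] that q by (auto simp: dist_commute)
      then show "q \<in> Z" using q e p(2) by (auto simp: Z_def intro!: exI[of _ "r / 2"])
    qed
    then show "\<exists>e>0. ball p e \<subseteq> Z" using e(1) p(2) by (intro exI[of _ "min e (r / 2)"]) auto
  qed
  have grad_cont: "continuous_on S (grad u)"
    using continuous_on_vec_lambda[OF grad_continuous[OF S(1) C2], of "\<lambda>i. i"] by simp
  have closedZ: "p \<in> Z" if p: "p \<in> S" "p \<in> closure Z" for p
  proof -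
    have Zsub: "Z \<subseteq> {y \<in> S. grad u y = 0}" by (auto simp: Z_def)
    have "closedin (top_of_set S) {y \<in> S. grad u y = 0}"
      using continuous_closedin_preimage_constant[OF grad_cont, of 0] by simp
    then obtain T where T: "closed T" "{y \<in> S. grad u y = 0} = S \<inter> T" by (auto simp: closedin_closed)
    have "closure Z \<subseteq> T" using Zsub T by (intro closure_minimal) auto
    then have crit: "grad u p = 0" using p T(2) by blast
    show ?thesis
      using critical_point_normal_form[OF S(1) sol a ell p(1) crit]
    proof (elim disjE exE conjE)
      fix r :: real assume "0 < r" "\<forall>x. dist x p < r \<longrightarrow> grad u x = 0"
      then show ?thesis using p(1) by (auto simp: Z_def)
    next
      fix n :: nat and T :: "complex \<Rightarrow> real^2"
      assume n: "2 \<le> n" and T: "linear T" "bij T"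
        and nf: "\<forall>e>0. \<exists>r>0. \<forall>z. norm z < r \<longrightarrow>
           p + T z \<in> S \<and> \<bar>u (p + T z) - u p - Re (z ^ n)\<bar> \<le> e * norm z ^ n \<and>
           (\<exists>f. ((\<lambda>w. u (p + T w)) has_derivative (\<lambda>h. Re (f * h))) (at z) \<and>
              (grad u (p + T z) = 0 \<longrightarrow> f = 0) \<and> norm (f - of_nat n * z ^ (n - 1)) \<le> e * norm z ^ (n - 1))"
      let ?P = "\<lambda>z. p + T z \<in> S \<and> \<bar>u (p + T z) - u p - Re (z ^ n)\<bar> \<le> 1 * norm z ^ n \<and>
           (\<exists>f. ((\<lambda>w. u (p + T w)) has_derivative (\<lambda>h. Re (f * h))) (at z) \<and>
              (grad u (p + T z) = 0 \<longrightarrow> f = 0) \<and> norm (f - of_nat n * z ^ (n - 1)) \<le> 1 * norm z ^ (n - 1))"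
      from nf[rule_format, OF zero_less_one] obtain r where r1: "0 < r" "\<forall>z. norm z < r \<longrightarrow> ?P z" by (elim exE conjE)
      then have r: "0 < r" "\<And>z. norm z < r \<Longrightarrow> \<exists>f. (grad u (p + T z) = 0 \<longrightarrow> f = 0) \<and> norm (f - of_nat n * z ^ (n - 1)) \<le> 1 * norm z ^ (n - 1)"
        by blast+
      \<comment> \<open>With the error factor 1, a zero of the gradient would give
        \<open>n * norm z ^ (n - 1) \<le> norm z ^ (n - 1)\<close>, which is impossible for
        \<open>n \<ge> 2\<close>.\<close>
      have nz: "grad u (p + T z) \<noteq> 0" if z: "norm z < r" "z \<noteq> 0" for z
      proof
        assume "grad u (p + T z) = 0"
        then have "norm (of_nat n * z ^ (n - 1)) \<le> 1 * norm z ^ (n - 1)" using r(2)[OF z(1)] by auto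
        then have "real n * norm z ^ (n - 1) \<le> 1 * norm z ^ (n - 1)" by (simp add: norm_mult norm_power)
        then have "real n \<le> 1" by (rule mult_right_le_imp_le) (use z in simp)
        then show False using n by simp
      qed
      have "open ((\<lambda>z. p + T z) ` ball 0 r)"
      proof -
        have "open (T ` ball 0 r)" using T by (intro open_surjective_linear_image) (auto simp: bij_is_surj)
        from open_translation[OF this, of p] show ?thesis by (simp add: image_image)
      qed
      moreover have "p \<in> (\<lambda>z. p + T z) ` ball 0 r" using r(1) linear_0[OF T(1)] by (intro image_eqI[of _ _ 0]) auto
      ultimately have "(\<lambda>z. p + T z) ` ball 0 r \<inter> Z \<noteq> {}"
        using p(2) open_Int_closure_eq_empty by blast
      then obtain z where z: "norm z < r" "p + T z \<in> Z" by auto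
      show ?thesis
      proof (cases "z = 0")
        case True
        then show ?thesis using z(2) linear_0[OF T(1)] by simp
      next
        case False
        have "grad u (p + T z) = 0" using z(2) by (auto simp: Z_def)
        then show ?thesis using nz[OF z(1) False] by simp
      qed
    qed
  qed
  have "x \<in> Z" using x r flat by (auto simp: Z_def)
  moreover have "Z \<subseteq> S" by (auto simp: Z_def)
  moreover have "closedin (top_of_set S) Z"
    using closedZ \<open>Z \<subseteq> S\<close> closure_subset[of Z] closed_closure[of Z] unfolding closedin_closed
    by (intro exI[of _ "closure Z"]) auto
  moreover have "openin (top_of_set S) Z" using openZ \<open>Z \<subseteq> S\<close> by (simp add: open_openin_trans openin_open_eq S(1))
  ultimately have "Z = S" using S(2) connected_clopen[of S] by blast
  then have "(u has_derivative (\<lambda>_. 0)) (at y)" if "y \<in> S" for y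
    using grad_zero_deriv[OF C2 S(1) that] that by (force simp: Z_def)
  then have c: "u y = u x" if "y \<in> S" for y
    using has_derivative_zero_unique_connected[OF S, of u y x] that x by blast
  have "u y = u x" if "y \<in> closure S" for y
    using continuous_constant_on_closure[of S u "u x" y] sol c that by (auto simp: classical_solution_def)
  then show False using nonconst unfolding constant_on_def by blast
qed

text \<open>On the rays with angles \<open>j * pi / n\<close> the leading term is
  \<open>\<rho> ^ n\<close> in modulus, so the error factor 1/2 cannot change its sign.\<close>

lemma saddle_normal_form:
  assumes x: "x \<in> S" and crit: "grad u x = 0"
  obtains n T r where "2 \<le> n" "linear T" "bij (T :: complex \<Rightarrow> real^2)" "0 < r"
    "is_multiplicity S u x (n - 1)"
    "\<And>j \<rho>. 0 < \<rho> \<Longrightarrow> \<rho> \<le> r \<Longrightarrow> x + T (\<rho> *\<^sub>R cis (real j * pi / real n)) \<in> S \<and>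
       (if even j then u x < u (x + T (\<rho> *\<^sub>R cis (real j * pi / real n)))
        else u (x + T (\<rho> *\<^sub>R cis (real j * pi / real n))) < u x)"
proof -
  consider r where "0 < r" "\<forall>y. dist y x < r \<longrightarrow> grad u y = 0"
    | n T where "2 \<le> n" "linear T" "bij (T :: complex \<Rightarrow> real^2)"
      "\<forall>e>0. \<exists>r>0. \<forall>z. norm z < r \<longrightarrow>
           x + T z \<in> S \<and> \<bar>u (x + T z) - u x - Re (z ^ n)\<bar> \<le> e * norm z ^ n \<and>
           (\<exists>f. ((\<lambda>w. u (x + T w)) has_derivative (\<lambda>h. Re (f * h))) (at z) \<and>
              (grad u (x + T z) = 0 \<longrightarrow> f = 0) \<and> norm (f - of_nat n * z ^ (n - 1)) \<le> e * norm z ^ (n - 1))"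
    using critical_point_normal_form[OF S(1) sol a ell x crit] by blast
  then show ?thesis
  proof cases
    case 1
    then show ?thesis using not_flat[OF x] by blast
  next
    case (2 n T)
    let ?P = "\<lambda>z. x + T z \<in> S \<and> \<bar>u (x + T z) - u x - Re (z ^ n)\<bar> \<le> 1/2 * norm z ^ n \<and>
           (\<exists>f. ((\<lambda>w. u (x + T w)) has_derivative (\<lambda>h. Re (f * h))) (at z) \<and>
              (grad u (x + T z) = 0 \<longrightarrow> f = 0) \<and> norm (f - of_nat n * z ^ (n - 1)) \<le> 1/2 * norm z ^ (n - 1))"
    have "(0::real) < 1/2" by simp
    from 2(4)[rule_format, OF this] obtain r0 where r1: "0 < r0" "\<forall>z. norm z < r0 \<longrightarrow> ?P z" by (elim exE conjE)
    then have r0: "0 < r0" and nf: "\<And>z. norm z < r0 \<Longrightarrow>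
           x + T z \<in> S \<and> \<bar>u (x + T z) - u x - Re (z ^ n)\<bar> \<le> 1/2 * norm z ^ n \<and>
           (\<exists>f. ((\<lambda>w. u (x + T w)) has_derivative (\<lambda>h. Re (f * h))) (at z) \<and>
              norm (f - of_nat n * z ^ (n - 1)) \<le> 1/2 * norm z ^ (n - 1))"
      by blast+
    define r where "r = r0 / 2"
    have rr: "0 < r" "r < r0" using r0 by (auto simp: r_def)
    have "\<exists>f. \<forall>z. norm z < r0 \<longrightarrow> ((\<lambda>w. u (x + T w)) has_derivative (\<lambda>h. Re (f z * h))) (at z) \<and>
              norm (f z - of_nat n * z ^ (n - 1)) \<le> 1/2 * norm z ^ (n - 1)"
      by (intro choice allI) (use nf in blast)
    then obtain f where f: "\<And>z. norm z < r0 \<Longrightarrow> ((\<lambda>w. u (x + T w)) has_derivative (\<lambda>h. Re (f z * h))) (at z)"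
      "\<And>z. norm z < r0 \<Longrightarrow> norm (f z - of_nat n * z ^ (n - 1)) \<le> 1/2 * norm z ^ (n - 1)" by blast
    interpret saddle_form "\<lambda>z. u (x + T z) - u x" f n r
    proof
      fix z :: complex assume z: "norm z \<le> r"
      show "((\<lambda>z. u (x + T z) - u x) has_derivative (\<lambda>h. Re (f z * h))) (at z)"
        by (rule has_derivative_eq_rhs[OF has_derivative_diff[OF f(1) has_derivative_const]]) (use z rr in auto)
    qed (use 2 rr f nf in auto)
    have "is_multiplicity S u x (n - 1)"
    proof (rule saddle_multiplicity[OF 2(1,2,3) refl])
      fix z :: complex assume "norm z \<le> r"
      then have "norm z < r0" using rr(2) by linarith
      then show "x + T z \<in> S" using nf by blast
    qed
    moreover have "x + T (\<rho> *\<^sub>R cis (real j * pi / real n)) \<in> S \<and>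
       (if even j then u x < u (x + T (\<rho> *\<^sub>R cis (real j * pi / real n)))
        else u (x + T (\<rho> *\<^sub>R cis (real j * pi / real n))) < u x)" if \<rho>: "0 < \<rho>" "\<rho> \<le> r" for j \<rho>
    proof -
      have "cos (real n * (real j * pi / real n)) = (-1) ^ j" using 2(1) by simp
      then have "\<bar>u (x + T (\<rho> *\<^sub>R cis (real j * pi / real n))) - u x - \<rho> ^ n * (-1) ^ j\<bar> \<le> 1/2 * \<rho> ^ n"
        using U_polar[of \<rho> "real j * pi / real n"] \<rho> by (simp only: scaleR_conv_of_real)
      moreover have "0 < \<rho> ^ n" using \<rho> by simp
      moreover have "norm (\<rho> *\<^sub>R cis (real j * pi / real n)) < r0" using \<rho> rr by simp
      ultimately show ?thesis using nf by (cases "even j") (auto simp: abs_if split: if_splits)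
    qed
    ultimately show ?thesis using that 2(1,2,3) rr(1) by blast
  qed
qed

text \<open>The strong maximum principle, obtained from the normal form: at a critical point both
  signs occur on rays arbitrarily close to it, and elsewhere the derivative does not vanish.\<close>

lemma no_local_extremum:
  assumes x: "x \<in> S" and e: "0 < e"
  shows "\<exists>y\<in>S \<inter> ball x e. u x < u y" "\<exists>y\<in>S \<inter> ball x e. u y < u x"
proof -
  have op: "open (S \<inter> ball x e)" "x \<in> S \<inter> ball x e" using S(1) x e by auto
  have "(\<exists>y\<in>S \<inter> ball x e. u x < u y) \<and> (\<exists>y\<in>S \<inter> ball x e. u y < u x)"
  proof (cases "grad u x = 0")
    case False
    have no: "\<not> ((\<forall>y\<in>S \<inter> ball x e. u y \<le> u x) \<or> (\<forall>y\<in>S \<inter> ball x e. u x \<le> u y))"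
    proof
      assume "(\<forall>y\<in>S \<inter> ball x e. u y \<le> u x) \<or> (\<forall>y\<in>S \<inter> ball x e. u x \<le> u y)"
      from differential_zero_maxmin[OF op(2,1) Ck_on_2D(1)[OF C2 x] this]
      have "(u has_derivative (\<lambda>_. 0)) (at x)" using Ck_on_2D(1)[OF C2 x] by simp
      then show False using False grad_eq_0_of_deriv_0 by blast
    qed
    then show ?thesis by (auto simp: not_le)
  next
    case True
    obtain n T r where nf: "linear T" "bij (T :: complex \<Rightarrow> real^2)" "0 < r"
      "\<And>j \<rho>. 0 < \<rho> \<Longrightarrow> \<rho> \<le> r \<Longrightarrow> x + T (\<rho> *\<^sub>R cis (real j * pi / real n)) \<in> S \<and>
       (if even j then u x < u (x + T (\<rho> *\<^sub>R cis (real j * pi / real n)))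
        else u (x + T (\<rho> *\<^sub>R cis (real j * pi / real n))) < u x)"
      by (rule saddle_normal_form[OF x True]) blast
    obtain Kt where Kt: "0 < Kt" "\<And>z. norm (T z) \<le> norm z * Kt"
      using bounded_linear.pos_bounded[of T] nf(1) by (auto simp: linear_conv_bounded_linear)
    define \<rho> where "\<rho> = min r (e / (2 * Kt))"
    have \<rho>: "0 < \<rho>" "\<rho> \<le> r" using nf(3) e Kt(1) by (auto simp: \<rho>_def)
    have "\<rho> * Kt \<le> e / 2" using Kt(1) by (simp add: \<rho>_def min_def field_simps)
    then have "dist x (x + T (\<rho> *\<^sub>R cis \<phi>)) < e" for \<phi>
      using Kt(2)[of "\<rho> *\<^sub>R cis \<phi>"] \<rho>(1) e by (simp add: dist_norm)
    then have "x + T (\<rho> *\<^sub>R cis (real j * pi / real n)) \<in> S \<inter> ball x e" for j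
      using nf(4)[OF \<rho>, of j] by simp
    moreover have "u x < u (x + T (\<rho> *\<^sub>R cis (real 0 * pi / real n)))" "u (x + T (\<rho> *\<^sub>R cis (real 1 * pi / real n))) < u x"
      using nf(4)[OF \<rho>, of 0] nf(4)[OF \<rho>, of 1] by simp_all
    ultimately show ?thesis by blast
  qed
  then show "\<exists>y\<in>S \<inter> ball x e. u x < u y" "\<exists>y\<in>S \<inter> ball x e. u y < u x" by auto
qed

end

section \<open>The bound\<close>

definition of_plane :: "real^2 \<Rightarrow> complex" where "of_plane w = Complex (w $ 1) (w $ 2)"

definition to_plane :: "complex \<Rightarrow> real^2" where "to_plane z = vector [Re z, Im z]"

lemma to_of_plane [simp]: "to_plane (of_plane w) = w" "of_plane (to_plane z) = z"
  by (auto simp: to_plane_def of_plane_def vec_eq_iff forall_2 complex_eq_iff)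

lemma linear_plane: "linear of_plane" "linear to_plane"
  by (auto simp: linear_iff of_plane_def to_plane_def complex_eq_iff vec_eq_iff forall_2)

lemma bounded_linear_plane: "bounded_linear of_plane" "bounded_linear to_plane"
  using linear_plane by (auto simp: linear_conv_bounded_linear)

lemma continuous_on_plane [continuous_intros]:
  "continuous_on S f \<Longrightarrow> continuous_on S (\<lambda>x. of_plane (f x))"
  "continuous_on S g \<Longrightarrow> continuous_on S (\<lambda>x. to_plane (g x))"
  using bounded_linear.continuous_on[OF bounded_linear_plane(1)] bounded_linear.continuous_on[OF bounded_linear_plane(2)] by auto

lemma bij_of_plane: "bij of_plane" "inj of_plane" "surj of_plane"
proof -
  show "bij of_plane" by (rule o_bij[of to_plane]) (auto simp: fun_eq_iff)
  then show "inj of_plane" "surj of_plane" by (auto simp: bij_def)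
qed

lemma dist_of_plane: "dist (of_plane x) (of_plane y) = dist x y"
  by (simp add: dist_norm of_plane_def norm_vec_def L2_set_def sum_2 cmod_def)

lemma of_plane_mem: "of_plane x \<in> of_plane ` S \<longleftrightarrow> x \<in> S"
  using bij_of_plane(2) by (rule inj_image_mem_iff)

lemma mem_of_plane_image: "z \<in> of_plane ` S \<longleftrightarrow> to_plane z \<in> S"
  using of_plane_mem[of "to_plane z" S] by simp

lemma closure_of_plane: "closure (of_plane ` S) = of_plane ` closure S"
  using closure_injective_linear_image[OF linear_plane(1) bij_of_plane(2)] by simp

lemma open_of_plane: "open S \<Longrightarrow> open (of_plane ` S)"
  by (rule open_surjective_linear_image[OF _ linear_plane(1) bij_of_plane(3)])

lemma frontier_of_plane: "open S \<Longrightarrow> frontier (of_plane ` S) = of_plane ` frontier S"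
  unfolding frontier_def closure_of_plane
  by (simp add: interior_open open_of_plane image_set_diff[OF bij_of_plane(2)])

lemma inside_of_plane: "of_plane ` inside S \<subseteq> inside (of_plane ` S)"
proof
  fix z assume "z \<in> of_plane ` inside S"
  then obtain x where x: "x \<in> inside S" "z = of_plane x" by blast
  let ?X = "connected_component_set (- of_plane ` S) z"
  have "z \<notin> of_plane ` S" using x by (auto simp: of_plane_mem inside_def)
  have "to_plane ` ?X \<subseteq> connected_component_set (- S) x"
  proof (rule connected_component_maximal)
    show "x \<in> to_plane ` ?X" using \<open>z \<notin> of_plane ` S\<close> x(2) by (intro image_eqI[of _ _ z]) auto
    show "connected (to_plane ` ?X)" by (intro connected_continuous_image continuous_intros) simp
    show "to_plane ` ?X \<subseteq> - S" using connected_component_subset[of "- of_plane ` S" z] by (auto simp: mem_of_plane_image)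
  qed
  then have "bounded (to_plane ` ?X)" using x(1) bounded_subset by (auto simp: inside_def)
  then have "bounded (of_plane ` (to_plane ` ?X))" by (rule bounded_linear_image[OF _ bounded_linear_plane(1)])
  then have "bounded ?X" by (simp add: image_image)
  then show "z \<in> inside (of_plane ` S)" using \<open>z \<notin> of_plane ` S\<close> by (simp add: inside_def)
qed

lemma local_max_points_of_plane:
  "local_max_points (of_plane ` S) f = of_plane ` local_max_points S (\<lambda>x. f (of_plane x))"
proof -
  have "(\<forall>y\<in>of_plane ` S \<inter> ball (of_plane p) e. f y \<le> f (of_plane p)) \<longleftrightarrow> (\<forall>y\<in>S \<inter> ball p e. f (of_plane y) \<le> f (of_plane p))" for p e
    by (auto simp: dist_of_plane)
  then show ?thesis by (auto simp: local_max_points_def of_plane_mem)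
qed

lemma regular_closed_curve_of_smooth:
  assumes "smooth_simple_closed_curve \<gamma>"
  obtains c c' where "regular_closed_curve c c'" "range c = of_plane ` \<gamma>"
proof -
  obtain g where g: "smooth_on UNIV g" "\<And>t. g (t + 1) = g t" "\<And>t. vector_derivative g (at t) \<noteq> 0"
    "simple_path g" "path_image g = \<gamma>"
    using assms unfolding smooth_simple_closed_curve_def by blast
  have "Ck_on (Suc 0) UNIV g" using g(1) by (simp only: smooth_on_def)
  then have d: "\<And>t. g differentiable (at t)" and cd: "continuous_on UNIV (\<lambda>t. frechet_derivative g (at t) 1)" by auto
  have fd: "frechet_derivative g (at t) 1 = vector_derivative g (at t)" for t
    using d[of t] frechet_derivative_works[of g "at t"] vector_derivative_works[of g "at t"]
    by (metis frechet_derivative_at has_vector_derivative_def scaleR_one)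
  define c where "c = (\<lambda>t. of_plane (g t))"
  define c' where "c' = (\<lambda>t. of_plane (vector_derivative g (at t)))"
  have cont_g: "continuous_on UNIV g"
    using d by (intro differentiable_imp_continuous_on) (simp add: differentiable_on_def)
  interpret regular_closed_curve c c'
  proof
    show "continuous_on UNIV c" unfolding c_def by (intro continuous_intros cont_g)
    show "c (t + 1) = c t" for t by (simp add: c_def g(2))
    show "inj_on c {0..<1}"
    proof (rule inj_onI)
      fix x y assume "x \<in> {0..<1}" "y \<in> {0..<1}" "c x = c y"
      moreover from this have "g x = g y" using bij_of_plane(2) by (auto simp: c_def dest: injD)
      ultimately show "x = y" using g(4) unfolding simple_path_def loop_free_def
        by (metis atLeastAtMost_iff atLeastLessThan_iff less_irrefl less_imp_le)
    qed
    show "(c has_vector_derivative c' t) (at t)" for t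
      unfolding c_def c'_def
      using bounded_linear.has_vector_derivative[OF bounded_linear_plane(1)] d[of t] vector_derivative_works by blast
    show "continuous_on UNIV c'" unfolding c'_def using cd by (intro continuous_intros) (simp add: fd)
    show "c' t \<noteq> 0" for t using g(3)[of t] linear_injective_0[OF linear_plane(1)] bij_of_plane(2) by (auto simp: c'_def)
  qed
  have "range c = path_image c" by (simp add: path_image_c)
  also have "\<dots> = of_plane ` \<gamma>" unfolding g(5)[symmetric] by (simp add: c_def path_image_def image_image)
  finally show ?thesis using that regular_closed_curve_axioms by blast
qed

text \<open>The bound refers to arbitrary finite sets of critical points, because finiteness of all
  of them is only deduced from it.\<close>

lemma sum_multiplicities_le:
  fixes \<Omega> \<gamma>I \<gamma>E :: "(real^2) set" and \<psi> u :: "real^2 \<Rightarrow> real"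
  assumes dom: "smooth_annular_domain \<Omega> \<gamma>I \<gamma>E"
    and a: "\<forall>i j. smooth_on UNIV (a i j)" and ell: "uniformly_elliptic_along a \<Omega> u"
    and \<psi>H: "\<forall>x\<in>\<gamma>E. \<psi> x \<ge> H" and fin: "finite (local_max_points \<gamma>E \<psi>)"
    and sol: "classical_solution a \<Omega> u" and uI: "\<forall>x\<in>\<gamma>I. u x = H" and uE: "\<forall>x\<in>\<gamma>E. u x = \<psi> x"
    and nonconst: "\<not> u constant_on closure \<Omega>"
  shows "\<And>x. x \<in> critical_points \<Omega> u \<Longrightarrow> \<exists>m\<ge>1. is_multiplicity \<Omega> u x m"
    and "\<And>X. finite X \<Longrightarrow> X \<subseteq> critical_points \<Omega> u \<Longrightarrow> (\<Sum>x\<in>X. multiplicity_at \<Omega> u x) \<le> card (local_max_points \<gamma>E \<psi>)"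
proof -
  have \<Omega>: "open \<Omega>" "connected \<Omega>" "\<Omega> \<noteq> {}" and cI: "smooth_simple_closed_curve \<gamma>I" and cE: "smooth_simple_closed_curve \<gamma>E"
    and IE: "\<gamma>I \<subseteq> inside \<gamma>E" and fr: "frontier \<Omega> = \<gamma>I \<union> \<gamma>E"
    using dom unfolding smooth_annular_domain_def by auto
  interpret E: elliptic_solution \<Omega> a u
    by unfold_locales (use \<Omega> sol a ell nonconst in auto)
  have "\<exists>n\<ge>2. \<exists>T r. linear T \<and> bij (T :: complex \<Rightarrow> real^2) \<and> 0 < r \<and> is_multiplicity \<Omega> u x (n - 1) \<and>
    (\<forall>j \<rho>. 0 < \<rho> \<longrightarrow> \<rho> \<le> r \<longrightarrow> x + T (\<rho> *\<^sub>R cis (real j * pi / real n)) \<in> \<Omega> \<and>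
       (if even j then u x < u (x + T (\<rho> *\<^sub>R cis (real j * pi / real n)))
        else u (x + T (\<rho> *\<^sub>R cis (real j * pi / real n))) < u x))"
    if "x \<in> critical_points \<Omega> u" for x
  proof -
    have "x \<in> \<Omega>" "grad u x = 0" using that by (auto simp: critical_points_def)
    then show ?thesis by (rule E.saddle_normal_form) blast
  qed
  then have "\<exists>n. \<forall>x\<in>critical_points \<Omega> u. n x \<ge> 2 \<and> (\<exists>T r. linear T \<and> bij (T :: complex \<Rightarrow> real^2) \<and> 0 < r \<and> is_multiplicity \<Omega> u x (n x - 1) \<and>
    (\<forall>j \<rho>. 0 < \<rho> \<longrightarrow> \<rho> \<le> r \<longrightarrow> x + T (\<rho> *\<^sub>R cis (real j * pi / real (n x))) \<in> \<Omega> \<and>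
       (if even j then u x < u (x + T (\<rho> *\<^sub>R cis (real j * pi / real (n x))))
        else u (x + T (\<rho> *\<^sub>R cis (real j * pi / real (n x)))) < u x)))"
    by (intro bchoice ballI)
  then obtain n where n: "\<And>x. x \<in> critical_points \<Omega> u \<Longrightarrow> n x \<ge> 2"
    and nT: "\<And>x. x \<in> critical_points \<Omega> u \<Longrightarrow> \<exists>T r. linear T \<and> bij (T :: complex \<Rightarrow> real^2) \<and> 0 < r \<and> is_multiplicity \<Omega> u x (n x - 1) \<and>
    (\<forall>j \<rho>. 0 < \<rho> \<longrightarrow> \<rho> \<le> r \<longrightarrow> x + T (\<rho> *\<^sub>R cis (real j * pi / real (n x))) \<in> \<Omega> \<and>
       (if even j then u x < u (x + T (\<rho> *\<^sub>R cis (real j * pi / real (n x))))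
        else u (x + T (\<rho> *\<^sub>R cis (real j * pi / real (n x)))) < u x))" by blast
  have mult: "is_multiplicity \<Omega> u x (n x - 1)" if "x \<in> critical_points \<Omega> u" for x using nT[OF that] by blast
  show "\<exists>m\<ge>1. is_multiplicity \<Omega> u x m" if "x \<in> critical_points \<Omega> u" for x
    using mult[OF that] n[OF that] by (intro exI[of _ "n x - 1"]) simp
  have mult_at: "multiplicity_at \<Omega> u x = n x - 1" if "x \<in> critical_points \<Omega> u" for x
    unfolding multiplicity_at_def using mult[OF that] is_multiplicity_unique by (intro the_equality) blast+
  obtain c c' where cc: "regular_closed_curve c c'" "range c = of_plane ` \<gamma>E"
    by (rule regular_closed_curve_of_smooth[OF cE])
  obtain d d' where dd: "regular_closed_curve d d'" "range d = of_plane ` \<gamma>I"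
    by (rule regular_closed_curve_of_smooth[OF cI])
  interpret C: regular_closed_curve c c' by (rule cc(1))
  interpret I: regular_closed_curve d d' by (rule dd(1))
  define \<Omega>' where "\<Omega>' = of_plane ` \<Omega>"
  define D where "D = inside (range c)"
  define K where "K = D - \<Omega>'"
  have \<Omega>'op: "open \<Omega>'" unfolding \<Omega>'_def by (rule open_of_plane[OF \<Omega>(1)])
  have \<Omega>'con: "connected \<Omega>'" unfolding \<Omega>'_def by (intro connected_continuous_image continuous_intros \<Omega>(2))
  have fr': "frontier \<Omega>' = range d \<union> range c"
    unfolding \<Omega>'_def frontier_of_plane[OF \<Omega>(1)] fr by (simp add: image_Un cc(2) dd(2))
  have sub: "range d \<subseteq> inside (range c)"
    using IE inside_of_plane[of \<gamma>E] unfolding cc(2) dd(2) by blast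
  have "compact (range d)"
    using compact_path_image[of d] I.simple_loop simple_path_imp_path I.path_image_c by auto
  then have dI: "closed (range d)" "connected (range d)"
    using connected_continuous_image[OF I.c_cont connected_UNIV] by (auto simp: compact_imp_closed)
  note core = C.annulus_core[OF \<Omega>'op \<Omega>'con dI _ fr' sub, folded D_def K_def]
  have \<Omega>'D: "\<Omega>' \<subseteq> D" and Kc: "closed K" "connected K" and dK: "range d \<subseteq> K" using core by auto
  have DJ: "open D" "bounded D" "connected (- D)" "closure D = D \<union> range c" "D \<inter> range c = {}"
    unfolding D_def
    by (intro C.Jordan C.closure_inside C.connected_complement_inside inside_no_overlap)+
  have cl\<Omega>': "closure \<Omega>' = \<Omega>' \<union> range d \<union> range c"
    using closure_Un_frontier[of \<Omega>'] fr' by auto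
  have DK: "D = \<Omega>' \<union> K" "\<Omega>' \<inter> K = {}" "D - K = \<Omega>'" using \<Omega>'D by (auto simp: K_def)
  \<comment> \<open>On the inner curve both descriptions agree, since \<open>u\<close> equals
    \<open>H\<close> there; this makes \<open>v\<close> continuous across it.\<close>
  define v where "v = (\<lambda>z. if z \<in> closure \<Omega>' then u (to_plane z) else H)"
  have v\<Omega>: "v z = u (to_plane z)" if "z \<in> closure \<Omega>'" for z using that by (simp add: v_def)
  have v\<Omega>1: "v (of_plane x) = u x" if "x \<in> \<Omega>" for x
  proof -
    have "of_plane x \<in> \<Omega>'" unfolding \<Omega>'_def using that by (rule imageI)
    then have "of_plane x \<in> closure \<Omega>'" using closure_subset by (rule rev_subsetD)
    then show ?thesis using v\<Omega> by simp
  qed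
  have ud: "u (to_plane z) = H" if "z \<in> range d" for z
    using that uI unfolding dd(2) by auto
  \<comment> \<open>A point of \<open>K\<close> in the closure of \<open>\<Omega>'\<close> can only
    lie on the inner curve.\<close>
  have vK: "v z = H" if z: "z \<in> K" for z
  proof (cases "z \<in> closure \<Omega>'")
    case True
    then have "z \<in> range d" using z DK(2) DJ(5) unfolding cl\<Omega>' K_def by blast
    then show ?thesis using v\<Omega>[OF True] ud by simp
  qed (simp add: v_def)
  have v\<gamma>: "v (of_plane x) = \<psi> x" if "x \<in> \<gamma>E" for x
  proof -
    have "of_plane x \<in> closure \<Omega>'" using that unfolding cl\<Omega>' cc(2) by simp
    then show ?thesis using v\<Omega> uE that by simp
  qed
  have v_cont: "continuous_on (closure D) v"
  proof -
    have "continuous_on (closure \<Omega>') (\<lambda>z. u (to_plane z))"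
    proof (rule continuous_on_compose2[of "closure \<Omega>" u])
      show "continuous_on (closure \<Omega>) u" using sol by (simp add: classical_solution_def)
      show "to_plane ` closure \<Omega>' \<subseteq> closure \<Omega>" unfolding \<Omega>'_def closure_of_plane by auto
    qed (intro continuous_intros)
    then have 1: "continuous_on (closure \<Omega>') v" using v\<Omega> by (simp cong: continuous_on_cong)
    have 2: "continuous_on K v" using vK by (simp cong: continuous_on_cong)
    have "closure D = closure \<Omega>' \<union> K" using DJ(4) DK(1) dK unfolding cl\<Omega>' by blast
    then show ?thesis using continuous_on_closed_Un[OF closed_closure Kc(1) 1 2] by simp
  qed
  have rngd: "range d \<noteq> {}" by simp
  have lmax: "local_max_points (range c) v = of_plane ` local_max_points \<gamma>E \<psi>"
  proof -
    have "local_max_points \<gamma>E (\<lambda>x. v (of_plane x)) = local_max_points \<gamma>E \<psi>"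
      unfolding local_max_points_def using v\<gamma> by auto
    then show ?thesis unfolding cc(2) local_max_points_of_plane by simp
  qed
  have finv: "finite (local_max_points (range c) v)" using fin lmax by simp
  have "continuous_on (range c) v" using v_cont DJ(4) continuous_on_subset by blast
  note minima = C.card_local_minima_le[OF this finv]
  have ext: "\<exists>y\<in>D \<inter> ball p e. v p < v y" "\<exists>y\<in>D \<inter> ball p e. v y < v p" if p: "p \<in> D - K" and e: "0 < e" for p e
  proof -
    obtain x where x: "x \<in> \<Omega>" "p = of_plane x" using p unfolding DK(3) \<Omega>'_def by blast
    have tr: "of_plane y \<in> D \<inter> ball p e" if "y \<in> \<Omega> \<inter> ball x e" for y
      using that \<Omega>'D x(2) unfolding \<Omega>'_def by (auto simp: dist_of_plane)
    show "\<exists>y\<in>D \<inter> ball p e. v p < v y"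
    proof -
      obtain y where y: "y \<in> \<Omega> \<inter> ball x e" "u x < u y" using E.no_local_extremum(1)[OF x(1) e] by blast
      then have "v p < v (of_plane y)" unfolding x(2) using v\<Omega>1[OF x(1)] v\<Omega>1[of y] by simp
      then show ?thesis using tr[OF y(1)] by blast
    qed
    show "\<exists>y\<in>D \<inter> ball p e. v y < v p"
    proof -
      obtain y where y: "y \<in> \<Omega> \<inter> ball x e" "u y < u x" using E.no_local_extremum(2)[OF x(1) e] by blast
      then have "v (of_plane y) < v p" unfolding x(2) using v\<Omega>1[OF x(1)] v\<Omega>1[of y] by simp
      then show ?thesis using tr[OF y(1)] by blast
    qed
  qed
  interpret A: annular_levels D K "range c" v H
  proof
    show "\<exists>B W. open W \<and> y \<in> W \<and> B \<noteq> {} \<and> connected B \<and> W \<inter> D = B \<and> W \<subseteq> U"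
      if "y \<in> range c" "open U" "y \<in> U" for y U
      using C.inside_local_structure[OF that] unfolding D_def by metis
    show "K \<noteq> {}" using dK rngd by blast
    show "H \<le> v y" if "y \<in> range c" for y using that v\<gamma> \<psi>H unfolding cc(2) by auto
    show "finite (local_max_points (range c) (\<lambda>x. - v x))" using minima by blast
  qed (use DJ v_cont Kc vK ext in \<open>auto simp: K_def\<close>)
  have saddle: "A.saddle (of_plane x) (n x)" if x: "x \<in> critical_points \<Omega> u" for x
  proof -
    obtain T r where T: "linear T" "bij (T :: complex \<Rightarrow> real^2)" "0 < r"
      and rays: "\<And>j \<rho>. 0 < \<rho> \<Longrightarrow> \<rho> \<le> r \<Longrightarrow> x + T (\<rho> *\<^sub>R cis (real j * pi / real (n x))) \<in> \<Omega> \<and>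
       (if even j then u x < u (x + T (\<rho> *\<^sub>R cis (real j * pi / real (n x))))
        else u (x + T (\<rho> *\<^sub>R cis (real j * pi / real (n x)))) < u x)"
      using nT[OF x] by blast
    have x\<Omega>: "x \<in> \<Omega>" using x by (simp add: critical_points_def)
    let ?T = "\<lambda>z. of_plane (T z)"
    have add: "of_plane x + ?T z = of_plane (x + T z)" for z
      using linear_add[OF linear_plane(1)] by simp
    show ?thesis
      unfolding A.saddle_def
    proof (intro conjI exI[of _ ?T] exI[of _ r] allI impI)
      show "of_plane x \<in> D - K" unfolding DK(3) \<Omega>'_def using x\<Omega> by blast
      show "1 \<le> n x" using n[OF x] by simp
      show "linear ?T" using linear_compose[OF T(1) linear_plane(1)] by (simp add: o_def)
      show "inj ?T" using bij_is_inj[OF T(2)] bij_of_plane(2) by (auto simp: inj_def)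
      fix j \<rho> assume \<rho>: "0 < \<rho>" "\<rho> \<le> r"
      let ?y = "x + T (\<rho> *\<^sub>R cis (real j * pi / real (n x)))"
      have y: "?y \<in> \<Omega>" using rays[OF \<rho>] by blast
      show "of_plane x + ?T (\<rho> *\<^sub>R cis (real j * pi / real (n x))) \<in> D"
        unfolding add using y \<Omega>'D unfolding \<Omega>'_def by blast
      show "if even j then v (of_plane x) < v (of_plane x + ?T (\<rho> *\<^sub>R cis (real j * pi / real (n x))))
        else v (of_plane x + ?T (\<rho> *\<^sub>R cis (real j * pi / real (n x)))) < v (of_plane x)"
        unfolding add v\<Omega>1[OF y] v\<Omega>1[OF x\<Omega>] using rays[OF \<rho>] by blast
    qed (rule T(3))
  qed
  show "(\<Sum>x\<in>X. multiplicity_at \<Omega> u x) \<le> card (local_max_points \<gamma>E \<psi>)"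
    if X: "finite X" "X \<subseteq> critical_points \<Omega> u" for X
  proof -
    have "(\<Sum>x\<in>X. multiplicity_at \<Omega> u x) = (\<Sum>x\<in>X. n x - 1)"
      using mult_at X(2) by (intro sum.cong) auto
    also have "\<dots> = (\<Sum>z\<in>of_plane ` X. n (to_plane z) - 1)"
      by (subst sum.reindex) (auto intro: inj_on_subset[OF bij_of_plane(2)])
    also have "\<dots> \<le> card (local_max_points (range c) (\<lambda>x. - v x))"
      by (rule A.sum_saddle_orders_le) (use X saddle in auto)
    also have "\<dots> \<le> card (local_max_points (range c) v)" using minima by blast
    also have "\<dots> \<le> card (local_max_points \<gamma>E \<psi>)" unfolding lmax by (rule card_image_le[OF fin])
    finally show ?thesis .
  qed
qed

theorem theorem1p3:
  fixes \<Omega> \<gamma>I \<gamma>E :: "(real^2) set"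
    and a :: "2 \<Rightarrow> 2 \<Rightarrow> real^2 \<Rightarrow> real"
    and \<psi> u :: "real^2 \<Rightarrow> real"
    and H :: real
    and N :: nat
  assumes "smooth_annular_domain \<Omega> \<gamma>I \<gamma>E"
    and "\<forall>i j. smooth_on UNIV (a i j)"
    and "uniformly_elliptic_along a \<Omega> u"
    and "C1_on_closure \<Omega> \<psi>"
    and "\<forall>x\<in>\<gamma>E. \<psi> x \<ge> H"
    and "finite (local_max_points \<gamma>E \<psi>)"
    and "card (local_max_points \<gamma>E \<psi>) = N"
    and "classical_solution a \<Omega> u"
    and "\<forall>x\<in>\<gamma>I. u x = H"
    and "\<forall>x\<in>\<gamma>E. u x = \<psi> x"
    and "\<not> u constant_on closure \<Omega>"
  shows "finite (critical_points \<Omega> u) \<and>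
    (\<forall>x\<in>critical_points \<Omega> u. \<exists>!m. is_multiplicity \<Omega> u x m) \<and>
    (\<Sum>x\<in>critical_points \<Omega> u. multiplicity_at \<Omega> u x) \<le> N"
proof -
  note le = sum_multiplicities_le[OF assms(1,2,3,5,6,8,9,10,11)]
  have unique: "\<exists>!m. is_multiplicity \<Omega> u x m" if "x \<in> critical_points \<Omega> u" for x
    using le(1)[OF that] is_multiplicity_unique by blast
  have pos: "1 \<le> multiplicity_at \<Omega> u x" if "x \<in> critical_points \<Omega> u" for x
  proof -
    have "is_multiplicity \<Omega> u x (multiplicity_at \<Omega> u x)"
      unfolding multiplicity_at_def by (rule theI'[OF unique[OF that]])
    then show ?thesis by (simp add: is_multiplicity_def)
  qed
  \<comment> \<open>Since every multiplicity is at least 1, \<open>N + 1\<close> critical points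
    would already violate the bound.\<close>
  have "finite (critical_points \<Omega> u)"
  proof (rule ccontr)
    assume "infinite (critical_points \<Omega> u)"
    then obtain X where X: "finite X" "card X = Suc N" "X \<subseteq> critical_points \<Omega> u"
      using infinite_arbitrarily_large by blast
    have "card X \<le> (\<Sum>x\<in>X. multiplicity_at \<Omega> u x)"
      using sum_mono[of X "\<lambda>_. 1" "multiplicity_at \<Omega> u"] pos X(3) by auto
    then show False using le(2)[OF X(1,3)] X(2) assms(7) by simp
  qed
  then show ?thesis using unique le(2) assms(7) by blast
qed

end
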